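(* Let $\mathcal{E}=\mathcal{E}^1\otimes_C\mathcal{E}^2$ (with isometric morphisms $J^i:\mathcal{E}^i\to\mathcal{E}$, $i=1,2$) for spatial Arveson systems $\mathcal{E}^1$ and $\mathcal{E}^2$ and a partially isometric morphism $C:\mathcal{E}^2\to\mathcal{E}^1$, and let $u^2$ be a normalised unit of $\mathcal{E}^2$. Suppose that $\mathcal{E}$ is an Arveson system and that $u^2$ lies in the initial space of $C$: $C_t^*C_tu^2_t=u^2_t$ $(t>0)$. Then $u^1:=Cu^2=(C_tu^2_t)_{t>0}$ is a unit which is identified with $u^2$ in $\mathcal{E}$ (that is, $J^1_tu^1_t=J^2_tu^2_t$ for all $t>0$) and, denoting the common unit in $\mathcal{E}$ by $u$, $$\mathcal{R}^{\mathcal{E}}_u=\mathcal{R}^{\mathcal{E}^1}_{u^1}\oplus_{C_1}\mathcal{R}^{\mathcal{E}^2}_{u^2},$$ where the right-hand side is identified with a subspace of $\mathcal{E}_1$ via $(x_1,x_2)\mapsto J^1_1x_1+J^2_1x_2$.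
   Context: Inner products are linear in the second argument. A product system $\mathcal{E}$ is a family $(\mathcal{E}_t)_{t>0}$ of Hilbert spaces with unitary structure maps $B^{\mathcal{E}}_{s,t}:\mathcal{E}_{s+t}\to\mathcal{E}_s\otimes\mathcal{E}_t$ ($s,t>0$) satisfying $(I_{\mathcal{E}_r}\otimes B^{\mathcal{E}}_{s,t})B^{\mathcal{E}}_{r,s+t}=(B^{\mathcal{E}}_{r,s}\otimes I_{\mathcal{E}_t})B^{\mathcal{E}}_{r+s,t}$. Write $x\cdot y:=(B^{\mathcal{E}}_{s,t})^*(x\otimes y)$ for $x\in\mathcal{E}_s$, $y\in\mathcal{E}_t$. An Arveson system is a product system with every $\mathcal{E}_t$ separable, equipped with a measurable structure: a countable family of sections $(e^n)_{n\ge1}$ such that $(e^n_t)_n$ is total in $\mathcal{E}_t$ for each $t$, and $t\mapsto\langle e^m_t,e^n_t\rangle$ and $(s,t)\mapsto\langle e^l_{s+t},e^m_s\cdot e^n_t\rangle$ are measurable; a section $x$ is measurable if $t\mapsto\langle e^n_t,x_t\rangle$ is measurable for all $n$. A morphism of product systems $\phi:\mathcal{E}\to\mathcal{F}$ is a family of bounded operators $\phi_t:\mathcal{E}_t\to\mathcal{F}_t$ with $B^{\mathcal{F}}_{s,t}\phi_{s+t}=(\phi_s\otimes\phi_t)B^{\mathcal{E}}_{s,t}$ and $\|\phi_t\|\le e^{kt}$ for some $k\in\mathbb{R}$; a morphism of Arveson systems is moreover a measurable family. It is contractive, isometric or partially isometric if each $\phi_t$ is. A product subsystem of $\mathcal{E}$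 is a family of closed subspaces $\mathcal{G}_t\subset\mathcal{E}_t$ with $B^{\mathcal{E}}_{s,t}(\mathcal{G}_{s+t})=\mathcal{G}_s\otimes\mathcal{G}_t$; $\mathcal{G}^1\bigvee\mathcal{G}^2$ is the smallest product subsystem containing $\mathcal{G}^1$ and $\mathcal{G}^2$. A unit is a nonzero measurable section $u$ with $u_{s+t}=u_s\cdot u_t$; it is normalised if $\|u_t\|=1$ for all $t$; an Arveson system is spatial if it has a unit. For a normalised unit $u$ of $\mathcal{E}$, a root of $(\mathcal{E},u)$ is a measurable section $a$ with $a_{s+t}=a_s\cdot u_t+u_s\cdot a_t$ and $a_t\perp u_t$ for all $s,t>0$. $\mathcal{R}^{\mathcal{E}}_u:=\{a_1:a\text{ a root of }(\mathcal{E},u)\}$, a closed subspace of $\mathcal{E}_1$. Amalgamated product: for a contractive morphism $C:\mathcal{E}^2\to\mathcal{E}^1$ between Arveson systems there is a triple $(\mathcal{E},J^1,J^2)$, unique up to isomorphism, consisting of a product system $\mathcal{E}$ and isometric morphisms of product systems $J^i:\mathcal{E}^i\to\mathcal{E}$ with $(J^1_t)^*J^2_t=C_t$ ($t>0$) and $\mathcal{E}=J^1(\mathcal{E}^1)\bigvee J^2(\mathcal{E}^2)$; one writes $\mathcal{E}=\mathcal{E}^1\otimes_C\mathcal{E}^2$. For closed subspaces $\mathsf{H}_i\subset\mathcal{E}^i_1$ ($i=1,2$), $\mathsf{H}_1\oplus_{C_1}\mathsf{H}_2$ denotes the Hilbert space obtained from $\mathsf{H}_1\times\mathsf{H}_2$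 with the nonnegative sesquilinear form $\langle(x_1,x_2),(y_1,y_2)\rangle=\langle x_1,y_1\rangle+\langle x_1,C_1y_2\rangle+\langle C_1x_2,y_1\rangle+\langle x_2,y_2\rangle$ by quotienting by the null space and completing. The map $(x_1,x_2)\mapsto J^1_1x_1+J^2_1x_2$ induces a unitary from it onto the closed linear span of $J^1_1\mathsf{H}_1\cup J^2_1\mathsf{H}_2$ in $\mathcal{E}_1$.
   Formalization: The isometric morphisms J^1 and J^2 are assumed to be morphisms of Arveson systems, i.e. measurable families; for merely algebraic J^i (e.g. multiplied by nonmeasurable phases exp(i f(t)) with f additive) the common section u need not be measurable, hence not a unit of E. *)

theory Defs
  imports "HOL-Analysis.Analysis" "HOL-Algebra.Module" "HOL-Library.Poly_Mapping"
begin

section \<open>Complex Hilbert spaces with explicit carriers\<close>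

text \<open>
  The fibres of a product system form a family of Hilbert spaces indexed by the positive reals, so
  Hilbert spaces are records with a carrier, extending the modules of \<^theory>\<open>HOL-Algebra.Module\<close>.
  The ring multiplication and unit inherited from that record type are never used.
\<close>

definition complex_field :: "complex ring" where
  "complex_field = \<lparr>carrier = UNIV, monoid.mult = (*), one = 1, zero = 0, add = (+)\<rparr>"

record 'a hspace = "(complex, 'a) module" +
  cinner :: "'a \<Rightarrow> 'a \<Rightarrow> complex"

definition hnorm :: "'a hspace \<Rightarrow> 'a \<Rightarrow> real" where
  "hnorm V x = sqrt (Re (cinner V x x))"

definition hconverges :: "'a hspace \<Rightarrow> (nat \<Rightarrow> 'a) \<Rightarrow> 'a \<Rightarrow> bool" where
  "hconverges V X x \<longleftrightarrow> (\<lambda>n. hnorm V (X n \<ominus>\<^bsub>V\<^esub> x)) \<longlonglongrightarrow> 0"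

definition hcauchy :: "'a hspace \<Rightarrow> (nat \<Rightarrow> 'a) \<Rightarrow> bool" where
  "hcauchy V X \<longleftrightarrow> (\<forall>n. X n \<in> carrier V) \<and>
     (\<forall>\<epsilon>>0. \<exists>N. \<forall>m\<ge>N. \<forall>n\<ge>N. hnorm V (X m \<ominus>\<^bsub>V\<^esub> X n) < \<epsilon>)"

locale semi_inner_space = Module.module complex_field V for V :: "'a hspace" (structure) +
  assumes cinner_add_right:
      "\<lbrakk>x \<in> carrier V; y \<in> carrier V; z \<in> carrier V\<rbrakk>
        \<Longrightarrow> cinner V x (y \<oplus> z) = cinner V x y + cinner V x z"
    and cinner_smult_right:
      "\<lbrakk>x \<in> carrier V; y \<in> carrier V\<rbrakk> \<Longrightarrow> cinner V x (c \<odot> y) = c * cinner V x y"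
    and cinner_commute:
      "\<lbrakk>x \<in> carrier V; y \<in> carrier V\<rbrakk> \<Longrightarrow> cinner V y x = cnj (cinner V x y)"
    and cinner_nonneg: "x \<in> carrier V \<Longrightarrow> Re (cinner V x x) \<ge> 0"

locale hilbert_space = semi_inner_space +
  assumes cinner_definite: "\<lbrakk>x \<in> carrier V; cinner V x x = 0\<rbrakk> \<Longrightarrow> x = \<zero>"
    and complete: "hcauchy V X \<Longrightarrow> \<exists>x\<in>carrier V. hconverges V X x"

definition separable_hspace :: "'a hspace \<Rightarrow> bool" where
  "separable_hspace V \<longleftrightarrow> (\<exists>D. countable D \<and> D \<subseteq> carrier V \<and>
     (\<forall>x\<in>carrier V. \<forall>\<epsilon>>0. \<exists>d\<in>D. hnorm V (x \<ominus>\<^bsub>V\<^esub> d) < \<epsilon>))"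

definition closed_subspace :: "'a hspace \<Rightarrow> 'a set \<Rightarrow> bool" where
  "closed_subspace V W \<longleftrightarrow> submodule W complex_field V \<and>
     (\<forall>X x. (\<forall>n. X n \<in> W) \<longrightarrow> x \<in> carrier V \<longrightarrow> hconverges V X x \<longrightarrow> x \<in> W)"

definition closed_span :: "'a hspace \<Rightarrow> 'a set \<Rightarrow> 'a set" where
  "closed_span V S = \<Inter>{W. closed_subspace V W \<and> S \<subseteq> W}"

subsection \<open>Operators\<close>

definition linear_op :: "'a hspace \<Rightarrow> 'b hspace \<Rightarrow> ('a \<Rightarrow> 'b) \<Rightarrow> bool" where
  "linear_op V W A \<longleftrightarrow> A \<in> carrier V \<rightarrow> carrier W \<and>
     (\<forall>x\<in>carrier V. \<forall>y\<in>carrier V. A (x \<oplus>\<^bsub>V\<^esub> y) = A x \<oplus>\<^bsub>W\<^esub> A y) \<and>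
     (\<forall>c. \<forall>x\<in>carrier V. A (c \<odot>\<^bsub>V\<^esub> x) = c \<odot>\<^bsub>W\<^esub> A x)"

definition opnorm_le :: "'a hspace \<Rightarrow> 'b hspace \<Rightarrow> ('a \<Rightarrow> 'b) \<Rightarrow> real \<Rightarrow> bool" where
  "opnorm_le V W A c \<longleftrightarrow> (\<forall>x\<in>carrier V. hnorm W (A x) \<le> c * hnorm V x)"

definition bounded_op :: "'a hspace \<Rightarrow> 'b hspace \<Rightarrow> ('a \<Rightarrow> 'b) \<Rightarrow> bool" where
  "bounded_op V W A \<longleftrightarrow> linear_op V W A \<and> (\<exists>c. opnorm_le V W A c)"

definition isometric_op :: "'a hspace \<Rightarrow> 'b hspace \<Rightarrow> ('a \<Rightarrow> 'b) \<Rightarrow> bool" where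
  "isometric_op V W A \<longleftrightarrow> linear_op V W A \<and> (\<forall>x\<in>carrier V. hnorm W (A x) = hnorm V x)"

definition unitary_op :: "'a hspace \<Rightarrow> 'b hspace \<Rightarrow> ('a \<Rightarrow> 'b) \<Rightarrow> bool" where
  "unitary_op V W U \<longleftrightarrow> linear_op V W U \<and> U ` carrier V = carrier W \<and>
     (\<forall>x\<in>carrier V. \<forall>y\<in>carrier V. cinner W (U x) (U y) = cinner V x y)"

definition partially_isometric_op :: "'a hspace \<Rightarrow> 'b hspace \<Rightarrow> ('a \<Rightarrow> 'b) \<Rightarrow> bool" where
  "partially_isometric_op V W A \<longleftrightarrow> bounded_op V W A \<and>
     (\<forall>x\<in>carrier V. (\<forall>z\<in>carrier V. A z = \<zero>\<^bsub>W\<^esub> \<longrightarrow> cinner V z x = 0) \<longrightarrow>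
        hnorm W (A x) = hnorm V x)"

definition adjoint_op :: "'a hspace \<Rightarrow> 'b hspace \<Rightarrow> ('a \<Rightarrow> 'b) \<Rightarrow> 'b \<Rightarrow> 'a" where
  "adjoint_op V W A y =
     (THE x. x \<in> carrier V \<and> (\<forall>z\<in>carrier V. cinner V z x = cinner W (A z) y))"

subsection \<open>Hausdorff completion\<close>

text \<open>
  Quotienting a semi-inner-product space by its null space and completing is done in one step:
  Cauchy sequences with respect to the seminorm, modulo sequences of seminorm tending to zero.
\<close>

type_synonym 'a completion = "(nat \<Rightarrow> 'a) set"

definition completion_rel :: "'a hspace \<Rightarrow> ((nat \<Rightarrow> 'a) \<times> (nat \<Rightarrow> 'a)) set" where
  "completion_rel V = {(X, Y). hcauchy V X \<and> hcauchy V Y \<and>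
     (\<lambda>n. hnorm V (X n \<ominus>\<^bsub>V\<^esub> Y n)) \<longlonglongrightarrow> 0}"

definition completion_class :: "'a hspace \<Rightarrow> 'a \<Rightarrow> 'a completion" where
  "completion_class V v = completion_rel V `` {\<lambda>_. v}"

definition hcompletion :: "'a hspace \<Rightarrow> 'a completion hspace" where
  "hcompletion V =
     \<lparr>carrier = Collect (hcauchy V) // completion_rel V,
      monoid.mult = (\<lambda>_ _. undefined), one = undefined,
      zero = completion_class V \<zero>\<^bsub>V\<^esub>,
      add = (\<lambda>A B. \<Union>X\<in>A. \<Union>Y\<in>B. completion_rel V `` {\<lambda>n. X n \<oplus>\<^bsub>V\<^esub> Y n}),
      smult = (\<lambda>c A. \<Union>X\<in>A. completion_rel V `` {\<lambda>n. c \<odot>\<^bsub>V\<^esub> X n}),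
      cinner = (\<lambda>A B. the_elem (\<Union>X\<in>A. \<Union>Y\<in>B. {lim (\<lambda>n. cinner V (X n) (Y n))}))\<rparr>"

subsection \<open>Tensor products\<close>

text \<open>
  The Hilbert space tensor product is the Hausdorff completion of the space of finite formal
  combinations of pairs, with the semi-inner product determined by
  \<open>\<langle>x \<otimes> y, x' \<otimes> y'\<rangle> = \<langle>x, x'\<rangle> \<langle>y, y'\<rangle>\<close>; the null space contains the bilinearity relations.
\<close>

type_synonym ('a, 'b) tensor = "('a \<times> 'b \<Rightarrow>\<^sub>0 complex) completion"

definition pre_tensor :: "'a hspace \<Rightarrow> 'b hspace \<Rightarrow> ('a \<times> 'b \<Rightarrow>\<^sub>0 complex) hspace" where
  "pre_tensor V W =
     \<lparr>carrier = {f. Poly_Mapping.keys f \<subseteq> carrier V \<times> carrier W},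
      monoid.mult = (\<lambda>_ _. undefined), one = undefined,
      zero = 0, add = (+),
      smult = (\<lambda>c. Poly_Mapping.map (\<lambda>z. c * z)),
      cinner = (\<lambda>f g. \<Sum>(x, y)\<in>Poly_Mapping.keys f. \<Sum>(x', y')\<in>Poly_Mapping.keys g.
        cnj (Poly_Mapping.lookup f (x, y)) * Poly_Mapping.lookup g (x', y') *
        cinner V x x' * cinner W y y')\<rparr>"

definition htensor :: "'a hspace \<Rightarrow> 'b hspace \<Rightarrow> ('a, 'b) tensor hspace" where
  "htensor V W = hcompletion (pre_tensor V W)"

definition elem_tensor :: "'a hspace \<Rightarrow> 'b hspace \<Rightarrow> 'a \<Rightarrow> 'b \<Rightarrow> ('a, 'b) tensor" where
  "elem_tensor V W x y = completion_class (pre_tensor V W) (Poly_Mapping.single (x, y) 1)"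

text \<open>
  The next two operators are determined on the carrier of their domain, since elementary tensors
  are total.
\<close>

definition tensor_op ::
  "'a hspace \<Rightarrow> 'b hspace \<Rightarrow> 'c hspace \<Rightarrow> 'd hspace \<Rightarrow> ('a \<Rightarrow> 'c) \<Rightarrow> ('b \<Rightarrow> 'd) \<Rightarrow>
   ('a, 'b) tensor \<Rightarrow> ('c, 'd) tensor" where
  "tensor_op V W V' W' A B =
     (SOME T. bounded_op (htensor V W) (htensor V' W') T \<and>
        (\<forall>x\<in>carrier V. \<forall>y\<in>carrier W.
           T (elem_tensor V W x y) = elem_tensor V' W' (A x) (B y)))"

definition tensor_assoc ::
  "'a hspace \<Rightarrow> 'b hspace \<Rightarrow> 'c hspace \<Rightarrow>
   (('a, 'b) tensor, 'c) tensor \<Rightarrow> ('a, ('b, 'c) tensor) tensor" where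
  "tensor_assoc U V W =
     (SOME T. bounded_op (htensor (htensor U V) W) (htensor U (htensor V W)) T \<and>
        (\<forall>x\<in>carrier U. \<forall>y\<in>carrier V. \<forall>z\<in>carrier W.
           T (elem_tensor (htensor U V) W (elem_tensor U V x y) z) =
           elem_tensor U (htensor V W) x (elem_tensor V W y z)))"

definition tensor_subspace :: "'a hspace \<Rightarrow> 'b hspace \<Rightarrow> 'a set \<Rightarrow> 'b set \<Rightarrow> ('a, 'b) tensor set" where
  "tensor_subspace V W G H =
     closed_span (htensor V W) {elem_tensor V W x y |x y. x \<in> G \<and> y \<in> H}"

section \<open>Product systems\<close>

text \<open>
  Families indexed by \<open>t > 0\<close> are functions on the reals; values at nonpositive arguments are
  irrelevant throughout.
\<close>

record 'a prodsys =
  fib :: "real \<Rightarrow> 'a hspace"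
  cosplit :: "real \<Rightarrow> real \<Rightarrow> 'a \<Rightarrow> ('a, 'a) tensor"

definition product_system :: "('a, 'm) prodsys_scheme \<Rightarrow> bool" where
  "product_system E \<longleftrightarrow>
     (\<forall>t>0. hilbert_space (fib E t)) \<and>
     (\<forall>s>0. \<forall>t>0. unitary_op (fib E (s + t)) (htensor (fib E s) (fib E t)) (cosplit E s t)) \<and>
     (\<forall>r>0. \<forall>s>0. \<forall>t>0. \<forall>x\<in>carrier (fib E (r + s + t)).
        tensor_op (fib E r) (fib E (s + t)) (fib E r) (htensor (fib E s) (fib E t))
          id (cosplit E s t) (cosplit E r (s + t) x) =
        tensor_assoc (fib E r) (fib E s) (fib E t)
          (tensor_op (fib E (r + s)) (fib E t) (htensor (fib E r) (fib E s)) (fib E t)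
            (cosplit E r s) id (cosplit E (r + s) t x)))"

definition pmul :: "('a, 'm) prodsys_scheme \<Rightarrow> real \<Rightarrow> real \<Rightarrow> 'a \<Rightarrow> 'a \<Rightarrow> 'a" where
  "pmul E s t x y =
     adjoint_op (fib E (s + t)) (htensor (fib E s) (fib E t)) (cosplit E s t)
       (elem_tensor (fib E s) (fib E t) x y)"

definition prodsys_morphism ::
  "('a, 'm) prodsys_scheme \<Rightarrow> ('b, 'n) prodsys_scheme \<Rightarrow> (real \<Rightarrow> 'a \<Rightarrow> 'b) \<Rightarrow> bool" where
  "prodsys_morphism E F \<phi> \<longleftrightarrow>
     (\<forall>t>0. bounded_op (fib E t) (fib F t) (\<phi> t)) \<and>
     (\<forall>s>0. \<forall>t>0. \<forall>x\<in>carrier (fib E (s + t)).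
        cosplit F s t (\<phi> (s + t) x) =
        tensor_op (fib E s) (fib E t) (fib F s) (fib F t) (\<phi> s) (\<phi> t) (cosplit E s t x)) \<and>
     (\<exists>k. \<forall>t>0. opnorm_le (fib E t) (fib F t) (\<phi> t) (exp (k * t)))"

definition contractive_family ::
  "('a, 'm) prodsys_scheme \<Rightarrow> ('b, 'n) prodsys_scheme \<Rightarrow> (real \<Rightarrow> 'a \<Rightarrow> 'b) \<Rightarrow> bool" where
  "contractive_family E F \<phi> \<longleftrightarrow> (\<forall>t>0. opnorm_le (fib E t) (fib F t) (\<phi> t) 1)"

definition isometric_family ::
  "('a, 'm) prodsys_scheme \<Rightarrow> ('b, 'n) prodsys_scheme \<Rightarrow> (real \<Rightarrow> 'a \<Rightarrow> 'b) \<Rightarrow> bool" where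
  "isometric_family E F \<phi> \<longleftrightarrow> (\<forall>t>0. isometric_op (fib E t) (fib F t) (\<phi> t))"

definition partially_isometric_family ::
  "('a, 'm) prodsys_scheme \<Rightarrow> ('b, 'n) prodsys_scheme \<Rightarrow> (real \<Rightarrow> 'a \<Rightarrow> 'b) \<Rightarrow> bool" where
  "partially_isometric_family E F \<phi> \<longleftrightarrow>
     (\<forall>t>0. partially_isometric_op (fib E t) (fib F t) (\<phi> t))"

definition product_subsystem :: "('a, 'm) prodsys_scheme \<Rightarrow> (real \<Rightarrow> 'a set) \<Rightarrow> bool" where
  "product_subsystem E G \<longleftrightarrow>
     (\<forall>t>0. closed_subspace (fib E t) (G t)) \<and>
     (\<forall>s>0. \<forall>t>0. cosplit E s t ` G (s + t) = tensor_subspace (fib E s) (fib E t) (G s) (G t))"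

definition is_join ::
  "('a, 'm) prodsys_scheme \<Rightarrow> (real \<Rightarrow> 'a set) \<Rightarrow> (real \<Rightarrow> 'a set) \<Rightarrow> (real \<Rightarrow> 'a set) \<Rightarrow> bool" where
  "is_join E G1 G2 G \<longleftrightarrow>
     product_subsystem E G \<and> (\<forall>t>0. G1 t \<subseteq> G t \<and> G2 t \<subseteq> G t) \<and>
     (\<forall>H. product_subsystem E H \<longrightarrow> (\<forall>t>0. G1 t \<subseteq> H t \<and> G2 t \<subseteq> H t) \<longrightarrow> (\<forall>t>0. G t \<subseteq> H t))"

section \<open>Arveson systems\<close>

record 'a arveson = "'a prodsys" +
  basic :: "nat \<Rightarrow> real \<Rightarrow> 'a"

definition is_section :: "('a, 'm) prodsys_scheme \<Rightarrow> (real \<Rightarrow> 'a) \<Rightarrow> bool" where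
  "is_section E x \<longleftrightarrow> (\<forall>t>0. x t \<in> carrier (fib E t))"

definition arveson_system :: "'a arveson \<Rightarrow> bool" where
  "arveson_system E \<longleftrightarrow>
     product_system E \<and>
     (\<forall>t>0. separable_hspace (fib E t)) \<and>
     (\<forall>n. is_section E (basic E n)) \<and>
     (\<forall>t>0. closed_span (fib E t) (range (\<lambda>n. basic E n t)) = carrier (fib E t)) \<and>
     (\<forall>m n. (\<lambda>t. cinner (fib E t) (basic E m t) (basic E n t))
        \<in> borel_measurable (restrict_space borel {0<..})) \<and>
     (\<forall>l m n. (\<lambda>(s, t). cinner (fib E (s + t)) (basic E l (s + t))
                          (pmul E s t (basic E m s) (basic E n t)))
        \<in> borel_measurable (restrict_space borel ({0<..} \<times> {0<..})))"

definition measurable_section :: "'a arveson \<Rightarrow> (real \<Rightarrow> 'a) \<Rightarrow> bool" where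
  "measurable_section E x \<longleftrightarrow> is_section E x \<and>
     (\<forall>n. (\<lambda>t. cinner (fib E t) (basic E n t) (x t))
        \<in> borel_measurable (restrict_space borel {0<..}))"

definition arveson_morphism :: "'a arveson \<Rightarrow> 'b arveson \<Rightarrow> (real \<Rightarrow> 'a \<Rightarrow> 'b) \<Rightarrow> bool" where
  "arveson_morphism E F \<phi> \<longleftrightarrow> prodsys_morphism E F \<phi> \<and>
     (\<forall>x. measurable_section E x \<longrightarrow> measurable_section F (\<lambda>t. \<phi> t (x t)))"

definition is_unit :: "'a arveson \<Rightarrow> (real \<Rightarrow> 'a) \<Rightarrow> bool" where
  "is_unit E u \<longleftrightarrow> measurable_section E u \<and> (\<exists>t>0. u t \<noteq> \<zero>\<^bsub>fib E t\<^esub>) \<and>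
     (\<forall>s>0. \<forall>t>0. u (s + t) = pmul E s t (u s) (u t))"

definition normalised_unit :: "'a arveson \<Rightarrow> (real \<Rightarrow> 'a) \<Rightarrow> bool" where
  "normalised_unit E u \<longleftrightarrow> is_unit E u \<and> (\<forall>t>0. hnorm (fib E t) (u t) = 1)"

definition spatial :: "'a arveson \<Rightarrow> bool" where
  "spatial E \<longleftrightarrow> (\<exists>u. is_unit E u)"

definition is_root :: "'a arveson \<Rightarrow> (real \<Rightarrow> 'a) \<Rightarrow> (real \<Rightarrow> 'a) \<Rightarrow> bool" where
  "is_root E u a \<longleftrightarrow> measurable_section E a \<and>
     (\<forall>s>0. \<forall>t>0. a (s + t) =
        pmul E s t (a s) (u t) \<oplus>\<^bsub>fib E (s + t)\<^esub> pmul E s t (u s) (a t)) \<and>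
     (\<forall>t>0. cinner (fib E t) (a t) (u t) = 0)"

definition root_space :: "'a arveson \<Rightarrow> (real \<Rightarrow> 'a) \<Rightarrow> 'a set" where
  "root_space E u = {a 1 |a. is_root E u a}"

section \<open>Amalgamation\<close>

definition amalgamated_product ::
  "('a, 'k) prodsys_scheme \<Rightarrow> ('b, 'm) prodsys_scheme \<Rightarrow> (real \<Rightarrow> 'b \<Rightarrow> 'a) \<Rightarrow>
   ('c, 'n) prodsys_scheme \<Rightarrow> (real \<Rightarrow> 'a \<Rightarrow> 'c) \<Rightarrow> (real \<Rightarrow> 'b \<Rightarrow> 'c) \<Rightarrow> bool" where
  "amalgamated_product E1 E2 C E J1 J2 \<longleftrightarrow>
     contractive_family E2 E1 C \<and>
     product_system E \<and>
     prodsys_morphism E1 E J1 \<and> isometric_family E1 E J1 \<and>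
     prodsys_morphism E2 E J2 \<and> isometric_family E2 E J2 \<and>
     (\<forall>t>0. \<forall>y\<in>carrier (fib E2 t). adjoint_op (fib E1 t) (fib E t) (J1 t) (J2 t y) = C t y) \<and>
     is_join E (\<lambda>t. J1 t ` carrier (fib E1 t)) (\<lambda>t. J2 t ` carrier (fib E2 t))
       (\<lambda>t. carrier (fib E t))"

definition pre_amalgamated_sum ::
  "'a hspace \<Rightarrow> 'b hspace \<Rightarrow> ('b \<Rightarrow> 'a) \<Rightarrow> 'a set \<Rightarrow> 'b set \<Rightarrow> ('a \<times> 'b) hspace" where
  "pre_amalgamated_sum V W C H1 H2 =
     \<lparr>carrier = H1 \<times> H2,
      monoid.mult = (\<lambda>_ _. undefined), one = undefined,
      zero = (\<zero>\<^bsub>V\<^esub>, \<zero>\<^bsub>W\<^esub>),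
      add = (\<lambda>(x1, x2) (y1, y2). (x1 \<oplus>\<^bsub>V\<^esub> y1, x2 \<oplus>\<^bsub>W\<^esub> y2)),
      smult = (\<lambda>c (x1, x2). (c \<odot>\<^bsub>V\<^esub> x1, c \<odot>\<^bsub>W\<^esub> x2)),
      cinner = (\<lambda>(x1, x2) (y1, y2).
        cinner V x1 y1 + cinner V x1 (C y2) + cinner V (C x2) y1 + cinner W x2 y2)\<rparr>"

definition amalgamated_sum ::
  "'a hspace \<Rightarrow> 'b hspace \<Rightarrow> ('b \<Rightarrow> 'a) \<Rightarrow> 'a set \<Rightarrow> 'b set \<Rightarrow> ('a \<times> 'b) completion hspace" where
  "amalgamated_sum V W C H1 H2 = hcompletion (pre_amalgamated_sum V W C H1 H2)"

text \<open>
  \<open>R\<close> is the amalgamated sum of \<open>H1\<close> and \<open>H2\<close> under the identification of \<open>(x1, x2)\<close> with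
  \<open>A1 x1 + A2 x2\<close> in \<open>U\<close>: the map extends to a unitary from the completion onto \<open>R\<close>. A unitary
  extension is unique, because the classes of pairs are dense.
\<close>

definition identified_amalgamated_sum ::
  "'c hspace \<Rightarrow> 'c set \<Rightarrow> ('a \<Rightarrow> 'c) \<Rightarrow> ('b \<Rightarrow> 'c) \<Rightarrow>
   'a hspace \<Rightarrow> 'b hspace \<Rightarrow> ('b \<Rightarrow> 'a) \<Rightarrow> 'a set \<Rightarrow> 'b set \<Rightarrow> bool" where
  "identified_amalgamated_sum U R A1 A2 V W C H1 H2 \<longleftrightarrow>
     (\<exists>\<Phi>. unitary_op (amalgamated_sum V W C H1 H2) (U\<lparr>carrier := R\<rparr>) \<Phi> \<and>
        (\<forall>x1\<in>H1. \<forall>x2\<in>H2.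
           \<Phi> (completion_class (pre_amalgamated_sum V W C H1 H2) (x1, x2)) =
           A1 x1 \<oplus>\<^bsub>U\<^esub> A2 x2))"

end

theory Submission
  imports Defs
begin

text \<open>
  Let \<open>P\<^sub>i\<close> be the projection onto the range of \<open>J\<^sub>i\<close>. Since \<open>J\<^sub>i\<close> and its adjoint both map roots to roots,
  \<open>P\<^sub>i\<close> maps roots of \<open>(\<E>, u)\<close> to roots. For a root \<open>a\<close> put \<open>w = a - P\<^sub>2 a\<close> and \<open>b = w - P\<^sub>1 w\<close>. Because \<open>C\<close> is
  partially isometric, \<open>P\<^sub>1\<close> leaves the range of \<open>J\<^sub>2\<close> invariant, so \<open>b\<close> is orthogonal to both ranges.
  By the root equation \<open>b\<close> is then orthogonal to all products of elements of the two ranges; these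
  generate \<open>\<E>\<close>, so \<open>b = 0\<close> and \<open>a = P\<^sub>1 w + P\<^sub>2 a\<close>. Hence the root space of \<open>u\<close> is already the
  algebraic sum of the images of the two root spaces. It is closed since \<open>\<parallel>a\<^sub>t\<parallel>\<^sup>2 = t \<parallel>a\<^sub>1\<parallel>\<^sup>2\<close> for
  every root \<open>a\<close>.
\<close>

section \<open>Inner product spaces with explicit carriers\<close>

text \<open>Subtracting two projections in turn does not in general give a vector orthogonal to both
  ranges. Here it does: \<open>C t\<close> is the adjoint of \<open>J1 t\<close> composed with
  \<open>J2 t\<close>, and wherever it preserves the norm of \<open>y\<close> the vectors
  \<open>J1 t (C t y)\<close> and \<open>J2 t y\<close> are at distance zero. The same computation
  identifies the two units.

  Two obstacles lie outside this geometry. Minimality of the join can be used only against families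
  that are product subsystems, so the family generated by both ranges must factor at every cut of
  the time interval; products give one inclusion, the other requires recutting a product inside one
  of its factors. Moreover, sections are tested only against the basic sections of their own system.
  Applying the adjoint of \<open>J1\<close> or \<open>J2\<close> to a root tests it against images
  of basic sections, so inner products of arbitrary measurable sections must be measurable; this
  rests on a countable supremum formula for the norm.

  Tensor operators and reassociation maps are given by choice, hence each is first constructed as an
  isometric extension from elementary tensors.\<close>

lemma complex_field_simps [simp]:
  "carrier complex_field = UNIV" "a \<oplus>\<^bsub>complex_field\<^esub> b = a + b" "a \<otimes>\<^bsub>complex_field\<^esub> b = a * b"
  "\<one>\<^bsub>complex_field\<^esub> = 1" "\<zero>\<^bsub>complex_field\<^esub> = 0"
  by (simp_all add: complex_field_def)

lemma cring_complex_field: "cring complex_field"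
proof (intro cringI abelian_groupI comm_monoidI)
  fix x :: complex
  have "- x + x = 0" by simp
  then show "\<exists>y\<in>carrier complex_field. y \<oplus>\<^bsub>complex_field\<^esub> x = \<zero>\<^bsub>complex_field\<^esub>"
    by (intro bexI[of _ "-x"]) auto
qed (simp_all add: algebra_simps)

lemma minus_complex_field [simp]: "\<ominus>\<^bsub>complex_field\<^esub> a = - a"
proof -
  interpret cring complex_field by (rule cring_complex_field)
  have "\<ominus>\<^bsub>complex_field\<^esub> a = - a"
    by (rule minus_equality) auto
  then show ?thesis by simp
qed

text \<open>Unfolds the module axioms over \<open>complex_field\<close> once, for the three spaces
  built later: completions, formal combinations of pairs, and pairs under the amalgamated
  form.\<close>

lemma semi_inner_spaceI:
  assumes "abelian_group V"
    and "\<And>c x. x \<in> carrier V \<Longrightarrow> c \<odot>\<^bsub>V\<^esub> x \<in> carrier V"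
    and "\<And>a b x. x \<in> carrier V \<Longrightarrow> (a + b) \<odot>\<^bsub>V\<^esub> x = a \<odot>\<^bsub>V\<^esub> x \<oplus>\<^bsub>V\<^esub> b \<odot>\<^bsub>V\<^esub> x"
    and "\<And>a x y. \<lbrakk>x \<in> carrier V; y \<in> carrier V\<rbrakk> \<Longrightarrow> a \<odot>\<^bsub>V\<^esub> (x \<oplus>\<^bsub>V\<^esub> y) = a \<odot>\<^bsub>V\<^esub> x \<oplus>\<^bsub>V\<^esub> a \<odot>\<^bsub>V\<^esub> y"
    and "\<And>a b x. x \<in> carrier V \<Longrightarrow> (a * b) \<odot>\<^bsub>V\<^esub> x = a \<odot>\<^bsub>V\<^esub> (b \<odot>\<^bsub>V\<^esub> x)"
    and "\<And>x. x \<in> carrier V \<Longrightarrow> 1 \<odot>\<^bsub>V\<^esub> x = x"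
    and "\<And>x y z. \<lbrakk>x \<in> carrier V; y \<in> carrier V; z \<in> carrier V\<rbrakk>
        \<Longrightarrow> cinner V x (y \<oplus>\<^bsub>V\<^esub> z) = cinner V x y + cinner V x z"
    and "\<And>c x y. \<lbrakk>x \<in> carrier V; y \<in> carrier V\<rbrakk> \<Longrightarrow> cinner V x (c \<odot>\<^bsub>V\<^esub> y) = c * cinner V x y"
    and "\<And>x y. \<lbrakk>x \<in> carrier V; y \<in> carrier V\<rbrakk> \<Longrightarrow> cinner V y x = cnj (cinner V x y)"
    and "\<And>x. x \<in> carrier V \<Longrightarrow> Re (cinner V x x) \<ge> 0"
  shows "semi_inner_space V"
proof -
  interpret Module.module complex_field V
    by (rule moduleI) (simp_all add: assms(1-6) cring_complex_field)
  show ?thesis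
    by unfold_locales (fact assms)+
qed

section \<open>Cauchy-Schwarz, norms and convergence for a semidefinite form\<close>

context semi_inner_space
begin

lemma smult_mem [simp, intro]: "x \<in> carrier V \<Longrightarrow> c \<odot> x \<in> carrier V"
  by simp

lemma smult_1 [simp]: "x \<in> carrier V \<Longrightarrow> 1 \<odot> x = x"
  using smult_one by simp

lemma smult_0 [simp]: "x \<in> carrier V \<Longrightarrow> 0 \<odot> x = \<zero>"
  using smult_l_null by simp

lemma smult_smult: "x \<in> carrier V \<Longrightarrow> a \<odot> (b \<odot> x) = (a * b) \<odot> x"
  using smult_assoc1[of a b x] by simp

lemma minus_eq_smult: "x \<in> carrier V \<Longrightarrow> y \<in> carrier V \<Longrightarrow> x \<ominus> y = x \<oplus> (-1) \<odot> y"
  using smult_l_minus[of 1 y] by (simp add: a_minus_def)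

lemma diff_eq_zero_iff [simp]: "x \<in> carrier V \<Longrightarrow> y \<in> carrier V \<Longrightarrow> x \<ominus> y = \<zero> \<longleftrightarrow> x = y"
  using M.minus_equality[of x "\<ominus> y"] by (auto simp: a_minus_def M.r_neg)

lemma cinner_add_left:
  "\<lbrakk>x \<in> carrier V; y \<in> carrier V; z \<in> carrier V\<rbrakk> \<Longrightarrow> cinner V (x \<oplus> y) z = cinner V x z + cinner V y z"
  using cinner_commute[of z "x \<oplus> y"] cinner_commute[of z x] cinner_commute[of z y]
  by (simp add: cinner_add_right)

lemma cinner_smult_left:
  "\<lbrakk>x \<in> carrier V; y \<in> carrier V\<rbrakk> \<Longrightarrow> cinner V (c \<odot> x) y = cnj c * cinner V x y"
  using cinner_commute[of y "c \<odot> x"] cinner_commute[of y x] by (simp add: cinner_smult_right)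

lemma cinner_minus_right:
  "\<lbrakk>x \<in> carrier V; y \<in> carrier V; z \<in> carrier V\<rbrakk> \<Longrightarrow> cinner V x (y \<ominus> z) = cinner V x y - cinner V x z"
  by (simp add: minus_eq_smult cinner_add_right cinner_smult_right)

lemma cinner_minus_left:
  "\<lbrakk>x \<in> carrier V; y \<in> carrier V; z \<in> carrier V\<rbrakk> \<Longrightarrow> cinner V (x \<ominus> y) z = cinner V x z - cinner V y z"
  by (simp add: minus_eq_smult cinner_add_left cinner_smult_left)

lemma cinner_zero_right [simp]: "x \<in> carrier V \<Longrightarrow> cinner V x \<zero> = 0"
  using cinner_smult_right[of x x 0] by simp

lemma cinner_zero_left [simp]: "x \<in> carrier V \<Longrightarrow> cinner V \<zero> x = 0"
  using cinner_smult_left[of x x 0] by simp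

lemmas cinner_simps = cinner_add_left cinner_add_right cinner_smult_left cinner_smult_right
  cinner_minus_left cinner_minus_right

lemma hnorm_nonneg [simp]: "x \<in> carrier V \<Longrightarrow> 0 \<le> hnorm V x"
  by (simp add: hnorm_def cinner_nonneg)

lemma Re_cinner_self: "x \<in> carrier V \<Longrightarrow> Re (cinner V x x) = (hnorm V x)\<^sup>2"
  by (simp add: hnorm_def cinner_nonneg)

lemma cinner_self: "x \<in> carrier V \<Longrightarrow> cinner V x x = complex_of_real ((hnorm V x)\<^sup>2)"
  using cinner_commute[of x x] by (simp add: complex_eq_iff flip: Re_cinner_self)

text \<open>Vector identities under a norm are verified through this rule by expanding inner
  products, which leaves arithmetic in the complex numbers instead of rearrangements in an abelian
  group.\<close>

lemma hnorm_eqI: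
  "\<lbrakk>x \<in> carrier V; y \<in> carrier V; cinner V x x = cinner V y y\<rbrakk> \<Longrightarrow> hnorm V x = hnorm V y"
  by (simp add: hnorm_def)

lemma hnorm_zero [simp]: "hnorm V \<zero> = 0"
  by (simp add: hnorm_def)

lemma hnorm_smult: "x \<in> carrier V \<Longrightarrow> hnorm V (c \<odot> x) = norm c * hnorm V x"
proof -
  assume x: "x \<in> carrier V"
  have "cinner V (c \<odot> x) (c \<odot> x) = of_real ((norm c * hnorm V x)\<^sup>2)"
    using x complex_norm_square[of c]
    by (simp add: cinner_simps) (simp add: cinner_self power_mult_distrib mult.commute)
  then have "(hnorm V (c \<odot> x))\<^sup>2 = (norm c * hnorm V x)\<^sup>2"
    using x by (simp flip: Re_cinner_self)
  then show ?thesis using x by simp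
qed

lemma Re_cinner_le: "\<lbrakk>x \<in> carrier V; y \<in> carrier V\<rbrakk> \<Longrightarrow> Re (cinner V x y) \<le> hnorm V x * hnorm V y"
proof -
  assume x: "x \<in> carrier V" and y: "y \<in> carrier V"
  define a b r where "a = hnorm V x" and "b = hnorm V y" and "r = Re (cinner V x y)"
  have nn: "a \<ge> 0" "b \<ge> 0" using x y by (auto simp: a_def b_def)
  have q: "0 \<le> s\<^sup>2 * a\<^sup>2 - 2 * s * t * r + t\<^sup>2 * b\<^sup>2" for s t :: real
  proof -
    have "0 \<le> Re (cinner V (of_real s \<odot> x \<ominus> of_real t \<odot> y) (of_real s \<odot> x \<ominus> of_real t \<odot> y))"
      using x y by (intro cinner_nonneg) auto
    also have "\<dots> = s\<^sup>2 * a\<^sup>2 - 2 * s * t * r + t\<^sup>2 * b\<^sup>2"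
      using x y cinner_commute[OF x y]
      by (simp add: cinner_simps) (simp add: a_def b_def r_def cinner_self power2_eq_square algebra_simps)
    finally show ?thesis .
  qed
  show "r \<le> a * b"
  \<comment> \<open>The form is only semidefinite, so a vanishing norm does not make the vector
    zero. In that case the quadratic is affine in the remaining parameter, and a large value of it
    rules out \<open>r > 0\<close>.\<close>
  proof (cases "a = 0 \<or> b = 0")
    case True
    then show ?thesis
    proof
      assume "a = 0"
      then have "2 * s * r \<le> b\<^sup>2" for s using q[of s 1] by simp
      from this[of "(b\<^sup>2 + 1) / r"] have "2 * (b\<^sup>2 + 1) \<le> b\<^sup>2" if "r > 0" using that by simp
      then have "\<not> r > 0" by (smt (verit) zero_le_power2)
      then show ?thesis using \<open>a = 0\<close> by simp
    next
      assume "b = 0"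
      then have "2 * s * r \<le> a\<^sup>2" for s using q[of 1 s] by simp
      from this[of "(a\<^sup>2 + 1) / r"] have "2 * (a\<^sup>2 + 1) \<le> a\<^sup>2" if "r > 0" using that by simp
      then have "\<not> r > 0" by (smt (verit) zero_le_power2)
      then show ?thesis using \<open>b = 0\<close> by simp
    qed
  next
    case False
    then have pos: "a > 0" "b > 0" using nn by auto
    \<comment> \<open>The weights \<open>b\<close> and \<open>a\<close> make the two square terms
      equal, so that \<open>a * b\<close> factors out.\<close>
    have "0 \<le> 2 * (a * b) * (a * b - r)" using q[of b a] by (simp add: power2_eq_square algebra_simps)
    then have "0 \<le> a * b - r" using pos
      by (metis mult_pos_pos not_less zero_le_mult_iff zero_less_numeral)
    then show ?thesis by simp
  qed
qed

lemma norm_cinner_le: "\<lbrakk>x \<in> carrier V; y \<in> carrier V\<rbrakk> \<Longrightarrow> norm (cinner V x y) \<le> hnorm V x * hnorm V y"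
proof -
  assume x: "x \<in> carrier V" and y: "y \<in> carrier V"
  define z where "z = cinner V x y"
  show ?thesis
  proof (cases "z = 0")
    case True
    then show ?thesis using x y by (simp add: z_def)
  next
    case False
    \<comment> \<open>A phase that rotates \<open>z\<close> onto the positive real axis reduces the
      modulus to the real part.\<close>
    define c where "c = cnj z / of_real (norm z)"
    have n: "norm c = 1" using False by (simp add: c_def norm_divide)
    have "cinner V x (c \<odot> y) = of_real (norm z)"
      using False x y complex_norm_square[of z]
      by (simp add: cinner_simps c_def flip: z_def) (simp add: field_simps power2_eq_square)
    then show ?thesis
      using Re_cinner_le[of x "c \<odot> y"] x y n by (simp add: hnorm_smult z_def)
  qed
qed

lemma hnorm_triangle:
  "\<lbrakk>x \<in> carrier V; y \<in> carrier V\<rbrakk> \<Longrightarrow> hnorm V (x \<oplus> y) \<le> hnorm V x + hnorm V y"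
proof -
  assume x: "x \<in> carrier V" and y: "y \<in> carrier V"
  have "(hnorm V (x \<oplus> y))\<^sup>2 = (hnorm V x)\<^sup>2 + 2 * Re (cinner V x y) + (hnorm V y)\<^sup>2"
    using x y cinner_commute[OF x y]
    by (simp flip: Re_cinner_self add: cinner_simps)
  also have "\<dots> \<le> (hnorm V x + hnorm V y)\<^sup>2"
    using Re_cinner_le[OF x y] by (simp add: power2_sum)
  finally show ?thesis using x y by (meson add_nonneg_nonneg hnorm_nonneg power2_le_imp_le)
qed

lemma hnorm_minus_commute:
  "\<lbrakk>x \<in> carrier V; y \<in> carrier V\<rbrakk> \<Longrightarrow> hnorm V (x \<ominus> y) = hnorm V (y \<ominus> x)"
  by (rule hnorm_eqI) (auto simp: cinner_simps)

lemma hnorm_diff_triangle: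
  "\<lbrakk>x \<in> carrier V; y \<in> carrier V; z \<in> carrier V\<rbrakk>
    \<Longrightarrow> hnorm V (x \<ominus> z) \<le> hnorm V (x \<ominus> y) + hnorm V (y \<ominus> z)"
proof -
  assume *: "x \<in> carrier V" "y \<in> carrier V" "z \<in> carrier V"
  have "hnorm V (x \<ominus> z) = hnorm V ((x \<ominus> y) \<oplus> (y \<ominus> z))"
    using * by (intro hnorm_eqI) (auto simp: cinner_simps)
  then show ?thesis using hnorm_triangle[of "x \<ominus> y" "y \<ominus> z"] * by simp
qed

lemma hnorm_diff_add:
  "\<lbrakk>x \<in> carrier V; y \<in> carrier V; x' \<in> carrier V; y' \<in> carrier V\<rbrakk>
    \<Longrightarrow> hnorm V ((x \<oplus> y) \<ominus> (x' \<oplus> y')) \<le> hnorm V (x \<ominus> x') + hnorm V (y \<ominus> y')"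
proof -
  assume *: "x \<in> carrier V" "y \<in> carrier V" "x' \<in> carrier V" "y' \<in> carrier V"
  have "hnorm V ((x \<oplus> y) \<ominus> (x' \<oplus> y')) = hnorm V ((x \<ominus> x') \<oplus> (y \<ominus> y'))"
    using * by (intro hnorm_eqI) (auto simp: cinner_simps)
  then show ?thesis using hnorm_triangle[of "x \<ominus> x'" "y \<ominus> y'"] * by simp
qed

lemma hnorm_diff_smult:
  "\<lbrakk>x \<in> carrier V; y \<in> carrier V\<rbrakk> \<Longrightarrow> hnorm V (c \<odot> x \<ominus> c \<odot> y) = norm c * hnorm V (x \<ominus> y)"
proof -
  assume *: "x \<in> carrier V" "y \<in> carrier V"
  have "hnorm V (c \<odot> x \<ominus> c \<odot> y) = hnorm V (c \<odot> (x \<ominus> y))"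
    using * by (intro hnorm_eqI) (auto simp: cinner_simps algebra_simps)
  then show ?thesis using * by (simp add: hnorm_smult)
qed

lemma hnorm_le_diff: "\<lbrakk>x \<in> carrier V; y \<in> carrier V\<rbrakk> \<Longrightarrow> hnorm V x \<le> hnorm V y + hnorm V (x \<ominus> y)"
proof -
  assume *: "x \<in> carrier V" "y \<in> carrier V"
  have "hnorm V x = hnorm V (y \<oplus> (x \<ominus> y))"
    using * by (intro hnorm_eqI) (auto simp: cinner_simps)
  then show ?thesis using hnorm_triangle[of y "x \<ominus> y"] * by simp
qed

lemma hnorm_self_diff [simp]: "x \<in> carrier V \<Longrightarrow> hnorm V (x \<ominus> x) = 0"
  by (simp add: hnorm_def cinner_simps)

lemma hconverges_const [simp]: "x \<in> carrier V \<Longrightarrow> hconverges V (\<lambda>_. x) x"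
  by (simp add: hconverges_def)

lemma hconverges_add:
  assumes "\<And>n. X n \<in> carrier V" "\<And>n. Y n \<in> carrier V" "x \<in> carrier V" "y \<in> carrier V"
    "hconverges V X x" "hconverges V Y y"
  shows "hconverges V (\<lambda>n. X n \<oplus> Y n) (x \<oplus> y)"
  unfolding hconverges_def
proof (rule tendsto_sandwich[OF _ _ tendsto_const])
  show "(\<lambda>n. hnorm V (X n \<ominus> x) + hnorm V (Y n \<ominus> y)) \<longlonglongrightarrow> 0"
    using tendsto_add[OF assms(5,6)[unfolded hconverges_def]] by simp
qed (use assms in \<open>auto intro!: always_eventually hnorm_diff_add\<close>)

lemma hconverges_smult:
  assumes "\<And>n. X n \<in> carrier V" "x \<in> carrier V" "hconverges V X x"
  shows "hconverges V (\<lambda>n. c \<odot> X n) (c \<odot> x)"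
  using tendsto_mult_left[OF assms(3)[unfolded hconverges_def], of "norm c"] assms(1,2)
  by (simp add: hconverges_def hnorm_diff_smult)

lemma hnorm_bounded_hconverges:
  assumes "\<And>n. X n \<in> carrier V" "x \<in> carrier V" "hconverges V X x"
  shows "\<exists>B. \<forall>n. hnorm V (X n) \<le> B"
proof -
  have "Bseq (\<lambda>n. hnorm V (X n \<ominus> x))"
    using assms(3) by (intro convergent_imp_Bseq convergentI) (auto simp: hconverges_def)
  then obtain K where K: "\<And>n. norm (hnorm V (X n \<ominus> x)) \<le> K" by (auto simp: Bseq_def)
  have "hnorm V (X n) \<le> hnorm V x + K" for n
    using hnorm_le_diff[OF assms(1)[of n] assms(2)] K[of n] by simp
  then show ?thesis by blast
qed

lemma norm_cinner_diff_le:
  assumes "x \<in> carrier V" "y \<in> carrier V" "x' \<in> carrier V" "y' \<in> carrier V"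
  shows "norm (cinner V x y - cinner V x' y') \<le> hnorm V x * hnorm V (y \<ominus> y') + hnorm V (x \<ominus> x') * hnorm V y'"
proof -
  have "cinner V x y - cinner V x' y' = cinner V x (y \<ominus> y') + cinner V (x \<ominus> x') y'"
    using assms by (simp add: cinner_simps)
  also have "norm \<dots> \<le> norm (cinner V x (y \<ominus> y')) + norm (cinner V (x \<ominus> x') y')"
    by (rule norm_triangle_ineq)
  also have "\<dots> \<le> hnorm V x * hnorm V (y \<ominus> y') + hnorm V (x \<ominus> x') * hnorm V y'"
    using assms by (intro add_mono norm_cinner_le) auto
  finally show ?thesis .
qed

lemma cinner_tendsto:
  assumes X: "\<And>n. X n \<in> carrier V" "x \<in> carrier V" "hconverges V X x"
    and Y: "\<And>n. Y n \<in> carrier V" "y \<in> carrier V" "hconverges V Y y"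
  shows "(\<lambda>n. cinner V (X n) (Y n)) \<longlonglongrightarrow> cinner V x y"
proof -
  obtain B where B: "\<And>n. hnorm V (X n) \<le> B" using hnorm_bounded_hconverges[OF X] by auto
  have le: "norm (cinner V (X n) (Y n) - cinner V x y) \<le> B * hnorm V (Y n \<ominus> y) + hnorm V (X n \<ominus> x) * hnorm V y" for n
    using norm_cinner_diff_le[OF X(1)[of n] Y(1)[of n] X(2) Y(2)] mult_right_mono[OF B[of n], of "hnorm V (Y n \<ominus> y)"]
      Y(1)[of n] Y(2) by simp
  have "(\<lambda>n. B * hnorm V (Y n \<ominus> y) + hnorm V (X n \<ominus> x) * hnorm V y) \<longlonglongrightarrow> B * 0 + 0 * hnorm V y"
    by (intro tendsto_intros) (use X(3) Y(3) in \<open>auto simp: hconverges_def\<close>)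
  then have lim: "(\<lambda>n. B * hnorm V (Y n \<ominus> y) + hnorm V (X n \<ominus> x) * hnorm V y) \<longlonglongrightarrow> 0" by simp
  have "(\<lambda>n. cinner V (X n) (Y n) - cinner V x y) \<longlonglongrightarrow> 0"
    by (rule Lim_null_comparison[OF _ lim]) (simp add: le)
  then show ?thesis by (simp add: LIM_zero_iff)
qed

lemma hnorm_tendsto:
  assumes X: "\<And>n. X n \<in> carrier V" "x \<in> carrier V" "hconverges V X x"
  shows "(\<lambda>n. hnorm V (X n)) \<longlonglongrightarrow> hnorm V x"
  unfolding hnorm_def
  by (intro tendsto_real_sqrt tendsto_Re cinner_tendsto X)

lemma hconverges_hcauchy:
  assumes X: "\<And>n. X n \<in> carrier V" "x \<in> carrier V" "hconverges V X x"
  shows "hcauchy V X"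
  unfolding hcauchy_def
proof (intro conjI allI impI)
  fix e :: real assume "e > 0"
  then have "\<forall>\<^sub>F n in sequentially. hnorm V (X n \<ominus> x) < e/2"
    using X(3) by (auto simp: hconverges_def dest!: order_tendstoD(2)[of _ _ _ "e/2"])
  then obtain N where N: "\<And>n. n \<ge> N \<Longrightarrow> hnorm V (X n \<ominus> x) < e/2" by (auto simp: eventually_sequentially)
  have "hnorm V (X m \<ominus> X n) < e" if "m \<ge> N" "n \<ge> N" for m n
    using hnorm_diff_triangle[of "X m" x "X n"] hnorm_minus_commute[of x "X n"] N[of m] N[of n] that X by auto
  then show "\<exists>N. \<forall>m\<ge>N. \<forall>n\<ge>N. hnorm V (X m \<ominus> X n) < e" by blast
qed (use X in auto)

section \<open>Closed subspaces and closed spans\<close>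

lemma closed_subspaceD:
  assumes "closed_subspace V W"
  shows "W \<subseteq> carrier V" "\<zero> \<in> W" "\<And>x y. x \<in> W \<Longrightarrow> y \<in> W \<Longrightarrow> x \<oplus> y \<in> W"
    "\<And>c x. x \<in> W \<Longrightarrow> c \<odot> x \<in> W" "\<And>x y. x \<in> W \<Longrightarrow> y \<in> W \<Longrightarrow> x \<ominus> y \<in> W"
    "\<And>X x. (\<And>n. X n \<in> W) \<Longrightarrow> x \<in> carrier V \<Longrightarrow> hconverges V X x \<Longrightarrow> x \<in> W"
proof -
  have s: "submodule W complex_field V" using assms by (simp add: closed_subspace_def)
  note E = submoduleE[OF s]
  show 1: "W \<subseteq> carrier V" by (rule E)
  show add: "\<And>x y. x \<in> W \<Longrightarrow> y \<in> W \<Longrightarrow> x \<oplus> y \<in> W" by (rule E)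
  show sm: "\<And>c x. x \<in> W \<Longrightarrow> c \<odot> x \<in> W" using E(4) by simp
  show "\<zero> \<in> W" 
  proof -
    obtain w where "w \<in> W" using E(2) by blast
    then show ?thesis using sm[of w 0] 1 by auto
  qed
  show "x \<ominus> y \<in> W" if "x \<in> W" "y \<in> W" for x y
    using that 1 add[OF that(1) sm[OF that(2), of "-1"]] by (simp add: minus_eq_smult subset_iff)
  show "\<And>X x. (\<And>n. X n \<in> W) \<Longrightarrow> x \<in> carrier V \<Longrightarrow> hconverges V X x \<Longrightarrow> x \<in> W"
    using assms by (auto simp: closed_subspace_def)
qed

lemma closed_subspaceI:
  assumes "W \<subseteq> carrier V" "\<zero> \<in> W" "\<And>x y. x \<in> W \<Longrightarrow> y \<in> W \<Longrightarrow> x \<oplus> y \<in> W"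
    "\<And>c x. x \<in> W \<Longrightarrow> c \<odot> x \<in> W"
    "\<And>X x. (\<And>n. X n \<in> W) \<Longrightarrow> x \<in> carrier V \<Longrightarrow> hconverges V X x \<Longrightarrow> x \<in> W"
  shows "closed_subspace V W"
  unfolding closed_subspace_def
proof (intro conjI allI impI submoduleI)
  show "\<ominus> a \<in> W" if "a \<in> W" for a
    using assms(4)[OF that, of "-1"] smult_l_minus[of 1 a] that assms(1) by auto
  show "x \<in> W" if "\<forall>n. X n \<in> W" "x \<in> carrier V" "hconverges V X x" for X x
    using assms(5) that by blast
qed (use assms(1-4) in auto)

lemma closed_subspace_carrier: "closed_subspace V (carrier V)"
  by (rule closed_subspaceI) auto

text \<open>Lets orthogonality pass from a generating set to its closed span, by minimality of the
  latter.\<close>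

lemma closed_subspace_orth:
  "z \<in> carrier V \<Longrightarrow> closed_subspace V {x \<in> carrier V. cinner V z x = 0}"
proof (rule closed_subspaceI)
  fix X x assume z: "z \<in> carrier V" and X: "\<And>n. X n \<in> {x \<in> carrier V. cinner V z x = 0}" "x \<in> carrier V" "hconverges V X x"
  have "(\<lambda>n. cinner V z (X n)) \<longlonglongrightarrow> cinner V z x"
    by (rule cinner_tendsto) (use z X in auto)
  then have "cinner V z x = 0" using X by (simp add: LIMSEQ_const_iff)
  then show "x \<in> {x \<in> carrier V. cinner V z x = 0}" using X by simp
qed (auto simp: cinner_simps)

lemma closed_subspace_INT:
  assumes A: "\<And>i. i \<in> I \<Longrightarrow> closed_subspace V (A i)" and ne: "I \<noteq> {}"
  shows "closed_subspace V (\<Inter>i\<in>I. A i)"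
proof (rule closed_subspaceI)
  show "(\<Inter>i\<in>I. A i) \<subseteq> carrier V" using ne closed_subspaceD(1)[OF A] by blast
  show "\<zero> \<in> (\<Inter>i\<in>I. A i)" using closed_subspaceD(2)[OF A] by blast
  show "x \<oplus> y \<in> (\<Inter>i\<in>I. A i)" if "x \<in> (\<Inter>i\<in>I. A i)" "y \<in> (\<Inter>i\<in>I. A i)" for x y
    using closed_subspaceD(3)[OF A] that by simp
  show "c \<odot> x \<in> (\<Inter>i\<in>I. A i)" if "x \<in> (\<Inter>i\<in>I. A i)" for c x
    using closed_subspaceD(4)[OF A] that by simp
  fix X x assume X: "\<And>n. X n \<in> (\<Inter>i\<in>I. A i)" "x \<in> carrier V" "hconverges V X x"
  show "x \<in> (\<Inter>i\<in>I. A i)"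
  proof
    fix i assume "i \<in> I"
    then show "x \<in> A i" using closed_subspaceD(6)[OF A, of i X x] X by auto
  qed
qed

lemma closed_span_subset: "S \<subseteq> closed_span V S"
  by (auto simp: closed_span_def)

lemma closed_span_minimal: "closed_subspace V W \<Longrightarrow> S \<subseteq> W \<Longrightarrow> closed_span V S \<subseteq> W"
  by (auto simp: closed_span_def)

lemma closed_subspace_closed_span: "S \<subseteq> carrier V \<Longrightarrow> closed_subspace V (closed_span V S)"
  using closed_subspace_INT[of "{W. closed_subspace V W \<and> S \<subseteq> W}" id] closed_subspace_carrier
  by (auto simp: closed_span_def)

lemma closed_span_carrier: "S \<subseteq> carrier V \<Longrightarrow> closed_span V S \<subseteq> carrier V"
  by (intro closed_span_minimal closed_subspace_carrier)

lemma closed_span_carrier_eq: "closed_span V (carrier V) = carrier V"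
  using closed_span_carrier[of "carrier V"] closed_span_subset[of "carrier V"] by auto

end

section \<open>Separation by inner products and orthogonal projection\<close>

context hilbert_space
begin

lemma hnorm_eq_0_iff: "x \<in> carrier V \<Longrightarrow> hnorm V x = 0 \<longleftrightarrow> x = \<zero>"
  using cinner_definite[of x] by (auto simp: cinner_self)

lemma hnorm_diff_eq_0_iff: "\<lbrakk>x \<in> carrier V; y \<in> carrier V\<rbrakk> \<Longrightarrow> hnorm V (x \<ominus> y) = 0 \<longleftrightarrow> x = y"
  by (simp add: hnorm_eq_0_iff)

lemma hspace_eqI:
  assumes "x \<in> carrier V" "y \<in> carrier V" "\<And>z. z \<in> carrier V \<Longrightarrow> cinner V z x = cinner V z y"
  shows "x = y"
proof -
  have "cinner V (x \<ominus> y) (x \<ominus> y) = 0" using assms by (simp add: cinner_minus_right)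
  then show ?thesis using assms cinner_definite[of "x \<ominus> y"] by simp
qed

text \<open>The difference of \<open>x\<close> and \<open>y\<close> is orthogonal to a total set,
  hence to the whole space and to itself.\<close>

lemma hspace_total_eqI:
  assumes S: "S \<subseteq> carrier V" "closed_span V S = carrier V"
    and x: "x \<in> carrier V" and y: "y \<in> carrier V" and eq: "\<And>z. z \<in> S \<Longrightarrow> cinner V z x = cinner V z y"
  shows "x = y"
proof -
  have "closed_span V S \<subseteq> {z \<in> carrier V. cinner V (x \<ominus> y) z = 0}"
  proof (intro closed_span_minimal closed_subspace_orth subsetI)
    fix z assume z: "z \<in> S"
    then have "z \<in> carrier V" using S by auto
    then have "cinner V (x \<ominus> y) z = cnj (cinner V z (x \<ominus> y))"
      using x y by (intro cinner_commute) auto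
    then show "z \<in> {z \<in> carrier V. cinner V (x \<ominus> y) z = 0}"
      using eq[OF z] x y \<open>z \<in> carrier V\<close> by (simp add: cinner_minus_right)
  qed (use x y in auto)
  then have "cinner V (x \<ominus> y) (x \<ominus> y) = 0" using S x y by auto
  then show ?thesis using x y cinner_definite[of "x \<ominus> y"] by simp
qed

lemma hconverges_unique:
  assumes "\<And>n. X n \<in> carrier V" "x \<in> carrier V" "y \<in> carrier V" "hconverges V X x" "hconverges V X y"
  shows "x = y"
proof -
  have "(\<lambda>n. hnorm V (X n \<ominus> y)) \<longlonglongrightarrow> 0" "(\<lambda>n. hnorm V (X n \<ominus> x)) \<longlonglongrightarrow> 0"
    using assms by (auto simp: hconverges_def)
  then have "(\<lambda>n. hnorm V (X n \<ominus> x) + hnorm V (X n \<ominus> y)) \<longlonglongrightarrow> 0"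
    using tendsto_add by fastforce
  moreover have "hnorm V (x \<ominus> y) \<le> hnorm V (X n \<ominus> x) + hnorm V (X n \<ominus> y)" for n
    using hnorm_diff_triangle[of x "X n" y] hnorm_minus_commute[of x "X n"] assms by simp
  ultimately have "hnorm V (x \<ominus> y) \<le> 0"
    by (intro LIMSEQ_le_const) auto
  then have "hnorm V (x \<ominus> y) = 0" using assms hnorm_nonneg[of "x \<ominus> y"] by (intro antisym) auto
  then show ?thesis using assms by (simp add: hnorm_diff_eq_0_iff)
qed

lemma closed_subspace_complete:
  assumes W: "closed_subspace V W" and X: "\<And>n. X n \<in> W" "hcauchy V X"
  shows "\<exists>x\<in>W. hconverges V X x"
proof -
  obtain x where "x \<in> carrier V" "hconverges V X x" using complete X(2) by blast
  then show ?thesis using closed_subspaceD(6)[OF W, of X x] X by blast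
qed

text \<open>A minimising sequence for the distance to \<open>W\<close> converges by the
  parallelogram law and completeness; at the minimiser a small step inside \<open>W\<close> towards
  a non-orthogonal direction would decrease the distance further.\<close>

lemma orthogonal_projection:
  assumes W: "closed_subspace V W" and x: "x \<in> carrier V"
  obtains p where "p \<in> W" "\<And>w. w \<in> W \<Longrightarrow> cinner V w (x \<ominus> p) = 0"
proof -
  have WV: "w \<in> carrier V" if "w \<in> W" for w using closed_subspaceD(1)[OF W] that by auto
  define N where "N w = (hnorm V (x \<ominus> w))\<^sup>2" for w
  define d where "d = Inf (N ` W)"
  have bdd: "bdd_below (N ` W)" by (intro bdd_belowI[of _ 0]) (auto simp: N_def)
  have ne: "N ` W \<noteq> {}" using closed_subspaceD(2)[OF W] by auto
  have d_le: "d \<le> N w" if "w \<in> W" for w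
    unfolding d_def by (intro cInf_lower bdd) (use that in auto)
  have "\<exists>w\<in>W. N w < d + 1 / real (Suc n)" for n
    using cInf_lessD[OF ne, of "d + 1 / real (Suc n)"] by (auto simp: d_def)
  then obtain X where X: "\<And>n. X n \<in> W" "\<And>n. N (X n) < d + 1 / real (Suc n)" by metis
  note XV = WV[OF X(1)]
  \<comment> \<open>Parallelogram law: the midpoint \<open>h\<close> lies in \<open>W\<close>, so
    \<open>N h\<close> is at least \<open>d\<close>, and the excesses of \<open>N (X m)\<close> and
    \<open>N (X n)\<close> over \<open>d\<close> bound the gap.\<close>
  have par: "(hnorm V (X m \<ominus> X n))\<^sup>2 \<le> 2 / real (Suc m) + 2 / real (Suc n)" for m n
  proof -
    define h where "h = (1/2) \<odot> (X m \<oplus> X n)"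
    have h: "h \<in> W" using X(1) closed_subspaceD(3,4)[OF W] by (simp add: h_def)
    have "(hnorm V (X m \<ominus> X n))\<^sup>2 = 2 * N (X m) + 2 * N (X n) - 4 * N h"
      unfolding N_def using x XV[of m] XV[of n]
      by (simp add: h_def cinner_simps flip: Re_cinner_self) (simp add: field_simps)
    then show ?thesis using d_le[OF h] X(2)[of m] X(2)[of n] by simp
  qed
  have "hcauchy V X"
    unfolding hcauchy_def
  proof (intro conjI allI impI XV)
    fix e :: real assume e: "e > 0"
    obtain N where N: "4 / e\<^sup>2 < real N" using reals_Archimedean2 by blast
    have "hnorm V (X m \<ominus> X n) < e" if "m \<ge> N" "n \<ge> N" for m n
    proof -
      have N0: "0 < real N" using N e by (meson divide_pos_pos less_trans zero_less_numeral zero_less_power)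
      have "2 / real (Suc m) + 2 / real (Suc n) \<le> 2 / real N + 2 / real N"
        using that N0 by (intro add_mono divide_left_mono) auto
      also have "\<dots> < e\<^sup>2" using N N0 e by (simp add: field_simps)
      finally have "(hnorm V (X m \<ominus> X n))\<^sup>2 < e\<^sup>2" using par[of m n] by simp
      then show ?thesis using e by (meson less_eq_real_def power2_less_imp_less)
    qed
    then show "\<exists>N. \<forall>m\<ge>N. \<forall>n\<ge>N. hnorm V (X m \<ominus> X n) < e" by blast
  qed
  then obtain p where p: "p \<in> W" "hconverges V X p"
    using closed_subspace_complete[OF W, of X] X(1) by auto
  note pV = WV[OF p(1)]
  have "hconverges V (\<lambda>n. x \<ominus> X n) (x \<ominus> p)"
    using hconverges_add[OF _ _ _ _ _ hconverges_smult[of X p "-1"], of "\<lambda>_. x" x] x XV pV p(2)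
    by (simp add: minus_eq_smult)
  then have "(\<lambda>n. N (X n)) \<longlonglongrightarrow> N p"
    unfolding N_def by (intro tendsto_power hnorm_tendsto) (use x XV pV in auto)
  moreover have "(\<lambda>n. d + 1 / real (Suc n)) \<longlonglongrightarrow> d + 0"
    by (intro tendsto_add tendsto_const LIMSEQ_Suc[OF lim_1_over_n])
  ultimately have "N p \<le> d + 0"
    by (rule LIMSEQ_le) (use X(2) less_imp_le in blast)
  then have Np: "N p \<le> d" by simp
  have "cinner V w (x \<ominus> p) = 0" if w: "w \<in> W" for w
  proof (rule ccontr)
    define z where "z = cinner V w (x \<ominus> p)"
    \<comment> \<open>The step \<open>c = e z\<close> changes the squared distance by -2 e |z|^2 +
      e^2 |z|^2 |w|^2. This \<open>e\<close> makes e |w|^2 at most 1, so the change is negative; the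
      summand 1 keeps the denominator positive.\<close>
    define e where "e = 1 / ((hnorm V w)\<^sup>2 + 1)"
    define c where "c = of_real e * z"
    assume "cinner V w (x \<ominus> p) \<noteq> 0"
    then have z: "norm z > 0" by (simp add: z_def)
    note wV = WV[OF w]
    have e: "e > 0" by (simp add: e_def add_nonneg_pos)
    have "N p \<le> N (p \<oplus> c \<odot> w)"
      using Np d_le[of "p \<oplus> c \<odot> w"] closed_subspaceD(3,4)[OF W] w p(1) by simp
    also have "N (p \<oplus> c \<odot> w) = (hnorm V ((x \<ominus> p) \<ominus> c \<odot> w))\<^sup>2"
      unfolding N_def using x pV wV
      by (intro arg_cong[where f = "\<lambda>r. r\<^sup>2"] hnorm_eqI) (auto simp: cinner_simps algebra_simps)
    also have "\<dots> = N p - 2 * Re (cnj c * z) + (norm c)\<^sup>2 * (hnorm V w)\<^sup>2"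
    proof -
      have "cinner V (x \<ominus> p) w = cnj z"
        unfolding z_def by (rule cinner_commute) (use x pV wV in auto)
      moreover have "cinner V (c \<odot> w) (c \<odot> w) = of_real ((norm c)\<^sup>2 * (hnorm V w)\<^sup>2)"
        using wV by (simp add: cinner_self hnorm_smult power_mult_distrib)
      ultimately show ?thesis
        unfolding N_def using x pV wV
        by (simp add: cinner_minus_left[of "x \<ominus> p"] cinner_minus_right[of _ "x \<ominus> p"]
            cinner_smult_left cinner_smult_right[of "x \<ominus> p"] flip: Re_cinner_self z_def)
    qed
    also have "Re (cnj c * z) = e * (norm z)\<^sup>2"
      by (simp add: c_def cmod_power2) (simp add: power2_eq_square algebra_simps)
    also have "(norm c)\<^sup>2 = e\<^sup>2 * (norm z)\<^sup>2" using e by (simp add: c_def norm_mult power_mult_distrib)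
    finally have "e * (norm z)\<^sup>2 * 2 \<le> e * (norm z)\<^sup>2 * (e * (hnorm V w)\<^sup>2)"
      by (simp add: power2_eq_square algebra_simps)
    then have "2 \<le> e * (hnorm V w)\<^sup>2" using e z by simp
    moreover have "e * (hnorm V w)\<^sup>2 \<le> 1" by (simp add: e_def divide_le_eq_1 add_nonneg_pos)
    ultimately show False by simp
  qed
  then show ?thesis using p(1) that by blast
qed

end

section \<open>Linear, isometric and unitary operators\<close>

lemma linear_opD:
  assumes "linear_op V W A"
  shows "\<And>x. x \<in> carrier V \<Longrightarrow> A x \<in> carrier W"
    "\<And>x y. \<lbrakk>x \<in> carrier V; y \<in> carrier V\<rbrakk> \<Longrightarrow> A (x \<oplus>\<^bsub>V\<^esub> y) = A x \<oplus>\<^bsub>W\<^esub> A y"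
    "\<And>c x. x \<in> carrier V \<Longrightarrow> A (c \<odot>\<^bsub>V\<^esub> x) = c \<odot>\<^bsub>W\<^esub> A x"
  using assms by (auto simp: linear_op_def)

locale two_semi = V: semi_inner_space V + W: semi_inner_space W
  for V :: "'a hspace" and W :: "'b hspace"
begin

lemma linear_op_minus:
  "\<lbrakk>linear_op V W A; x \<in> carrier V; y \<in> carrier V\<rbrakk> \<Longrightarrow> A (x \<ominus>\<^bsub>V\<^esub> y) = A x \<ominus>\<^bsub>W\<^esub> A y"
  by (simp add: V.minus_eq_smult W.minus_eq_smult linear_opD)

lemma linear_op_zero: "linear_op V W A \<Longrightarrow> A \<zero>\<^bsub>V\<^esub> = \<zero>\<^bsub>W\<^esub>"
  using linear_opD(3)[of V W A "\<zero>\<^bsub>V\<^esub>" 0] linear_opD(1)[of V W A "\<zero>\<^bsub>V\<^esub>"] by simp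

text \<open>Polarisation: the norm of the sum of \<open>x\<close> and \<open>y\<close> determines
  the real part, and replacing \<open>y\<close> by its multiple by \<i> yields the imaginary
  part.\<close>

lemma isometric_cinner:
  assumes A: "isometric_op V W A" and x: "x \<in> carrier V" and y: "y \<in> carrier V"
  shows "cinner W (A x) (A y) = cinner V x y"
proof -
  have L: "linear_op V W A" using A by (simp add: isometric_op_def)
  have iso: "Re (cinner W (A v) (A v)) = Re (cinner V v v)" if "v \<in> carrier V" for v
    using A that by (simp add: isometric_op_def W.Re_cinner_self V.Re_cinner_self linear_opD[OF L])
  have re: "Re (cinner W (A x) (A y)) = Re (cinner V x y)" if x: "x \<in> carrier V" and y: "y \<in> carrier V" for x y
    using iso[of "x \<oplus>\<^bsub>V\<^esub> y"] iso[OF x] iso[OF y] x y V.cinner_commute[OF x y] W.cinner_commute[of "A x" "A y"]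
    by (simp add: linear_opD[OF L] V.cinner_simps W.cinner_simps)
  have "Im (cinner W (A x) (A y)) = Im (cinner V x y)"
    using re[OF x, of "\<i> \<odot>\<^bsub>V\<^esub> y"] x y
    by (simp add: linear_opD[OF L] V.cinner_simps W.cinner_simps)
  then show ?thesis using re[OF x y] by (simp add: complex_eq_iff)
qed

lemma isometric_opI:
  assumes "linear_op V W A" "\<And>x. x \<in> carrier V \<Longrightarrow> cinner W (A x) (A x) = cinner V x x"
  shows "isometric_op V W A"
  using assms by (simp add: isometric_op_def hnorm_def)

lemma isometric_bounded: "isometric_op V W A \<Longrightarrow> bounded_op V W A"
  unfolding isometric_op_def bounded_op_def opnorm_le_def by (intro conjI exI[of _ 1]) auto

lemma unitary_isometric: "unitary_op V W A \<Longrightarrow> isometric_op V W A"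
  by (simp add: unitary_op_def isometric_op_def hnorm_def)

lemma bounded_op_hconverges:
  assumes A: "bounded_op V W A" and X: "\<And>n. X n \<in> carrier V" "x \<in> carrier V" "hconverges V X x"
  shows "hconverges W (\<lambda>n. A (X n)) (A x)"
proof -
  obtain c where L: "linear_op V W A" and c: "opnorm_le V W A c" using A by (auto simp: bounded_op_def)
  have "hnorm W (A (X n) \<ominus>\<^bsub>W\<^esub> A x) \<le> c * hnorm V (X n \<ominus>\<^bsub>V\<^esub> x)" for n
    using c X(1,2) by (simp add: opnorm_le_def flip: linear_op_minus[OF L])
  then have le: "norm (hnorm W (A (X n) \<ominus>\<^bsub>W\<^esub> A x)) \<le> c * hnorm V (X n \<ominus>\<^bsub>V\<^esub> x)" for n
    using X(1,2) linear_opD(1)[OF L] by simp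
  have lim: "(\<lambda>n. c * hnorm V (X n \<ominus>\<^bsub>V\<^esub> x)) \<longlonglongrightarrow> 0"
    using tendsto_mult_left[OF X(3)[unfolded hconverges_def], of c] by simp
  show ?thesis
    unfolding hconverges_def
    by (rule Lim_null_comparison[OF _ lim]) (simp only: le eventually_True)
qed

lemma closed_subspace_vimage:
  assumes A: "bounded_op V W A" and S: "closed_subspace W S"
  shows "closed_subspace V {x \<in> carrier V. A x \<in> S}"
proof -
  have L: "linear_op V W A" using A by (auto simp: bounded_op_def)
  show ?thesis
  proof (rule V.closed_subspaceI)
    fix X x assume X: "\<And>n. X n \<in> {x \<in> carrier V. A x \<in> S}" "x \<in> carrier V" "hconverges V X x"
    have "A x \<in> S"
      by (rule W.closed_subspaceD(6)[OF S, of "\<lambda>n. A (X n)"])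
         (use X bounded_op_hconverges[OF A, of X x] linear_opD[OF L] in auto)
    then show "x \<in> {x \<in> carrier V. A x \<in> S}" using X by simp
  qed (use W.closed_subspaceD[OF S] linear_opD[OF L] linear_op_zero[OF L] in auto)
qed

end

locale two_hilbert = V: hilbert_space V + W: hilbert_space W
  for V :: "'a hspace" and W :: "'b hspace"

sublocale two_hilbert \<subseteq> two_semi ..

context two_hilbert
begin

text \<open>The set where two bounded operators agree is a closed subspace. This is how an operator
  obtained by choice is compared with one that has been constructed.\<close>

lemma bounded_op_eq_on_total:
  assumes A: "bounded_op V W A" and B: "bounded_op V W B"
    and S: "S \<subseteq> carrier V" "closed_span V S = carrier V"
    and eq: "\<And>x. x \<in> S \<Longrightarrow> A x = B x" and x: "x \<in> carrier V"
  shows "A x = B x"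
proof -
  have LA: "linear_op V W A" and LB: "linear_op V W B" using A B by (auto simp: bounded_op_def)
  have "closed_subspace V {x \<in> carrier V. A x = B x}"
  proof (rule V.closed_subspaceI)
    fix X x assume X: "\<And>n. X n \<in> {x \<in> carrier V. A x = B x}" "x \<in> carrier V" "hconverges V X x"
    have "A x = B x"
      by (rule W.hconverges_unique[of "\<lambda>n. A (X n)"])
        (use X linear_opD(1)[OF LA] linear_opD(1)[OF LB] bounded_op_hconverges[OF A, of X x]
           bounded_op_hconverges[OF B, of X x] in auto)
    then show "x \<in> {x \<in> carrier V. A x = B x}" using X by simp
  qed (auto simp: linear_opD[OF LA] linear_opD[OF LB] linear_op_zero[OF LA] linear_op_zero[OF LB])
  then have "closed_span V S \<subseteq> {x \<in> carrier V. A x = B x}"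
    by (rule V.closed_span_minimal) (use S eq in auto)
  then show ?thesis using S x by auto
qed

lemma isometric_inj:
  assumes "isometric_op V W A" "x \<in> carrier V" "y \<in> carrier V" "A x = A y"
  shows "x = y"
proof -
  have L: "linear_op V W A" using assms by (simp add: isometric_op_def)
  have "hnorm V (x \<ominus>\<^bsub>V\<^esub> y) = hnorm W (A (x \<ominus>\<^bsub>V\<^esub> y))"
    using assms by (simp add: isometric_op_def)
  also have "\<dots> = 0" using assms linear_opD(1)[OF L] by (simp add: linear_op_minus[OF L])
  finally show ?thesis using assms by (simp add: V.hnorm_diff_eq_0_iff)
qed

text \<open>An isometry reflects Cauchy sequences, so completeness of the domain supplies a preimage
  of the limit.\<close>

lemma closed_subspace_isometric_image:
  assumes A: "isometric_op V W A" and S: "closed_subspace V S"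
  shows "closed_subspace W (A ` S)"
proof -
  have L: "linear_op V W A" using A by (simp add: isometric_op_def)
  have SV: "v \<in> carrier V" if "v \<in> S" for v using V.closed_subspaceD(1)[OF S] that by auto
  show ?thesis
  proof (rule W.closed_subspaceI)
    show "A ` S \<subseteq> carrier W" using linear_opD(1)[OF L] SV by auto
    show "\<zero>\<^bsub>W\<^esub> \<in> A ` S" using linear_op_zero[OF L] V.closed_subspaceD(2)[OF S] by (metis imageI)
    show "x \<oplus>\<^bsub>W\<^esub> y \<in> A ` S" if "x \<in> A ` S" "y \<in> A ` S" for x y
      using that V.closed_subspaceD(3)[OF S] SV by (auto simp flip: linear_opD(2)[OF L])
    show "c \<odot>\<^bsub>W\<^esub> x \<in> A ` S" if "x \<in> A ` S" for c x
      using that V.closed_subspaceD(4)[OF S] SV by (auto simp flip: linear_opD(3)[OF L])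
    fix Y y assume Y: "\<And>n. Y n \<in> A ` S" "y \<in> carrier W" "hconverges W Y y"
    then obtain X where X: "\<And>n. X n \<in> S" "\<And>n. Y n = A (X n)" unfolding image_iff by metis
    have "hnorm V (X m \<ominus>\<^bsub>V\<^esub> X n) = hnorm W (Y m \<ominus>\<^bsub>W\<^esub> Y n)" for m n
      using A SV[OF X(1)[of m]] SV[OF X(1)[of n]]
      by (simp add: X(2) isometric_op_def flip: linear_op_minus[OF L])
    moreover have "hcauchy W Y"
      by (rule W.hconverges_hcauchy) (use Y X SV linear_opD(1)[OF L] in auto)
    ultimately have "hcauchy V X" using X SV by (simp add: hcauchy_def)
    then obtain x where x: "x \<in> S" "hconverges V X x"
      using V.closed_subspace_complete[OF S, of X] X(1) by auto
    have "Y = (\<lambda>n. A (X n))" using X by auto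
    then have "hconverges W Y (A x)"
      using bounded_op_hconverges[OF isometric_bounded[OF A], of X x] X SV x by simp
    then have "y = A x"
      using W.hconverges_unique[of Y y "A x"] Y X SV x linear_opD(1)[OF L] by auto
    then show "y \<in> A ` S" using x by simp
  qed
qed

lemma adjoint_op_eqI:
  assumes "x \<in> carrier V" "\<And>z. z \<in> carrier V \<Longrightarrow> cinner V z x = cinner W (A z) y"
  shows "adjoint_op V W A y = x"
  unfolding adjoint_op_def
  by (rule the_equality) (use assms V.hspace_eqI in auto)

text \<open>\<open>adjoint_op\<close> is a definite description, so existence has to be shown. For
  an isometry no representation theorem is required: the range is closed, and the preimage of the
  projection of \<open>y\<close> onto it is the value sought.\<close>

lemma isometric_adjoint:
  assumes A: "isometric_op V W A" and y: "y \<in> carrier W"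
  shows isometric_adjoint_mem: "adjoint_op V W A y \<in> carrier V"
    and cinner_isometric_adjoint: "\<And>z. z \<in> carrier V \<Longrightarrow> cinner V z (adjoint_op V W A y) = cinner W (A z) y"
proof -
  have L: "linear_op V W A" using A by (simp add: isometric_op_def)
  obtain p where p: "p \<in> A ` carrier V" "\<And>w. w \<in> A ` carrier V \<Longrightarrow> cinner W w (y \<ominus>\<^bsub>W\<^esub> p) = 0"
    using W.orthogonal_projection[OF closed_subspace_isometric_image[OF A V.closed_subspace_carrier] y] by blast
  then obtain x where x: "x \<in> carrier V" "p = A x" by auto
  have eq: "cinner V z x = cinner W (A z) y" if "z \<in> carrier V" for z
    using p(2)[of "A z"] that x y linear_opD(1)[OF L] isometric_cinner[OF A, of z x]
    by (simp add: W.cinner_minus_right)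
  then have "adjoint_op V W A y = x" by (intro adjoint_op_eqI x)
  then show "adjoint_op V W A y \<in> carrier V" "\<And>z. z \<in> carrier V \<Longrightarrow> cinner V z (adjoint_op V W A y) = cinner W (A z) y"
    using x eq by auto
qed

end

section \<open>The Hausdorff completion\<close>

context semi_inner_space
begin

lemma hcauchyD: "hcauchy V X \<Longrightarrow> X n \<in> carrier V"
  by (simp add: hcauchy_def)

lemma hcauchy_const [simp]: "v \<in> carrier V \<Longrightarrow> hcauchy V (\<lambda>_. v)"
  by (simp add: hcauchy_def)

lemma hcauchy_add:
  assumes X: "hcauchy V X" and Y: "hcauchy V Y"
  shows "hcauchy V (\<lambda>n. X n \<oplus> Y n)"
  unfolding hcauchy_def
proof (intro conjI allI impI)
  fix e :: real assume "e > 0"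
  then have "e / 2 > 0" by simp
  obtain M where M: "\<And>m n. m \<ge> M \<Longrightarrow> n \<ge> M \<Longrightarrow> hnorm V (X m \<ominus> X n) < e / 2"
    using X \<open>e / 2 > 0\<close> unfolding hcauchy_def by blast
  obtain N where N: "\<And>m n. m \<ge> N \<Longrightarrow> n \<ge> N \<Longrightarrow> hnorm V (Y m \<ominus> Y n) < e / 2"
    using Y \<open>e / 2 > 0\<close> unfolding hcauchy_def by blast
  have "hnorm V (X m \<oplus> Y m \<ominus> (X n \<oplus> Y n)) < e" if "m \<ge> max M N" "n \<ge> max M N" for m n
    using hnorm_diff_add[OF hcauchyD[OF X, of m] hcauchyD[OF Y, of m] hcauchyD[OF X, of n] hcauchyD[OF Y, of n]]
      M[of m n] N[of m n] that by simp
  then show "\<exists>N. \<forall>m\<ge>N. \<forall>n\<ge>N. hnorm V (X m \<oplus> Y m \<ominus> (X n \<oplus> Y n)) < e" by blast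
qed (use hcauchyD X Y in auto)

lemma hcauchy_smult:
  assumes X: "hcauchy V X"
  shows "hcauchy V (\<lambda>n. c \<odot> X n)"
  unfolding hcauchy_def
proof (intro conjI allI impI)
  fix e :: real assume "e > 0"
  then have "e / (norm c + 1) > 0" by (simp add: add_nonneg_pos)
  then obtain M where M: "\<And>m n. m \<ge> M \<Longrightarrow> n \<ge> M \<Longrightarrow> hnorm V (X m \<ominus> X n) < e / (norm c + 1)"
    using X unfolding hcauchy_def by blast
  have "hnorm V (c \<odot> X m \<ominus> c \<odot> X n) < e" if "m \<ge> M" "n \<ge> M" for m n
  proof -
    have "norm c * hnorm V (X m \<ominus> X n) \<le> (norm c + 1) * hnorm V (X m \<ominus> X n)"
      using hcauchyD[OF X] by (intro mult_right_mono) auto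
    also have "\<dots> < (norm c + 1) * (e / (norm c + 1))"
      by (rule mult_strict_left_mono[OF M[OF that]]) (simp add: add_nonneg_pos)
    also have "\<dots> = e" using norm_ge_zero[of c] by (simp add: add_nonneg_eq_0_iff)
    finally show ?thesis using hcauchyD[OF X] by (simp add: hnorm_diff_smult)
  qed
  then show "\<exists>N. \<forall>m\<ge>N. \<forall>n\<ge>N. hnorm V (c \<odot> X m \<ominus> c \<odot> X n) < e" by blast
qed (use hcauchyD X in auto)

lemma hcauchy_diff: "hcauchy V X \<Longrightarrow> hcauchy V Y \<Longrightarrow> hcauchy V (\<lambda>n. X n \<ominus> Y n)"
  using hcauchy_add[OF _ hcauchy_smult[of Y "-1"], of X] by (simp add: minus_eq_smult hcauchyD)

lemma hcauchy_hnorm_bounded: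
  assumes X: "hcauchy V X"
  obtains B where "B \<ge> 0" "\<And>n. hnorm V (X n) \<le> B"
proof -
  have "Cauchy (\<lambda>n. hnorm V (X n))"
  proof (rule metric_CauchyI)
    fix e :: real assume "e > 0"
    then obtain N where N: "\<And>m n. m \<ge> N \<Longrightarrow> n \<ge> N \<Longrightarrow> hnorm V (X m \<ominus> X n) < e"
      using X unfolding hcauchy_def by blast
    have "dist (hnorm V (X m)) (hnorm V (X n)) < e" if "m \<ge> N" "n \<ge> N" for m n
      using N[OF that] N[OF that(2,1)] hnorm_le_diff[OF hcauchyD[OF X, of m] hcauchyD[OF X, of n]]
        hnorm_le_diff[OF hcauchyD[OF X, of n] hcauchyD[OF X, of m]]
      by (auto simp: dist_real_def abs_less_iff)
    then show "\<exists>N. \<forall>m\<ge>N. \<forall>n\<ge>N. dist (hnorm V (X m)) (hnorm V (X n)) < e" by blast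
  qed
  then have "Bseq (\<lambda>n. hnorm V (X n))" by (rule Cauchy_Bseq)
  then obtain K where "K > 0" "\<And>n. norm (hnorm V (X n)) \<le> K" by (auto simp: Bseq_def)
  then show ?thesis using that[of K] hcauchyD[OF X] by simp
qed

lemma hcauchy_cinner_convergent:
  assumes X: "hcauchy V X" and Y: "hcauchy V Y"
  shows "convergent (\<lambda>n. cinner V (X n) (Y n))"
proof -
  obtain A where A: "A \<ge> 0" "\<And>n. hnorm V (X n) \<le> A" using hcauchy_hnorm_bounded[OF X] by blast
  obtain B where B: "B \<ge> 0" "\<And>n. hnorm V (Y n) \<le> B" using hcauchy_hnorm_bounded[OF Y] by blast
  have "Cauchy (\<lambda>n. cinner V (X n) (Y n))"
  proof (rule metric_CauchyI)
    fix e :: real assume e: "e > 0"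
    define d where "d = e / (A + B + 1)"
    have d: "d > 0" using e A B by (simp add: d_def add_nonneg_pos)
    obtain M where M: "\<And>m n. m \<ge> M \<Longrightarrow> n \<ge> M \<Longrightarrow> hnorm V (X m \<ominus> X n) < d"
      using X d unfolding hcauchy_def by blast
    obtain N where N: "\<And>m n. m \<ge> N \<Longrightarrow> n \<ge> N \<Longrightarrow> hnorm V (Y m \<ominus> Y n) < d"
      using Y d unfolding hcauchy_def by blast
    have "dist (cinner V (X m) (Y m)) (cinner V (X n) (Y n)) < e" if "m \<ge> max M N" "n \<ge> max M N" for m n
    proof -
      have mn: "m \<ge> M" "n \<ge> M" "m \<ge> N" "n \<ge> N" using that by auto
      have "norm (cinner V (X m) (Y m) - cinner V (X n) (Y n)) \<le>
          hnorm V (X m) * hnorm V (Y m \<ominus> Y n) + hnorm V (X m \<ominus> X n) * hnorm V (Y n)"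
        using hcauchyD[OF X] hcauchyD[OF Y] by (intro norm_cinner_diff_le) auto
      also have "\<dots> \<le> A * d + d * B"
        using A B d M[OF mn(1,2)] N[OF mn(3,4)] hcauchyD[OF X] hcauchyD[OF Y]
        by (intro add_mono mult_mono) (auto intro: less_imp_le)
      also have "\<dots> < (A + B + 1) * d" using d by (simp add: algebra_simps)
      also have "\<dots> = e" using A B by (simp add: d_def)
      finally show ?thesis by (simp add: dist_norm)
    qed
    then show "\<exists>N. \<forall>m\<ge>N. \<forall>n\<ge>N. dist (cinner V (X m) (Y m)) (cinner V (X n) (Y n)) < e" by blast
  qed
  then show ?thesis by (simp add: Cauchy_convergent_iff)
qed

lemma completion_rel_trans:
  assumes "(X, Y) \<in> completion_rel V" "(Y, Z) \<in> completion_rel V"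
  shows "(X, Z) \<in> completion_rel V"
proof -
  have c: "hcauchy V X" "hcauchy V Y" "hcauchy V Z" using assms by (auto simp: completion_rel_def)
  have lim: "(\<lambda>n. hnorm V (X n \<ominus> Y n) + hnorm V (Y n \<ominus> Z n)) \<longlonglongrightarrow> 0"
    using assms tendsto_add[of "\<lambda>n. hnorm V (X n \<ominus> Y n)" 0 sequentially "\<lambda>n. hnorm V (Y n \<ominus> Z n)" 0]
    by (simp add: completion_rel_def)
  have "norm (hnorm V (X n \<ominus> Z n)) \<le> hnorm V (X n \<ominus> Y n) + hnorm V (Y n \<ominus> Z n)" for n
    using hnorm_diff_triangle[of "X n" "Y n" "Z n"] c by (simp add: hcauchyD)
  then have "(\<lambda>n. hnorm V (X n \<ominus> Z n)) \<longlonglongrightarrow> 0"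
    by (intro Lim_null_comparison[OF _ lim]) simp
  then show ?thesis using c by (simp add: completion_rel_def)
qed

lemma equiv_completion_rel: "equiv (Collect (hcauchy V)) (completion_rel V)"
proof (rule equivI)
  show "completion_rel V \<subseteq> Collect (hcauchy V) \<times> Collect (hcauchy V)"
    by (auto simp: completion_rel_def)
  show "refl_on (Collect (hcauchy V)) (completion_rel V)"
    by (auto simp: refl_on_def completion_rel_def hcauchyD)
  show "sym (completion_rel V)"
  proof (rule symI)
    fix X Y assume r: "(X, Y) \<in> completion_rel V"
    then have "hnorm V (X n \<ominus> Y n) = hnorm V (Y n \<ominus> X n)" for n
      by (intro hnorm_minus_commute) (auto simp: completion_rel_def hcauchyD)
    then show "(Y, X) \<in> completion_rel V" using r by (simp add: completion_rel_def)
  qed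
  show "trans (completion_rel V)"
    by (rule transI) (rule completion_rel_trans)
qed

text \<open>\<open>completion_class\<close> reaches only constant sequences; computing in the
  completion needs a name for the class of an arbitrary Cauchy sequence.\<close>

definition cseq_class :: "(nat \<Rightarrow> 'a) \<Rightarrow> 'a completion" where
  "cseq_class X = completion_rel V `` {X}"

lemma completion_class_eq: "completion_class V v = cseq_class (\<lambda>_. v)"
  by (simp add: completion_class_def cseq_class_def)

context
begin

private abbreviation (input) "HV \<equiv> hcompletion V"

lemma carrier_hcompletion: "A \<in> carrier HV \<longleftrightarrow> (\<exists>X. hcauchy V X \<and> A = cseq_class X)"
  by (auto simp: hcompletion_def quotient_def cseq_class_def)

lemma cseq_class_mem [simp]: "hcauchy V X \<Longrightarrow> cseq_class X \<in> carrier HV"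
  by (auto simp: carrier_hcompletion)

lemma cseq_class_eqI: "(X, Y) \<in> completion_rel V \<Longrightarrow> cseq_class X = cseq_class Y"
  unfolding cseq_class_def by (rule equiv_class_eq[OF equiv_completion_rel])

lemma completion_relD:
  "(X, Y) \<in> completion_rel V \<Longrightarrow> hcauchy V X"
  "(X, Y) \<in> completion_rel V \<Longrightarrow> hcauchy V Y"
  "(X, Y) \<in> completion_rel V \<Longrightarrow> (\<lambda>n. hnorm V (X n \<ominus> Y n)) \<longlonglongrightarrow> 0"
  by (auto simp: completion_rel_def)

text \<open>The operations of \<open>hcompletion\<close> are unions over all representatives;
  compatibility with the relation collapses such a union to a single class.\<close>

lemma add_cseq_class:
  assumes "hcauchy V X" "hcauchy V Y"
  shows "cseq_class X \<oplus>\<^bsub>HV\<^esub> cseq_class Y = cseq_class (\<lambda>n. X n \<oplus> Y n)"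
proof -
  have "congruent2 (completion_rel V) (completion_rel V) (\<lambda>X Y. cseq_class (\<lambda>n. X n \<oplus> Y n))"
  proof (rule congruent2I[OF equiv_completion_rel equiv_completion_rel])
    fix X Y Z assume Z: "Z \<in> Collect (hcauchy V)" and r: "(X, Y) \<in> completion_rel V"
    note D = completion_relD[OF r]
    have 1: "hnorm V (X n \<oplus> Z n \<ominus> (Y n \<oplus> Z n)) = hnorm V (X n \<ominus> Y n)" for n
      using D Z by (intro hnorm_eqI) (auto simp: cinner_simps hcauchyD)
    show "cseq_class (\<lambda>n. X n \<oplus> Z n) = cseq_class (\<lambda>n. Y n \<oplus> Z n)"
      using D Z by (intro cseq_class_eqI) (auto simp: completion_rel_def 1 hcauchy_add)
    have 2: "hnorm V (Z n \<oplus> X n \<ominus> (Z n \<oplus> Y n)) = hnorm V (X n \<ominus> Y n)" for n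
      using D Z by (intro hnorm_eqI) (auto simp: cinner_simps hcauchyD)
    show "cseq_class (\<lambda>n. Z n \<oplus> X n) = cseq_class (\<lambda>n. Z n \<oplus> Y n)"
      using D Z by (intro cseq_class_eqI) (auto simp: completion_rel_def 2 hcauchy_add)
  qed
  from UN_equiv_class2[OF equiv_completion_rel equiv_completion_rel this, of X Y] assms
  show ?thesis by (simp add: hcompletion_def cseq_class_def)
qed

lemma smult_cseq_class:
  assumes "hcauchy V X"
  shows "c \<odot>\<^bsub>HV\<^esub> cseq_class X = cseq_class (\<lambda>n. c \<odot> X n)"
proof -
  have "congruent (completion_rel V) (\<lambda>X. cseq_class (\<lambda>n. c \<odot> X n))"
  proof (rule congruentI)
    fix X Y assume r: "(X, Y) \<in> completion_rel V"
    note D = completion_relD[OF r]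
    have "(\<lambda>n. hnorm V (c \<odot> X n \<ominus> c \<odot> Y n)) \<longlonglongrightarrow> 0"
      using tendsto_mult_left[OF D(3), of "norm c"] D by (simp add: hnorm_diff_smult hcauchyD)
    then show "cseq_class (\<lambda>n. c \<odot> X n) = cseq_class (\<lambda>n. c \<odot> Y n)"
      using D by (intro cseq_class_eqI) (auto simp: completion_rel_def hcauchy_smult)
  qed
  from UN_equiv_class[OF equiv_completion_rel this, of X] assms
  show ?thesis by (simp add: hcompletion_def cseq_class_def)
qed

text \<open>The union of limits over all representatives is a singleton: Cauchy sequences are
  bounded, so by Cauchy-Schwarz a null perturbation of either argument leaves the limit
  unchanged.\<close>

lemma cinner_cseq_class_lim:
  assumes "hcauchy V X" "hcauchy V Y"
  shows "cinner HV (cseq_class X) (cseq_class Y) = lim (\<lambda>n. cinner V (X n) (Y n))"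
proof -
  have "congruent2 (completion_rel V) (completion_rel V) (\<lambda>X Y. {lim (\<lambda>n. cinner V (X n) (Y n))})"
  proof (rule congruent2I[OF equiv_completion_rel equiv_completion_rel])
    fix X Y Z assume Z: "Z \<in> Collect (hcauchy V)" and r: "(X, Y) \<in> completion_rel V"
    note D = completion_relD[OF r]
    obtain B where B: "B \<ge> 0" "\<And>n. hnorm V (Z n) \<le> B" using hcauchy_hnorm_bounded[of Z] Z by blast
    have lim: "(\<lambda>n. B * hnorm V (X n \<ominus> Y n)) \<longlonglongrightarrow> 0"
      using tendsto_mult_left[OF D(3), of B] by simp
    have XY: "X n \<in> carrier V" "Y n \<in> carrier V" "Z n \<in> carrier V" for n
      using D Z by (auto simp: hcauchyD)
    have 1: "norm (cinner V (X n) (Z n) - cinner V (Y n) (Z n)) \<le> B * hnorm V (X n \<ominus> Y n)" for n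
      using norm_cinner_le[of "X n \<ominus> Y n" "Z n"] XY[of n] mult_right_mono[OF B(2), of "hnorm V (X n \<ominus> Y n)" n]
      by (simp add: cinner_simps mult.commute)
    have 2: "norm (cinner V (Z n) (X n) - cinner V (Z n) (Y n)) \<le> B * hnorm V (X n \<ominus> Y n)" for n
      using norm_cinner_le[of "Z n" "X n \<ominus> Y n"] XY[of n] mult_right_mono[OF B(2), of "hnorm V (X n \<ominus> Y n)" n]
      by (simp add: cinner_simps mult.commute)
    have "(\<lambda>n. cinner V (X n) (Z n) - cinner V (Y n) (Z n)) \<longlonglongrightarrow> 0"
      by (rule Lim_null_comparison[OF _ lim]) (simp add: 1)
    moreover have "(\<lambda>n. cinner V (Y n) (Z n)) \<longlonglongrightarrow> lim (\<lambda>n. cinner V (Y n) (Z n))"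
      using hcauchy_cinner_convergent[of Y Z] D Z by (simp add: convergent_LIMSEQ_iff)
    ultimately have "(\<lambda>n. cinner V (X n) (Z n)) \<longlonglongrightarrow> lim (\<lambda>n. cinner V (Y n) (Z n))"
      by - (drule (1) tendsto_add, simp)
    then show "{lim (\<lambda>n. cinner V (X n) (Z n))} = {lim (\<lambda>n. cinner V (Y n) (Z n))}"
      by (simp add: limI)
    have "(\<lambda>n. cinner V (Z n) (X n) - cinner V (Z n) (Y n)) \<longlonglongrightarrow> 0"
      by (rule Lim_null_comparison[OF _ lim]) (simp add: 2)
    moreover have "(\<lambda>n. cinner V (Z n) (Y n)) \<longlonglongrightarrow> lim (\<lambda>n. cinner V (Z n) (Y n))"
      using hcauchy_cinner_convergent[of Z Y] D Z by (simp add: convergent_LIMSEQ_iff)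
    ultimately have "(\<lambda>n. cinner V (Z n) (X n)) \<longlonglongrightarrow> lim (\<lambda>n. cinner V (Z n) (Y n))"
      by - (drule (1) tendsto_add, simp)
    then show "{lim (\<lambda>n. cinner V (Z n) (X n))} = {lim (\<lambda>n. cinner V (Z n) (Y n))}"
      by (simp add: limI)
  qed
  from UN_equiv_class2[OF equiv_completion_rel equiv_completion_rel this, of X Y] assms
  show ?thesis by (simp add: hcompletion_def cseq_class_def)
qed

lemma cinner_cseq_class_tendsto:
  assumes "hcauchy V X" "hcauchy V Y"
  shows "(\<lambda>n. cinner V (X n) (Y n)) \<longlonglongrightarrow> cinner HV (cseq_class X) (cseq_class Y)"
  using hcauchy_cinner_convergent[OF assms] assms
  by (simp add: cinner_cseq_class_lim convergent_LIMSEQ_iff)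

lemma zero_hcompletion: "\<zero>\<^bsub>HV\<^esub> = cseq_class (\<lambda>_. \<zero>)"
  by (simp add: hcompletion_def completion_class_eq)

lemma abelian_group_hcompletion: "abelian_group HV"
proof (rule abelian_groupI)
  fix A B C assume "A \<in> carrier HV" "B \<in> carrier HV" "C \<in> carrier HV"
  then obtain X Y Z where "hcauchy V X" "A = cseq_class X" "hcauchy V Y" "B = cseq_class Y"
    "hcauchy V Z" "C = cseq_class Z" by (auto simp: carrier_hcompletion)
  then show "(A \<oplus>\<^bsub>HV\<^esub> B) \<oplus>\<^bsub>HV\<^esub> C = A \<oplus>\<^bsub>HV\<^esub> (B \<oplus>\<^bsub>HV\<^esub> C)"
    by (simp add: add_cseq_class hcauchy_add M.a_assoc hcauchyD)
next
  fix A B assume "A \<in> carrier HV" "B \<in> carrier HV"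
  then obtain X Y where *: "hcauchy V X" "A = cseq_class X" "hcauchy V Y" "B = cseq_class Y"
    by (auto simp: carrier_hcompletion)
  then show "A \<oplus>\<^bsub>HV\<^esub> B \<in> carrier HV"
    by (simp add: add_cseq_class hcauchy_add)
  show "A \<oplus>\<^bsub>HV\<^esub> B = B \<oplus>\<^bsub>HV\<^esub> A"
    using * by (simp add: add_cseq_class M.a_comm[OF hcauchyD[of X] hcauchyD[of Y]])
next
  show "\<zero>\<^bsub>HV\<^esub> \<in> carrier HV" by (simp add: zero_hcompletion)
  fix A assume "A \<in> carrier HV"
  then obtain X where X: "hcauchy V X" "A = cseq_class X" by (auto simp: carrier_hcompletion)
  then show "\<zero>\<^bsub>HV\<^esub> \<oplus>\<^bsub>HV\<^esub> A = A"
    by (simp add: zero_hcompletion add_cseq_class hcauchyD)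
  have "(-1) \<odot> x \<oplus> x = \<zero>" if "x \<in> carrier V" for x
  proof -
    have "(-1) \<odot> x \<oplus> x = x \<oplus> (-1) \<odot> x" using that by (intro M.a_comm) auto
    also have "\<dots> = x \<ominus> x" using that by (simp only: minus_eq_smult)
    finally show ?thesis using that by simp
  qed
  then have "cseq_class (\<lambda>n. (-1) \<odot> X n) \<oplus>\<^bsub>HV\<^esub> A = \<zero>\<^bsub>HV\<^esub>"
    using X by (simp add: add_cseq_class hcauchy_smult hcauchyD zero_hcompletion)
  then show "\<exists>B\<in>carrier HV. B \<oplus>\<^bsub>HV\<^esub> A = \<zero>\<^bsub>HV\<^esub>"
    using X by (metis cseq_class_mem hcauchy_smult)
qed

lemma semi_inner_space_hcompletion: "semi_inner_space HV"
proof (rule semi_inner_spaceI[OF abelian_group_hcompletion])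
  fix A B C and a b :: complex
  assume "A \<in> carrier HV" "B \<in> carrier HV" "C \<in> carrier HV"
  then obtain X Y Z where *: "hcauchy V X" "A = cseq_class X" "hcauchy V Y" "B = cseq_class Y"
    "hcauchy V Z" "C = cseq_class Z" by (auto simp: carrier_hcompletion)
  note lim = cinner_cseq_class_tendsto
  show "cinner HV A (B \<oplus>\<^bsub>HV\<^esub> C) = cinner HV A B + cinner HV A C"
  proof (rule LIMSEQ_unique)
    show "(\<lambda>n. cinner V (X n) (Y n \<oplus> Z n)) \<longlonglongrightarrow> cinner HV A (B \<oplus>\<^bsub>HV\<^esub> C)"
      using * by (simp add: add_cseq_class lim hcauchy_add)
    show "(\<lambda>n. cinner V (X n) (Y n \<oplus> Z n)) \<longlonglongrightarrow> cinner HV A B + cinner HV A C"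
      using tendsto_add[OF lim lim, of X Y X Z] * by (simp add: cinner_add_right hcauchyD)
  qed
next
  fix A B and a b :: complex
  assume "A \<in> carrier HV" "B \<in> carrier HV"
  then obtain X Y where *: "hcauchy V X" "A = cseq_class X" "hcauchy V Y" "B = cseq_class Y"
    by (auto simp: carrier_hcompletion)
  note lim = cinner_cseq_class_tendsto
  show "a \<odot>\<^bsub>HV\<^esub> (A \<oplus>\<^bsub>HV\<^esub> B) = a \<odot>\<^bsub>HV\<^esub> A \<oplus>\<^bsub>HV\<^esub> a \<odot>\<^bsub>HV\<^esub> B"
    using * by (simp add: add_cseq_class smult_cseq_class hcauchy_add hcauchy_smult smult_r_distr hcauchyD)
  show "cinner HV A (a \<odot>\<^bsub>HV\<^esub> B) = a * cinner HV A B"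
  proof (rule LIMSEQ_unique)
    show "(\<lambda>n. cinner V (X n) (a \<odot> Y n)) \<longlonglongrightarrow> cinner HV A (a \<odot>\<^bsub>HV\<^esub> B)"
      using * by (simp add: smult_cseq_class lim hcauchy_smult)
    show "(\<lambda>n. cinner V (X n) (a \<odot> Y n)) \<longlonglongrightarrow> a * cinner HV A B"
      using tendsto_mult_left[OF lim, of X Y a] * by (simp add: cinner_smult_right hcauchyD)
  qed
  show "cinner HV B A = cnj (cinner HV A B)"
  proof (rule LIMSEQ_unique)
    show "(\<lambda>n. cinner V (Y n) (X n)) \<longlonglongrightarrow> cinner HV B A"
      using * by (simp add: lim)
    have "cinner V (Y n) (X n) = cnj (cinner V (X n) (Y n))" for n
      using * by (intro cinner_commute) (auto simp: hcauchyD)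
    then show "(\<lambda>n. cinner V (Y n) (X n)) \<longlonglongrightarrow> cnj (cinner HV A B)"
      using tendsto_cnj[OF lim, of X Y] * by simp
  qed
next
  fix A and a b :: complex
  assume "A \<in> carrier HV"
  then obtain X where *: "hcauchy V X" "A = cseq_class X" by (auto simp: carrier_hcompletion)
  show "a \<odot>\<^bsub>HV\<^esub> A \<in> carrier HV"
    using * by (simp add: smult_cseq_class hcauchy_smult)
  show "(a + b) \<odot>\<^bsub>HV\<^esub> A = a \<odot>\<^bsub>HV\<^esub> A \<oplus>\<^bsub>HV\<^esub> b \<odot>\<^bsub>HV\<^esub> A"
    using * smult_l_distr[of a b] by (simp add: add_cseq_class smult_cseq_class hcauchy_smult hcauchyD)
  show "(a * b) \<odot>\<^bsub>HV\<^esub> A = a \<odot>\<^bsub>HV\<^esub> (b \<odot>\<^bsub>HV\<^esub> A)"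
    using * by (simp add: smult_cseq_class hcauchy_smult hcauchyD smult_smult)
  show "1 \<odot>\<^bsub>HV\<^esub> A = A"
    using * by (simp add: smult_cseq_class hcauchyD)
  have "(\<lambda>n. Re (cinner V (X n) (X n))) \<longlonglongrightarrow> Re (cinner HV A A)"
    using * by (simp add: tendsto_Re cinner_cseq_class_tendsto)
  then show "0 \<le> Re (cinner HV A A)"
    by (rule LIMSEQ_le_const) (use * cinner_nonneg hcauchyD in auto)
qed

lemma hnorm_cseq_class_tendsto:
  "hcauchy V X \<Longrightarrow> (\<lambda>n. hnorm V (X n)) \<longlonglongrightarrow> hnorm HV (cseq_class X)"
  unfolding hnorm_def by (intro tendsto_real_sqrt tendsto_Re cinner_cseq_class_tendsto)

lemma completion_class_mem [simp]: "v \<in> carrier V \<Longrightarrow> completion_class V v \<in> carrier HV"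
  by (simp add: completion_class_eq)

lemma completion_class_add:
  "\<lbrakk>v \<in> carrier V; w \<in> carrier V\<rbrakk> \<Longrightarrow>
    completion_class V (v \<oplus> w) = completion_class V v \<oplus>\<^bsub>HV\<^esub> completion_class V w"
  by (simp add: completion_class_eq add_cseq_class)

lemma completion_class_smult:
  "v \<in> carrier V \<Longrightarrow> completion_class V (c \<odot> v) = c \<odot>\<^bsub>HV\<^esub> completion_class V v"
  by (simp add: completion_class_eq smult_cseq_class)

lemma completion_class_zero: "completion_class V \<zero> = \<zero>\<^bsub>HV\<^esub>"
  by (simp add: completion_class_eq zero_hcompletion)

lemma cinner_completion_class:
  "\<lbrakk>v \<in> carrier V; w \<in> carrier V\<rbrakk> \<Longrightarrow>
    cinner HV (completion_class V v) (completion_class V w) = cinner V v w"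
  by (simp add: completion_class_eq cinner_cseq_class_lim)

lemma cseq_class_diff:
  assumes "hcauchy V X" "hcauchy V Y"
  shows "cseq_class X \<ominus>\<^bsub>HV\<^esub> cseq_class Y = cseq_class (\<lambda>n. X n \<ominus> Y n)"
proof -
  interpret H: semi_inner_space "HV" by (rule semi_inner_space_hcompletion)
  show ?thesis
    using assms
    by (simp add: H.minus_eq_smult smult_cseq_class add_cseq_class hcauchy_smult minus_eq_smult hcauchyD)
qed

text \<open>For fixed \<open>m\<close>, the distance from the constant class of \<open>X m\<close>
  to the class of \<open>X\<close> is the limit over \<open>n\<close> of the distances between
  \<open>X m\<close> and \<open>X n\<close>, which the Cauchy condition bounds.\<close>

lemma hconverges_cseq_class:
  assumes X: "hcauchy V X"
  shows "hconverges HV (\<lambda>n. completion_class V (X n)) (cseq_class X)"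
  unfolding hconverges_def
proof (rule LIMSEQ_I)
  interpret H: semi_inner_space "HV" by (rule semi_inner_space_hcompletion)
  fix e :: real assume e: "e > 0"
  then have "e / 2 > 0" by simp
  then obtain N where N: "\<And>m n. m \<ge> N \<Longrightarrow> n \<ge> N \<Longrightarrow> hnorm V (X m \<ominus> X n) < e / 2"
    using X unfolding hcauchy_def by blast
  have "hnorm HV (completion_class V (X m) \<ominus>\<^bsub>HV\<^esub> cseq_class X) \<le> e / 2" if "m \<ge> N" for m
  proof (rule LIMSEQ_le_const2)
    show "(\<lambda>n. hnorm V (X m \<ominus> X n)) \<longlonglongrightarrow> hnorm HV (completion_class V (X m) \<ominus>\<^bsub>HV\<^esub> cseq_class X)"
      using hnorm_cseq_class_tendsto[OF hcauchy_diff, of "\<lambda>_. X m" X] X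
      by (simp add: completion_class_eq cseq_class_diff hcauchyD)
    show "\<exists>N. \<forall>n\<ge>N. hnorm V (X m \<ominus> X n) \<le> e / 2"
      using N[OF that] by (intro exI[of _ N]) (auto intro: less_imp_le)
  qed
  then have "norm (hnorm HV (completion_class V (X m) \<ominus>\<^bsub>HV\<^esub> cseq_class X) - 0) < e" if "m \<ge> N" for m
    using that e X H.hnorm_nonneg[of "completion_class V (X m) \<ominus>\<^bsub>HV\<^esub> cseq_class X"]
    by (fastforce simp: hcauchyD)
  then show "\<exists>no. \<forall>n\<ge>no. norm (hnorm HV (completion_class V (X n) \<ominus>\<^bsub>HV\<^esub> cseq_class X) - 0) < e"
    by blast
qed

lemma completion_class_dense:
  assumes A: "A \<in> carrier HV" and e: "e > 0"
  shows "\<exists>v\<in>carrier V. hnorm HV (completion_class V v \<ominus>\<^bsub>HV\<^esub> A) < e"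
proof -
  interpret H: semi_inner_space "HV" by (rule semi_inner_space_hcompletion)
  obtain X where X: "hcauchy V X" "A = cseq_class X" using A by (auto simp: carrier_hcompletion)
  have "\<forall>\<^sub>F n in sequentially. hnorm HV (completion_class V (X n) \<ominus>\<^bsub>HV\<^esub> A) < e"
    using hconverges_cseq_class[OF X(1)] e unfolding X(2) hconverges_def by (rule order_tendstoD(2))
  then show ?thesis using hcauchyD[OF X(1)] by (auto simp: eventually_sequentially)
qed

lemma hilbert_space_hcompletion: "hilbert_space HV"
proof -
  interpret H: semi_inner_space "HV" by (rule semi_inner_space_hcompletion)
  show ?thesis
  proof unfold_locales
    fix A assume "A \<in> carrier HV" and 0: "cinner HV A A = 0"
    then obtain X where X: "hcauchy V X" "A = cseq_class X" by (auto simp: carrier_hcompletion)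
    have "(\<lambda>n. hnorm V (X n)) \<longlonglongrightarrow> 0"
      using hnorm_cseq_class_tendsto[OF X(1)] 0 by (simp add: hnorm_def X(2))
    moreover have "hnorm V (X n \<ominus> \<zero>) = hnorm V (X n)" for n
      using X by (intro hnorm_eqI) (auto simp: cinner_simps hcauchyD)
    ultimately show "A = \<zero>\<^bsub>HV\<^esub>"
      using X by (auto simp: zero_hcompletion completion_rel_def intro!: cseq_class_eqI)
  next
    fix A assume A: "hcauchy HV A"
    have Ac: "A n \<in> carrier HV" for n using H.hcauchyD[OF A] .
    \<comment> \<open>Each \<open>A n\<close> is approximated by a vector of \<open>V\<close> within
      \<open>1 / real (Suc n)\<close>. These vectors form a Cauchy sequence in \<open>V\<close>, and
      its class is the limit of \<open>A\<close>.\<close>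
    have "\<exists>v\<in>carrier V. hnorm HV (completion_class V v \<ominus>\<^bsub>HV\<^esub> A n) < 1 / real (Suc n)" for n
      by (rule completion_class_dense[OF Ac]) simp
    then obtain X where X: "\<And>n. X n \<in> carrier V"
      "\<And>n. hnorm HV (completion_class V (X n) \<ominus>\<^bsub>HV\<^esub> A n) < 1 / real (Suc n)" by metis
    have iso: "hnorm V (X m \<ominus> X n) = hnorm HV (completion_class V (X m) \<ominus>\<^bsub>HV\<^esub> completion_class V (X n))" for m n
      using X(1) by (simp add: completion_class_eq cseq_class_diff) (simp add: hnorm_def cinner_completion_class flip: completion_class_eq)
    let ?Q = "\<lambda>n. completion_class V (X n)"
    have "hcauchy V X"
      unfolding hcauchy_def
    proof (intro conjI allI impI X)
      fix e :: real assume e: "e > 0"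
      then have "e / 3 > 0" by simp
      then obtain M where M: "\<And>m n. m \<ge> M \<Longrightarrow> n \<ge> M \<Longrightarrow> hnorm HV (A m \<ominus>\<^bsub>HV\<^esub> A n) < e / 3"
        using A unfolding hcauchy_def by blast
      obtain N where N: "1 / real (Suc N) < e / 3" using nat_approx_posE[OF \<open>e / 3 > 0\<close>] by blast
      have "hnorm V (X m \<ominus> X n) < e" if "m \<ge> max M N" "n \<ge> max M N" for m n
      proof -
        have s: "1 / real (Suc k) \<le> 1 / real (Suc N)" if "k \<ge> N" for k
          using that by (intro divide_left_mono) auto
        have "hnorm V (X m \<ominus> X n) \<le> hnorm HV (?Q m \<ominus>\<^bsub>HV\<^esub> A m)
            + hnorm HV (A m \<ominus>\<^bsub>HV\<^esub> ?Q n)"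
          unfolding iso using X Ac by (intro H.hnorm_diff_triangle) auto
        also have "hnorm HV (A m \<ominus>\<^bsub>HV\<^esub> ?Q n) \<le>
            hnorm HV (A m \<ominus>\<^bsub>HV\<^esub> A n) + hnorm HV (A n \<ominus>\<^bsub>HV\<^esub> ?Q n)"
          using X Ac by (intro H.hnorm_diff_triangle) auto
        also have "hnorm HV (A n \<ominus>\<^bsub>HV\<^esub> ?Q n) = hnorm HV (?Q n \<ominus>\<^bsub>HV\<^esub> A n)"
          using X Ac by (intro H.hnorm_minus_commute) auto
        finally show ?thesis using M[of m n] X(2)[of m] X(2)[of n] s[of m] s[of n] N that by simp
      qed
      then show "\<exists>N. \<forall>m\<ge>N. \<forall>n\<ge>N. hnorm V (X m \<ominus> X n) < e" by blast
    qed
    note c = this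
    have "hconverges HV A (cseq_class X)"
      unfolding hconverges_def
    proof (rule Lim_null_comparison)
      show "(\<lambda>n. 1 / real (Suc n) + hnorm HV (?Q n \<ominus>\<^bsub>HV\<^esub> cseq_class X)) \<longlonglongrightarrow> 0"
        using tendsto_add[OF LIMSEQ_Suc[OF lim_1_over_n] hconverges_cseq_class[OF c, unfolded hconverges_def]] by simp
      have "hnorm HV (A n \<ominus>\<^bsub>HV\<^esub> cseq_class X) \<le>
         1 / real (Suc n) + hnorm HV (?Q n \<ominus>\<^bsub>HV\<^esub> cseq_class X)" for n
        using H.hnorm_diff_triangle[of "A n" "?Q n" "cseq_class X"] H.hnorm_minus_commute[of "A n" "?Q n"]
          X(1)[of n] Ac[of n] X(2)[of n] c by simp
      then show "\<forall>\<^sub>F n in sequentially. norm (hnorm HV (A n \<ominus>\<^bsub>HV\<^esub> cseq_class X)) \<le>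
         1 / real (Suc n) + hnorm HV (?Q n \<ominus>\<^bsub>HV\<^esub> cseq_class X)"
        using Ac c by simp
    qed
    then show "\<exists>x\<in>carrier HV. hconverges HV A x" using c by auto
  qed
qed

lemma closed_span_completion_class:
  "closed_span HV (completion_class V ` carrier V) = carrier HV"
proof -
  interpret H: hilbert_space "HV" by (rule hilbert_space_hcompletion)
  have sub: "completion_class V ` carrier V \<subseteq> carrier HV" by auto
  have "A \<in> closed_span HV (completion_class V ` carrier V)" if A: "A \<in> carrier HV" for A
  proof -
    obtain X where X: "hcauchy V X" "A = cseq_class X" using A by (auto simp: carrier_hcompletion)
    show ?thesis unfolding X(2)
      by (rule H.closed_subspaceD(6)[OF H.closed_subspace_closed_span[OF sub] _ _ hconverges_cseq_class[OF X(1)]])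
         (use X hcauchyD in \<open>auto intro!: subsetD[OF H.closed_span_subset]\<close>)
  qed
  then show ?thesis using H.closed_span_carrier[OF sub] by auto
qed

end

end

section \<open>Extension of inner-product-preserving families\<close>

context two_hilbert
begin

text \<open>
  The graph of the isometry to be constructed: rule induction shows that it preserves inner products
  before it is known to be single-valued.
\<close>

inductive isom_graph :: "'i set \<Rightarrow> ('i \<Rightarrow> 'a) \<Rightarrow> ('i \<Rightarrow> 'b) \<Rightarrow> 'a \<Rightarrow> 'b \<Rightarrow> bool" for I g h where
  base: "i \<in> I \<Longrightarrow> isom_graph I g h (g i) (h i)"
| zero: "isom_graph I g h \<zero>\<^bsub>V\<^esub> \<zero>\<^bsub>W\<^esub>"
| add: "isom_graph I g h x y \<Longrightarrow> isom_graph I g h x' y' \<Longrightarrow> isom_graph I g h (x \<oplus>\<^bsub>V\<^esub> x') (y \<oplus>\<^bsub>W\<^esub> y')"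
| smult: "isom_graph I g h x y \<Longrightarrow> isom_graph I g h (c \<odot>\<^bsub>V\<^esub> x) (c \<odot>\<^bsub>W\<^esub> y)"
| lim: "(\<And>n. isom_graph I g h (X n) (Y n)) \<Longrightarrow> x \<in> carrier V \<Longrightarrow> y \<in> carrier W \<Longrightarrow>
    hconverges V X x \<Longrightarrow> hconverges W Y y \<Longrightarrow> isom_graph I g h x y"

context
  fixes I :: "'i set" and g :: "'i \<Rightarrow> 'a" and h :: "'i \<Rightarrow> 'b"
  assumes g: "\<And>i. i \<in> I \<Longrightarrow> g i \<in> carrier V" and h: "\<And>i. i \<in> I \<Longrightarrow> h i \<in> carrier W"
    and gh: "\<And>i j. i \<in> I \<Longrightarrow> j \<in> I \<Longrightarrow> cinner W (h i) (h j) = cinner V (g i) (g j)"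
    and total: "closed_span V (g ` I) = carrier V"
begin

lemma isom_graph_mem:
  "isom_graph I g h x y \<Longrightarrow> x \<in> carrier V \<and> y \<in> carrier W"
  by (induction rule: isom_graph.induct) (use g h in auto)

text \<open>Comparing inner products of two graph elements takes a double induction. It is done one
  argument at a time, and the left one is still a generator here.\<close>

lemma isom_graph_cinner_base:
  assumes i: "i \<in> I" and "isom_graph I g h x y"
  shows "cinner W (h i) y = cinner V (g i) x"
  using assms(2)
proof (induction rule: isom_graph.induct)
  case (lim X Y x y)
  have "(\<lambda>n. cinner V (g i) (X n)) \<longlonglongrightarrow> cinner V (g i) x"
    by (rule V.cinner_tendsto) (use lim isom_graph_mem g i in auto)
  moreover have "(\<lambda>n. cinner W (h i) (Y n)) \<longlonglongrightarrow> cinner W (h i) y"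
    by (rule W.cinner_tendsto) (use lim isom_graph_mem h i in auto)
  ultimately show ?case using lim.IH LIMSEQ_unique by simp
qed (use g h gh i isom_graph_mem in \<open>auto simp: V.cinner_simps W.cinner_simps\<close>)

lemma isom_graph_cinner:
  assumes "isom_graph I g h x y" and R: "isom_graph I g h x' y'"
  shows "cinner W y y' = cinner V x x'"
  using assms(1)
proof (induction rule: isom_graph.induct)
  case (lim X Y x y)
  have "(\<lambda>n. cinner V (X n) x') \<longlonglongrightarrow> cinner V x x'"
    by (rule V.cinner_tendsto) (use lim isom_graph_mem R in auto)
  moreover have "(\<lambda>n. cinner W (Y n) y') \<longlonglongrightarrow> cinner W y y'"
    by (rule W.cinner_tendsto) (use lim isom_graph_mem R in auto)
  ultimately show ?case using lim.IH LIMSEQ_unique by simp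
qed (use isom_graph_cinner_base[OF _ R] isom_graph_mem R in \<open>auto simp: V.cinner_simps W.cinner_simps\<close>)

lemma isom_graph_functional:
  assumes "isom_graph I g h x y" "isom_graph I g h x y'"
  shows "y = y'"
proof -
  have "cinner W (y \<ominus>\<^bsub>W\<^esub> y') (y \<ominus>\<^bsub>W\<^esub> y') = 0"
    using isom_graph_mem[OF assms(1)] isom_graph_mem[OF assms(2)]
      isom_graph_cinner[OF assms(1) assms(1)] isom_graph_cinner[OF assms(1) assms(2)]
      isom_graph_cinner[OF assms(2) assms(1)] isom_graph_cinner[OF assms(2) assms(2)]
    by (simp add: W.cinner_simps)
  then show ?thesis
    using isom_graph_mem[OF assms(1)] isom_graph_mem[OF assms(2)] W.cinner_definite[of "y \<ominus>\<^bsub>W\<^esub> y'"]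
    by simp
qed

text \<open>The domain of the graph is closed: image sequences of convergent sequences are Cauchy
  since inner products are preserved, so they converge in \<open>W\<close> and the rule
  \<open>lim\<close> applies.\<close>

lemma isom_graph_total:
  assumes "x \<in> carrier V"
  shows "\<exists>y. isom_graph I g h x y"
proof -
  have "closed_subspace V {x \<in> carrier V. \<exists>y. isom_graph I g h x y}"
  proof (rule V.closed_subspaceI)
    fix X x assume X: "\<And>n. X n \<in> {x \<in> carrier V. \<exists>y. isom_graph I g h x y}"
      "x \<in> carrier V" "hconverges V X x"
    have XV: "X n \<in> carrier V" for n using X by auto
    have "\<exists>y. isom_graph I g h (X n) y" for n using X(1) by blast
    then obtain Y where Y: "\<And>n. isom_graph I g h (X n) (Y n)" by metis
    have YW: "Y n \<in> carrier W" for n using isom_graph_mem[OF Y] by simp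
    have "cinner W (Y m \<ominus>\<^bsub>W\<^esub> Y n) (Y m \<ominus>\<^bsub>W\<^esub> Y n) = cinner V (X m \<ominus>\<^bsub>V\<^esub> X n) (X m \<ominus>\<^bsub>V\<^esub> X n)" for m n
      using isom_graph_cinner[OF Y Y] YW XV by (simp add: V.cinner_simps W.cinner_simps)
    then have "hnorm W (Y m \<ominus>\<^bsub>W\<^esub> Y n) = hnorm V (X m \<ominus>\<^bsub>V\<^esub> X n)" for m n
      by (simp add: hnorm_def)
    then have "hcauchy W Y"
      using V.hconverges_hcauchy[OF XV X(2,3)] YW by (simp add: hcauchy_def)
    then obtain y where "y \<in> carrier W" "hconverges W Y y" using W.complete by blast
    then have "isom_graph I g h x y" by (rule isom_graph.lim[OF Y X(2) _ X(3)])
    then show "x \<in> {x \<in> carrier V. \<exists>y. isom_graph I g h x y}" using X by blast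
  qed (auto intro: isom_graph.zero isom_graph.add isom_graph.smult)
  then have "closed_span V (g ` I) \<subseteq> {x \<in> carrier V. \<exists>y. isom_graph I g h x y}"
    by (rule V.closed_span_minimal) (use g in \<open>auto intro: isom_graph.base\<close>)
  then show ?thesis using total assms by auto
qed

text \<open>The source of the isometries built later: tensor products of isometries, reassociation,
  and the map out of the amalgamated sum. Equality of the Gram matrices makes the assignment on
  generators well defined.\<close>

lemma isometric_extension:
  obtains T where "isometric_op V W T" "\<And>i. i \<in> I \<Longrightarrow> T (g i) = h i"
proof -
  define T where "T x = (THE y. isom_graph I g h x y)" for x
  have TI: "T x = y" if "isom_graph I g h x y" for x y
    unfolding T_def using that isom_graph_functional by (intro the_equality) auto
  have T: "isom_graph I g h x (T x)" if "x \<in> carrier V" for x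
    using isom_graph_total[OF that] TI by auto
  have TW: "T x \<in> carrier W" if "x \<in> carrier V" for x using isom_graph_mem[OF T[OF that]] by simp
  have "linear_op V W T"
    unfolding linear_op_def
    by (intro conjI ballI allI funcsetI TI isom_graph.add isom_graph.smult T TW)
  then have "isometric_op V W T"
    by (rule isometric_opI) (rule isom_graph_cinner[OF T T])
  then show ?thesis by (rule that) (rule TI[OF isom_graph.base])
qed

end

text \<open>The range of an isometry is closed, so it is everything as soon as it contains a total
  set.\<close>

lemma unitary_opI:
  assumes A: "isometric_op V W A" and S: "closed_span W S = carrier W" "S \<subseteq> A ` carrier V"
  shows "unitary_op V W A"
proof -
  have L: "linear_op V W A" using A by (simp add: isometric_op_def)
  have "closed_span W S \<subseteq> A ` carrier V"
    by (intro W.closed_span_minimal closed_subspace_isometric_image[OF A] V.closed_subspace_carrier S)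
  then show ?thesis
    using A S linear_opD(1)[OF L] isometric_cinner[OF A] L by (auto simp: unitary_op_def)
qed

end

text \<open>
  Schur's product theorem for a positive kernel and a Gram matrix. Projecting the vectors to the
  complement of \<open>y k\<close> splits off a rank-one kernel and removes the index \<open>k\<close>.
\<close>

lemma (in semi_inner_space) Schur_product_nonneg:
  assumes "finite I" "\<And>i. i \<in> I \<Longrightarrow> y i \<in> carrier V"
    and "\<And>c. 0 \<le> Re (\<Sum>i\<in>I. \<Sum>j\<in>I. cnj (c i) * c j * K i j)"
  shows "0 \<le> Re (\<Sum>i\<in>I. \<Sum>j\<in>I. cnj (c i) * c j * K i j * cinner V (y i) (y j))"
  using assms
proof (induction I arbitrary: y rule: finite_induct)
  case empty
  then show ?case by simp
next
  case (insert k I)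
  note y = insert.prems(1)
  have yk: "y k \<in> carrier V" using y by simp
  have KI: "0 \<le> Re (\<Sum>i\<in>I. \<Sum>j\<in>I. cnj (c i) * c j * K i j)" for c
  proof -
    \<comment> \<open>Positivity of the kernel on the smaller index set comes from coefficients that
      vanish at \<open>k\<close>.\<close>
    let ?c = "c(k := 0)"
    have "(\<Sum>i\<in>insert k I. \<Sum>j\<in>insert k I. cnj (?c i) * ?c j * K i j)
        = (\<Sum>i\<in>I. \<Sum>j\<in>I. cnj (?c i) * ?c j * K i j)"
      using insert.hyps by simp
    also have "\<dots> = (\<Sum>i\<in>I. \<Sum>j\<in>I. cnj (c i) * c j * K i j)"
      using insert.hyps by (intro sum.cong refl) auto
    finally show ?thesis using insert.prems(2)[of ?c] by simp
  qed
  define a where "a = cinner V (y k) (y k)"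
  \<comment> \<open>For \<open>a = 0\<close> nothing has to be subtracted: by Cauchy-Schwarz
    \<open>y k\<close> is then orthogonal to every \<open>y i\<close> already.\<close>
  define y' where "y' i = y i \<ominus> (if a = 0 then 0 else cinner V (y k) (y i) / a) \<odot> y k" for i
  have y': "y' i \<in> carrier V" if "i \<in> insert k I" for i using y[OF that] yk by (simp add: y'_def)
  have a0: "cinner V (y k) (y i) = 0" "cinner V (y i) (y k) = 0" if "a = 0" "i \<in> insert k I" for i
  proof -
    have "hnorm V (y k) = 0" using that yk by (simp add: a_def hnorm_def)
    then show "cinner V (y k) (y i) = 0" "cinner V (y i) (y k) = 0"
      using norm_cinner_le[OF yk y[OF that(2)]] norm_cinner_le[OF y[OF that(2)] yk] by simp_all
  qed
  \<comment> \<open>These are the coordinates along the normalised \<open>y k\<close>. The rank-one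
    part \<open>cnj (b i) * b j\<close> is absorbed into the coefficients, where the hypothesis on
    \<open>K\<close> applies to \<open>c i * b i\<close>.\<close>
  define b where "b i = (if a = 0 then 0 else cinner V (y k) (y i) / of_real (sqrt (Re a)))" for i
  have ca: "cnj a = a" unfolding a_def using cinner_commute[OF yk yk] by simp
  have apos: "a = of_real (Re a)" "Re a \<ge> 0"
    using cinner_self[OF yk] cinner_nonneg[OF yk] by (auto simp: a_def)
  have csq: "complex_of_real (sqrt (Re a)) * of_real (sqrt (Re a)) = a"
    using apos by (simp flip: of_real_mult)
  have split: "cinner V (y i) (y j) = cnj (b i) * b j + cinner V (y' i) (y' j)"
    if "i \<in> insert k I" "j \<in> insert k I" for i j
  proof (cases "a = 0")
    case True
    then show ?thesis using y[OF that(1)] y[OF that(2)] yk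
      by (simp add: b_def y'_def cinner_simps)
  next
    case False
    have "cnj (b i) * b j = cinner V (y i) (y k) * cinner V (y k) (y j) / a"
      using False csq cinner_commute[OF y[OF that(1)] yk] cinner_commute[OF yk y[OF that(1)]]
      by (simp add: b_def mult.commute)
    moreover have "cinner V (y' i) (y' j) = cinner V (y i) (y j) - cinner V (y i) (y k) * cinner V (y k) (y j) / a"
      using False y[OF that(1)] y[OF that(2)] yk cinner_commute[OF yk y[OF that(1)]] ca
      by (simp add: y'_def cinner_simps flip: a_def)
    ultimately show ?thesis by simp
  qed
  have z: "cinner V (y' k) (y' j) = 0" "cinner V (y' j) (y' k) = 0" if "j \<in> insert k I" for j
  proof -
    have 1: "cinner V (y' k) w = 0" if "w \<in> carrier V" "cinner V (y k) w = 0 \<or> a \<noteq> 0" for w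
      using that yk ca by (auto simp: y'_def cinner_simps simp flip: a_def)
    have 2: "cinner V (y k) (y' j) = 0"
      using a0[of j] y[OF that] yk that by (auto simp: y'_def cinner_simps simp flip: a_def)
    show "cinner V (y' k) (y' j) = 0" using 1[OF y'[OF that]] 2 by simp
    then show "cinner V (y' j) (y' k) = 0"
      using cinner_commute[OF y'[of k] y'[OF that]] by simp
  qed
  have "(\<Sum>i\<in>insert k I. \<Sum>j\<in>insert k I. cnj (c i) * c j * K i j * cinner V (y i) (y j))
      = (\<Sum>i\<in>insert k I. \<Sum>j\<in>insert k I. cnj (c i * b i) * (c j * b j) * K i j
          + cnj (c i) * c j * K i j * cinner V (y' i) (y' j))"
    by (intro sum.cong refl) (simp add: split algebra_simps)
  also have "\<dots> = (\<Sum>i\<in>insert k I. \<Sum>j\<in>insert k I. cnj (c i * b i) * (c j * b j) * K i j)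
      + (\<Sum>i\<in>insert k I. \<Sum>j\<in>insert k I. cnj (c i) * c j * K i j * cinner V (y' i) (y' j))"
    by (simp only: sum.distrib)
  also have "(\<Sum>i\<in>insert k I. \<Sum>j\<in>insert k I. cnj (c i) * c j * K i j * cinner V (y' i) (y' j))
      = (\<Sum>i\<in>I. \<Sum>j\<in>I. cnj (c i) * c j * K i j * cinner V (y' i) (y' j))"
    using insert.hyps z by simp
  finally have eq: "(\<Sum>i\<in>insert k I. \<Sum>j\<in>insert k I. cnj (c i) * c j * K i j * cinner V (y i) (y j))
      = (\<Sum>i\<in>insert k I. \<Sum>j\<in>insert k I. cnj (c i * b i) * (c j * b j) * K i j)
      + (\<Sum>i\<in>I. \<Sum>j\<in>I. cnj (c i) * c j * K i j * cinner V (y' i) (y' j))" .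
  have "0 \<le> Re (\<Sum>i\<in>I. \<Sum>j\<in>I. cnj (c i) * c j * K i j * cinner V (y' i) (y' j))"
    by (rule insert.IH[OF y' KI]) simp
  with insert.prems(2)[of "\<lambda>i. c i * b i"] show ?case unfolding eq by simp
qed

text \<open>The combination is recorded only through its inner products; positivity of the Gram form
  asks for no more, and finite sums stay in the complex numbers.\<close>

lemma (in semi_inner_space) linear_combination:
  assumes "finite I" "\<And>i. i \<in> I \<Longrightarrow> x i \<in> carrier V"
  shows "\<exists>v\<in>carrier V. \<forall>w\<in>carrier V. cinner V w v = (\<Sum>i\<in>I. c i * cinner V w (x i))"
  using assms
proof (induction I rule: finite_induct)
  case empty
  then show ?case by (intro bexI[of _ \<zero>]) auto
next
  case (insert k I)
  then obtain v where "v \<in> carrier V" "\<forall>w\<in>carrier V. cinner V w v = (\<Sum>i\<in>I. c i * cinner V w (x i))"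
    by auto
  then show ?case using insert by (intro bexI[of _ "c k \<odot> x k \<oplus> v"]) (auto simp: cinner_simps)
qed

text \<open>The double sum is the inner product with itself of the combination of the
  \<open>x i\<close> with coefficients \<open>c i\<close>.\<close>

lemma (in semi_inner_space) Gram_nonneg:
  assumes "finite I" "\<And>i. i \<in> I \<Longrightarrow> x i \<in> carrier V"
  shows "0 \<le> Re (\<Sum>i\<in>I. \<Sum>j\<in>I. cnj (c i) * c j * cinner V (x i) (x j))"
proof -
  obtain v where v: "v \<in> carrier V" "\<And>w. w \<in> carrier V \<Longrightarrow> cinner V w v = (\<Sum>i\<in>I. c i * cinner V w (x i))"
    using linear_combination[of I x c, OF assms] by blast
  have "cinner V v w = (\<Sum>i\<in>I. cnj (c i) * cinner V (x i) w)" if "w \<in> carrier V" for w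
  proof -
    have "cinner V v w = cnj (\<Sum>i\<in>I. c i * cinner V w (x i))"
      using cinner_commute[OF that v(1)] v(2)[OF that] by simp
    also have "\<dots> = (\<Sum>i\<in>I. cnj (c i) * cnj (cinner V w (x i)))" by simp
    also have "\<dots> = (\<Sum>i\<in>I. cnj (c i) * cinner V (x i) w)"
      using assms that by (intro sum.cong refl arg_cong2[where f = "(*)"] cinner_commute[symmetric]) auto
    finally show ?thesis .
  qed
  note this[OF v(1)]
  also have "(\<Sum>i\<in>I. cnj (c i) * cinner V (x i) v) = (\<Sum>i\<in>I. \<Sum>j\<in>I. cnj (c i) * c j * cinner V (x i) (x j))"
    by (intro sum.cong refl) (simp add: v(2) assms sum_distrib_left mult.assoc)
  finally have "cinner V v v = (\<Sum>i\<in>I. \<Sum>j\<in>I. cnj (c i) * c j * cinner V (x i) (x j))" .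
  then show ?thesis using cinner_nonneg[OF v(1)] by simp
qed

section \<open>Tensor products\<close>

context two_semi
begin

lemma pre_tensor_simps:
  "f \<in> carrier (pre_tensor V W) \<longleftrightarrow> Poly_Mapping.keys f \<subseteq> carrier V \<times> carrier W"
  "f \<oplus>\<^bsub>pre_tensor V W\<^esub> g = f + g" "\<zero>\<^bsub>pre_tensor V W\<^esub> = 0"
  "c \<odot>\<^bsub>pre_tensor V W\<^esub> f = Poly_Mapping.map (\<lambda>z. c * z) f"
  by (simp_all add: pre_tensor_def)

lemma lookup_map_mult:
  "Poly_Mapping.lookup (Poly_Mapping.map (\<lambda>z. c * z) f) p = (c :: complex) * Poly_Mapping.lookup f p"
  by (simp add: Poly_Mapping.map.rep_eq when_def)

lemma keys_map_mult: "Poly_Mapping.keys (Poly_Mapping.map (\<lambda>z. c * z) f) \<subseteq> Poly_Mapping.keys (f :: _ \<Rightarrow>\<^sub>0 complex)"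
  by (auto simp: in_keys_iff lookup_map_mult)

text \<open>Enlarging the index sets beyond the supports lets forms of combinations with different
  supports be added and compared term by term.\<close>

lemma cinner_pre_tensor:
  assumes "finite A" "Poly_Mapping.keys f \<subseteq> A" "finite B" "Poly_Mapping.keys g \<subseteq> B"
  shows "cinner (pre_tensor V W) f g = (\<Sum>p\<in>A. \<Sum>q\<in>B. cnj (Poly_Mapping.lookup f p) * Poly_Mapping.lookup g q *
    cinner V (fst p) (fst q) * cinner W (snd p) (snd q))"
proof -
  have "cinner (pre_tensor V W) f g = (\<Sum>p\<in>Poly_Mapping.keys f. \<Sum>q\<in>Poly_Mapping.keys g.
      cnj (Poly_Mapping.lookup f p) * Poly_Mapping.lookup g q * cinner V (fst p) (fst q) * cinner W (snd p) (snd q))"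
    by (simp add: pre_tensor_def case_prod_unfold)
  also have "\<dots> = (\<Sum>p\<in>Poly_Mapping.keys f. \<Sum>q\<in>B.
      cnj (Poly_Mapping.lookup f p) * Poly_Mapping.lookup g q * cinner V (fst p) (fst q) * cinner W (snd p) (snd q))"
    by (intro sum.cong refl sum.mono_neutral_left) (use assms in \<open>auto simp: in_keys_iff\<close>)
  also have "\<dots> = (\<Sum>p\<in>A. \<Sum>q\<in>B.
      cnj (Poly_Mapping.lookup f p) * Poly_Mapping.lookup g q * cinner V (fst p) (fst q) * cinner W (snd p) (snd q))"
    by (intro sum.mono_neutral_left) (use assms in \<open>auto simp: in_keys_iff\<close>)
  finally show ?thesis .
qed

text \<open>Positivity is the clause with content: the form is the Schur product of the Gram matrix
  of the first components, as kernel, with that of the second components.\<close>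

lemma semi_inner_space_pre_tensor: "semi_inner_space (pre_tensor V W)"
proof (rule semi_inner_spaceI)
  show "abelian_group (pre_tensor V W)"
  proof (rule abelian_groupI)
    fix f g assume "f \<in> carrier (pre_tensor V W)" "g \<in> carrier (pre_tensor V W)"
    then show "f \<oplus>\<^bsub>pre_tensor V W\<^esub> g \<in> carrier (pre_tensor V W)"
      using Poly_Mapping.keys_add[of f g] by (auto simp: pre_tensor_simps)
  next
    fix f assume "f \<in> carrier (pre_tensor V W)"
    then have "- f \<in> carrier (pre_tensor V W)" by (auto simp: pre_tensor_simps in_keys_iff)
    then show "\<exists>g\<in>carrier (pre_tensor V W). g \<oplus>\<^bsub>pre_tensor V W\<^esub> f = \<zero>\<^bsub>pre_tensor V W\<^esub>"
      by (intro bexI[of _ "- f"]) (auto simp: pre_tensor_simps)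
  qed (simp_all add: pre_tensor_simps ac_simps)
next
  fix f g h and c :: complex
  assume f: "f \<in> carrier (pre_tensor V W)" and g: "g \<in> carrier (pre_tensor V W)" and h: "h \<in> carrier (pre_tensor V W)"
  let ?A = "Poly_Mapping.keys f" and ?B = "Poly_Mapping.keys g \<union> Poly_Mapping.keys h"
  have "Poly_Mapping.keys (g + h) \<subseteq> ?B" by (rule Poly_Mapping.keys_add)
  then show "cinner (pre_tensor V W) f (g \<oplus>\<^bsub>pre_tensor V W\<^esub> h) = cinner (pre_tensor V W) f g + cinner (pre_tensor V W) f h"
    using cinner_pre_tensor[of ?A f ?B "g + h"] cinner_pre_tensor[of ?A f ?B g] cinner_pre_tensor[of ?A f ?B h]
    by (simp add: pre_tensor_simps lookup_add algebra_simps flip: sum.distrib)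
next
  fix f g and c :: complex
  assume f: "f \<in> carrier (pre_tensor V W)" and g: "g \<in> carrier (pre_tensor V W)"
  let ?A = "Poly_Mapping.keys f" and ?B = "Poly_Mapping.keys g"
  show "cinner (pre_tensor V W) f (c \<odot>\<^bsub>pre_tensor V W\<^esub> g) = c * cinner (pre_tensor V W) f g"
    using cinner_pre_tensor[of ?A f ?B "c \<odot>\<^bsub>pre_tensor V W\<^esub> g"] cinner_pre_tensor[of ?A f ?B g] keys_map_mult[of c g]
    by (simp add: pre_tensor_simps lookup_map_mult sum_distrib_left mult.left_commute[of _ c] mult.assoc)
  have "cinner (pre_tensor V W) g f = (\<Sum>p\<in>?B. \<Sum>q\<in>?A. cnj (Poly_Mapping.lookup g p) * Poly_Mapping.lookup f q *
      cinner V (fst p) (fst q) * cinner W (snd p) (snd q))"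
    by (rule cinner_pre_tensor) auto
  also have "\<dots> = (\<Sum>p\<in>?B. \<Sum>q\<in>?A. cnj (cnj (Poly_Mapping.lookup f q) * Poly_Mapping.lookup g p *
      cinner V (fst q) (fst p) * cinner W (snd q) (snd p)))"
  proof (intro sum.cong refl)
    fix p q assume "p \<in> ?B" "q \<in> ?A"
    then have *: "fst p \<in> carrier V" "snd p \<in> carrier W" "fst q \<in> carrier V" "snd q \<in> carrier W"
      using f g by (auto simp: pre_tensor_simps)
    show "cnj (Poly_Mapping.lookup g p) * Poly_Mapping.lookup f q * cinner V (fst p) (fst q) * cinner W (snd p) (snd q)
       = cnj (cnj (Poly_Mapping.lookup f q) * Poly_Mapping.lookup g p * cinner V (fst q) (fst p) * cinner W (snd q) (snd p))"
      unfolding V.cinner_commute[OF *(3,1)] W.cinner_commute[OF *(4,2)] by (simp add: mult_ac)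
  qed
  also have "\<dots> = cnj (\<Sum>q\<in>?A. \<Sum>p\<in>?B. cnj (Poly_Mapping.lookup f q) * Poly_Mapping.lookup g p *
      cinner V (fst q) (fst p) * cinner W (snd q) (snd p))"
    by (subst sum.swap) simp
  also have "\<dots> = cnj (cinner (pre_tensor V W) f g)"
    by (subst cinner_pre_tensor[of ?A f ?B g]) auto
  finally show "cinner (pre_tensor V W) g f = cnj (cinner (pre_tensor V W) f g)" .
  show "c \<odot>\<^bsub>pre_tensor V W\<^esub> (f \<oplus>\<^bsub>pre_tensor V W\<^esub> g) = c \<odot>\<^bsub>pre_tensor V W\<^esub> f \<oplus>\<^bsub>pre_tensor V W\<^esub> c \<odot>\<^bsub>pre_tensor V W\<^esub> g"
    by (rule poly_mapping_eqI) (simp add: pre_tensor_simps lookup_map_mult lookup_add, simp add: algebra_simps)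
next
  fix f and a b :: complex
  assume f: "f \<in> carrier (pre_tensor V W)"
  show "a \<odot>\<^bsub>pre_tensor V W\<^esub> f \<in> carrier (pre_tensor V W)"
    using f keys_map_mult[of a f] by (auto simp: pre_tensor_simps)
  show "(a + b) \<odot>\<^bsub>pre_tensor V W\<^esub> f = a \<odot>\<^bsub>pre_tensor V W\<^esub> f \<oplus>\<^bsub>pre_tensor V W\<^esub> b \<odot>\<^bsub>pre_tensor V W\<^esub> f"
    by (rule poly_mapping_eqI) (simp add: pre_tensor_simps lookup_map_mult lookup_add, simp add: algebra_simps)
  show "(a * b) \<odot>\<^bsub>pre_tensor V W\<^esub> f = a \<odot>\<^bsub>pre_tensor V W\<^esub> (b \<odot>\<^bsub>pre_tensor V W\<^esub> f)"
    by (rule poly_mapping_eqI) (simp add: pre_tensor_simps lookup_map_mult)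
  show "1 \<odot>\<^bsub>pre_tensor V W\<^esub> f = f"
    by (rule poly_mapping_eqI) (simp only: pre_tensor_simps lookup_map_mult, simp)
  let ?A = "Poly_Mapping.keys f"
  have f1: "fst p \<in> carrier V" "snd p \<in> carrier W" if "p \<in> ?A" for p
    using that f by (auto simp: pre_tensor_simps)
  have "0 \<le> Re (\<Sum>p\<in>?A. \<Sum>q\<in>?A. cnj (Poly_Mapping.lookup f p) * Poly_Mapping.lookup f q *
    cinner V (fst p) (fst q) * cinner W (snd p) (snd q))"
    by (rule W.Schur_product_nonneg[OF _ f1(2) V.Gram_nonneg[OF _ f1(1)]]) auto
  then show "0 \<le> Re (cinner (pre_tensor V W) f f)"
    by (subst cinner_pre_tensor[of ?A f ?A f]) auto
qed

interpretation PT: semi_inner_space "pre_tensor V W" by (rule semi_inner_space_pre_tensor)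

lemma hilbert_space_htensor: "hilbert_space (htensor V W)"
  unfolding htensor_def by (rule PT.hilbert_space_hcompletion)

interpretation TT: hilbert_space "htensor V W" by (rule hilbert_space_htensor)

lemma elem_tensor_mem [simp]:
  "\<lbrakk>x \<in> carrier V; y \<in> carrier W\<rbrakk> \<Longrightarrow> elem_tensor V W x y \<in> carrier (htensor V W)"
  unfolding elem_tensor_def htensor_def by (rule PT.completion_class_mem) (simp add: pre_tensor_simps)

lemma cinner_elem_tensor:
  assumes "x \<in> carrier V" "y \<in> carrier W" "x' \<in> carrier V" "y' \<in> carrier W"
  shows "cinner (htensor V W) (elem_tensor V W x y) (elem_tensor V W x' y') = cinner V x x' * cinner W y y'"
  unfolding elem_tensor_def htensor_def using assms
  by (subst PT.cinner_completion_class)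
    (simp_all add: pre_tensor_simps cinner_pre_tensor[of "{(x, y)}" _ "{(x', y')}"])

text \<open>Classes of formal combinations are dense in the completion. Induction on a combination,
  one new key at a time, places its class in the span of elementary tensors.\<close>

lemma closed_span_elem_tensor_carrier:
  "closed_span (htensor V W) {elem_tensor V W x y |x y. x \<in> carrier V \<and> y \<in> carrier W} = carrier (htensor V W)"
proof -
  let ?S = "{elem_tensor V W x y |x y. x \<in> carrier V \<and> y \<in> carrier W}"
  let ?M = "closed_span (htensor V W) ?S"
  have S: "?S \<subseteq> carrier (htensor V W)" by auto
  note M = TT.closed_subspaceD[OF TT.closed_subspace_closed_span[OF S]]
  have "Poly_Mapping.keys f \<subseteq> carrier V \<times> carrier W \<longrightarrow> completion_class (pre_tensor V W) f \<in> ?M" for f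
  proof (induction f rule: update_induct)
    case const
    show ?case using M(2) PT.completion_class_zero by (simp add: pre_tensor_simps htensor_def)
  next
    case (update f p b)
    show ?case
    proof
      assume k: "Poly_Mapping.keys (Poly_Mapping.update p b f) \<subseteq> carrier V \<times> carrier W"
      have sub: "Poly_Mapping.keys f \<subseteq> carrier V \<times> carrier W" "p \<in> carrier V \<times> carrier W"
        using k update.hyps by (auto simp: keys_update)
      then have f: "completion_class (pre_tensor V W) f \<in> ?M" using update.IH by simp
      have p: "completion_class (pre_tensor V W) (Poly_Mapping.single p 1) \<in> ?M"
        using sub(2) TT.closed_span_subset[of ?S] by (auto simp: elem_tensor_def)
      have "Poly_Mapping.update p b f = Poly_Mapping.map (\<lambda>z. b * z) (Poly_Mapping.single p 1) + f"
        using update.hyps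
        by (intro poly_mapping_eqI)
          (auto simp: lookup_update lookup_add lookup_map_mult lookup_single when_def in_keys_iff)
      also have "completion_class (pre_tensor V W) \<dots> =
          b \<odot>\<^bsub>htensor V W\<^esub> completion_class (pre_tensor V W) (Poly_Mapping.single p 1)
          \<oplus>\<^bsub>htensor V W\<^esub> completion_class (pre_tensor V W) f"
        using PT.completion_class_add[of "b \<odot>\<^bsub>pre_tensor V W\<^esub> Poly_Mapping.single p 1" f]
          PT.completion_class_smult[of "Poly_Mapping.single p 1" b] sub
          PT.smult_mem[of "Poly_Mapping.single p 1" b]
        by (simp add: pre_tensor_simps htensor_def)
      finally show "completion_class (pre_tensor V W) (Poly_Mapping.update p b f) \<in> ?M"
        using M(3)[OF M(4)[OF p] f] by simp
    qed
  qed
  then have "closed_span (htensor V W) (completion_class (pre_tensor V W) ` carrier (pre_tensor V W)) \<subseteq> ?M"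
    by (intro TT.closed_span_minimal TT.closed_subspace_closed_span[OF S]) (auto simp: pre_tensor_simps)
  then show ?thesis
    using PT.closed_span_completion_class TT.closed_span_carrier[OF S] by (auto simp: htensor_def)
qed

lemma elem_tensor_eqI:
  assumes "A \<in> carrier (htensor V W)" "B \<in> carrier (htensor V W)"
    "\<And>x y. x \<in> carrier V \<Longrightarrow> y \<in> carrier W \<Longrightarrow>
      cinner (htensor V W) (elem_tensor V W x y) A = cinner (htensor V W) (elem_tensor V W x y) B"
  shows "A = B"
  by (rule TT.hspace_total_eqI[OF _ closed_span_elem_tensor_carrier]) (use assms in auto)

lemma hnorm_elem_tensor:
  assumes x: "x \<in> carrier V" and y: "y \<in> carrier W"
  shows "hnorm (htensor V W) (elem_tensor V W x y) = hnorm V x * hnorm W y"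
proof -
  have "cinner (htensor V W) (elem_tensor V W x y) (elem_tensor V W x y) = of_real ((hnorm V x * hnorm W y)\<^sup>2)"
    using x y by (simp add: cinner_elem_tensor V.cinner_self W.cinner_self power_mult_distrib)
  then have "hnorm (htensor V W) (elem_tensor V W x y) = sqrt ((hnorm V x * hnorm W y)\<^sup>2)"
    unfolding hnorm_def[of "htensor V W"] by simp
  then show ?thesis using x y by simp
qed

text \<open>Among formal combinations a pair with a sum as component is a key of its own, so
  bilinearity holds only modulo the null space. It is checked by testing against elementary tensors,
  which are total.\<close>

lemma bounded_op_elem_tensor_left:
  assumes y: "y \<in> carrier W"
  shows "bounded_op V (htensor V W) (\<lambda>x. elem_tensor V W x y)"
proof -
  have "hnorm (htensor V W) (elem_tensor V W x y) = hnorm W y * hnorm V x" if "x \<in> carrier V" for x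
    using y that by (simp add: hnorm_elem_tensor)
  moreover have "linear_op V (htensor V W) (\<lambda>x. elem_tensor V W x y)"
    unfolding linear_op_def
    by (intro conjI ballI allI funcsetI; (rule elem_tensor_eqI)?)
      (use y in \<open>simp_all add: TT.cinner_simps V.cinner_simps cinner_elem_tensor algebra_simps\<close>)
  ultimately show ?thesis unfolding bounded_op_def opnorm_le_def by (intro conjI exI[of _ "hnorm W y"]) auto
qed

lemma bounded_op_elem_tensor_right:
  assumes x: "x \<in> carrier V"
  shows "bounded_op W (htensor V W) (elem_tensor V W x)"
proof -
  have "hnorm (htensor V W) (elem_tensor V W x y) = hnorm V x * hnorm W y" if "y \<in> carrier W" for y
    using x that by (simp add: hnorm_elem_tensor)
  moreover have "linear_op W (htensor V W) (elem_tensor V W x)"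
    unfolding linear_op_def
    by (intro conjI ballI allI funcsetI; (rule elem_tensor_eqI)?)
      (use x in \<open>simp_all add: TT.cinner_simps W.cinner_simps cinner_elem_tensor algebra_simps\<close>)
  ultimately show ?thesis unfolding bounded_op_def opnorm_le_def by (intro conjI exI[of _ "hnorm V x"]) auto
qed

text \<open>One factor at a time: with the other factor fixed, the vectors whose elementary tensor
  lies in the target span form a closed subspace.\<close>

lemma elem_tensor_closed_span:
  assumes S: "S \<subseteq> carrier V" and T: "T \<subseteq> carrier W"
    and x: "x \<in> closed_span V S" and y: "y \<in> closed_span W T"
  shows "elem_tensor V W x y \<in> closed_span (htensor V W) {elem_tensor V W x y |x y. x \<in> S \<and> y \<in> T}"
proof -
  let ?M = "closed_span (htensor V W) {elem_tensor V W x y |x y. x \<in> S \<and> y \<in> T}"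
  have sub: "{elem_tensor V W x y |x y. x \<in> S \<and> y \<in> T} \<subseteq> carrier (htensor V W)" using S T by (auto simp: subset_iff)
  note M = TT.closed_subspace_closed_span[OF sub]
  interpret VT: two_semi V "htensor V W" ..
  interpret WT: two_semi W "htensor V W" ..
  have xV: "x \<in> carrier V" using V.closed_span_carrier[OF S] x by auto
  have "elem_tensor V W x t \<in> ?M" if t: "t \<in> T" for t
  proof -
    have "closed_span V S \<subseteq> {x \<in> carrier V. elem_tensor V W x t \<in> ?M}"
      by (rule V.closed_span_minimal[OF VT.closed_subspace_vimage[OF bounded_op_elem_tensor_left M]])
        (use S T t in \<open>auto intro!: subsetD[OF TT.closed_span_subset]\<close>)
    then show ?thesis using x by auto
  qed
  then have "closed_span W T \<subseteq> {y \<in> carrier W. elem_tensor V W x y \<in> ?M}"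
    by (intro W.closed_span_minimal[OF WT.closed_subspace_vimage[OF bounded_op_elem_tensor_right M]])
      (use S T xV in auto)
  then show ?thesis using y by auto
qed

lemma closed_span_elem_tensor:
  assumes S: "S \<subseteq> carrier V" "closed_span V S = carrier V" and T: "T \<subseteq> carrier W" "closed_span W T = carrier W"
  shows "closed_span (htensor V W) {elem_tensor V W x y |x y. x \<in> S \<and> y \<in> T} = carrier (htensor V W)"
proof -
  have sub: "{elem_tensor V W x y |x y. x \<in> S \<and> y \<in> T} \<subseteq> carrier (htensor V W)" using S T by (auto simp: subset_iff)
  have "closed_span (htensor V W) {elem_tensor V W x y |x y. x \<in> carrier V \<and> y \<in> carrier W}
      \<subseteq> closed_span (htensor V W) {elem_tensor V W x y |x y. x \<in> S \<and> y \<in> T}"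
    by (rule TT.closed_span_minimal[OF TT.closed_subspace_closed_span[OF sub]])
      (use elem_tensor_closed_span[OF S(1) T(1)] S T in auto)
  then show ?thesis using closed_span_elem_tensor_carrier TT.closed_span_carrier[OF sub] by auto
qed

end

text \<open>\<open>tensor_op\<close> is chosen among bounded operators with prescribed values, so an
  operator with these values must exist. For isometries it arises by extension, since Gram matrices
  of elementary tensors are preserved; the structure maps and the embeddings \<open>J1\<close>,
  \<open>J2\<close> are of this kind.\<close>

lemma tensor_op_isometric:
  assumes V: "hilbert_space V" and W: "hilbert_space W" and V': "hilbert_space V'" and W': "hilbert_space W'"
    and A: "isometric_op V V' A" and B: "isometric_op W W' B"
  shows isometric_tensor_op: "isometric_op (htensor V W) (htensor V' W') (tensor_op V W V' W' A B)"
    and tensor_op_elem_tensor: "\<And>x y. x \<in> carrier V \<Longrightarrow> y \<in> carrier W \<Longrightarrow>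
      tensor_op V W V' W' A B (elem_tensor V W x y) = elem_tensor V' W' (A x) (B y)"
proof -
  interpret VW: two_hilbert V W using V W by (simp add: two_hilbert_def)
  interpret VW': two_hilbert V' W' using V' W' by (simp add: two_hilbert_def)
  interpret VV': two_hilbert V V' using V V' by (simp add: two_hilbert_def)
  interpret WW': two_hilbert W W' using W W' by (simp add: two_hilbert_def)
  interpret TT: two_hilbert "htensor V W" "htensor V' W'"
    using VW.hilbert_space_htensor VW'.hilbert_space_htensor by (simp add: two_hilbert_def)
  let ?S = "{elem_tensor V W x y |x y. x \<in> carrier V \<and> y \<in> carrier W}"
  let ?P = "\<lambda>T. bounded_op (htensor V W) (htensor V' W') T \<and>
        (\<forall>x\<in>carrier V. \<forall>y\<in>carrier W. T (elem_tensor V W x y) = elem_tensor V' W' (A x) (B y))"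
  have AV: "A x \<in> carrier V'" if "x \<in> carrier V" for x using A that by (auto simp: isometric_op_def linear_op_def)
  have BW: "B x \<in> carrier W'" if "x \<in> carrier W" for x using B that by (auto simp: isometric_op_def linear_op_def)
  have S: "(\<lambda>p. elem_tensor V W (fst p) (snd p)) ` (carrier V \<times> carrier W) = ?S" by force
  obtain T where T: "isometric_op (htensor V W) (htensor V' W') T"
    "\<And>p. p \<in> carrier V \<times> carrier W \<Longrightarrow> T (elem_tensor V W (fst p) (snd p)) = elem_tensor V' W' (A (fst p)) (B (snd p))"
  proof (rule TT.isometric_extension[where I = "carrier V \<times> carrier W"
        and g = "\<lambda>p. elem_tensor V W (fst p) (snd p)" and h = "\<lambda>p. elem_tensor V' W' (A (fst p)) (B (snd p))"])
    show "closed_span (htensor V W) ((\<lambda>p. elem_tensor V W (fst p) (snd p)) ` (carrier V \<times> carrier W)) = carrier (htensor V W)"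
      unfolding S by (rule VW.closed_span_elem_tensor_carrier)
  qed (use AV BW in \<open>auto simp: VW.cinner_elem_tensor VW'.cinner_elem_tensor
        VV'.isometric_cinner[OF A] WW'.isometric_cinner[OF B]\<close>)
  have "?P T" using T by (auto intro: TT.isometric_bounded)
  then have P: "?P (tensor_op V W V' W' A B)" unfolding tensor_op_def by (rule someI[where P = ?P])
  then show "\<And>x y. x \<in> carrier V \<Longrightarrow> y \<in> carrier W \<Longrightarrow>
      tensor_op V W V' W' A B (elem_tensor V W x y) = elem_tensor V' W' (A x) (B y)" by simp
  \<comment> \<open>The chosen operator inherits isometry from \<open>T\<close>, with which it
    agrees on elementary tensors.\<close>
  have "tensor_op V W V' W' A B z = T z" if "z \<in> carrier (htensor V W)" for z
    by (rule TT.bounded_op_eq_on_total[of _ _ ?S, OF _ TT.isometric_bounded[OF T(1)] _ VW.closed_span_elem_tensor_carrier _ that])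
      (use P T(2) in auto)
  then show "isometric_op (htensor V W) (htensor V' W') (tensor_op V W V' W' A B)"
    using P T(1) by (simp add: isometric_op_def bounded_op_def)
qed

text \<open>Both bracketings have a product of three inner products as Gram matrix, and iterated
  elementary tensors are total on the left, so the reassociation extends to an isometry and the
  choice is meaningful.\<close>

lemma tensor_assoc_elem_tensor:
  assumes U: "hilbert_space U" and V: "hilbert_space V" and W: "hilbert_space W"
    and "x \<in> carrier U" "y \<in> carrier V" "z \<in> carrier W"
  shows "tensor_assoc U V W (elem_tensor (htensor U V) W (elem_tensor U V x y) z) =
    elem_tensor U (htensor V W) x (elem_tensor V W y z)"
proof -
  interpret UV: two_hilbert U V using U V by (simp add: two_hilbert_def)
  interpret VW: two_hilbert V W using V W by (simp add: two_hilbert_def)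
  interpret L: two_hilbert "htensor U V" W
    using UV.hilbert_space_htensor W by (simp add: two_hilbert_def)
  interpret R: two_hilbert U "htensor V W"
    using VW.hilbert_space_htensor U by (simp add: two_hilbert_def)
  interpret TT: two_hilbert "htensor (htensor U V) W" "htensor U (htensor V W)"
    using L.hilbert_space_htensor R.hilbert_space_htensor by (simp add: two_hilbert_def)
  let ?g = "\<lambda>(x, y, z). elem_tensor (htensor U V) W (elem_tensor U V x y) z"
  let ?h = "\<lambda>(x, y, z). elem_tensor U (htensor V W) x (elem_tensor V W y z)"
  let ?I = "carrier U \<times> carrier V \<times> carrier W"
  have "?g ` ?I = {elem_tensor (htensor U V) W v z |v z.
      v \<in> {elem_tensor U V x y |x y. x \<in> carrier U \<and> y \<in> carrier V} \<and> z \<in> carrier W}"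
    by force
  then have tot: "closed_span (htensor (htensor U V) W) (?g ` ?I) = carrier (htensor (htensor U V) W)"
    by (simp only:)
      (rule L.closed_span_elem_tensor[OF _ UV.closed_span_elem_tensor_carrier _ VW.W.closed_span_carrier_eq], auto)
  obtain T where T: "isometric_op (htensor (htensor U V) W) (htensor U (htensor V W)) T"
    "\<And>p. p \<in> ?I \<Longrightarrow> T (?g p) = ?h p"
    by (rule TT.isometric_extension[OF _ _ _ tot, of ?h])
      (auto simp: UV.cinner_elem_tensor VW.cinner_elem_tensor L.cinner_elem_tensor R.cinner_elem_tensor mult.assoc)
  let ?P = "\<lambda>T. bounded_op (htensor (htensor U V) W) (htensor U (htensor V W)) T \<and>
        (\<forall>x\<in>carrier U. \<forall>y\<in>carrier V. \<forall>z\<in>carrier W.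
           T (elem_tensor (htensor U V) W (elem_tensor U V x y) z) =
           elem_tensor U (htensor V W) x (elem_tensor V W y z))"
  have "?P T" using T by (auto intro: TT.isometric_bounded)
  then have "?P (tensor_assoc U V W)" unfolding tensor_assoc_def by (rule someI[where P = ?P])
  then show ?thesis using assms by blast
qed

section \<open>Multiplication in product systems\<close>

lemma (in two_hilbert) unitary_image_closed_span:
  assumes U: "unitary_op V W U" and S: "S \<subseteq> carrier V"
  shows "U ` closed_span V S = closed_span W (U ` S)"
proof -
  note iso = unitary_isometric[OF U]
  have L: "linear_op V W U" using U by (simp add: unitary_op_def)
  have US: "U ` S \<subseteq> carrier W" using S linear_opD(1)[OF L] by auto
  show ?thesis
  proof
    have "closed_span V S \<subseteq> {x \<in> carrier V. U x \<in> closed_span W (U ` S)}"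
      by (rule V.closed_span_minimal[OF closed_subspace_vimage[OF isometric_bounded[OF iso] W.closed_subspace_closed_span[OF US]]])
        (use S subsetD[OF W.closed_span_subset] in auto)
    then show "U ` closed_span V S \<subseteq> closed_span W (U ` S)" by auto
    show "closed_span W (U ` S) \<subseteq> U ` closed_span V S"
      by (intro W.closed_span_minimal closed_subspace_isometric_image[OF iso]
          V.closed_subspace_closed_span[OF S] image_mono V.closed_span_subset)
  qed
qed

locale prodsys =
  fixes E :: "('a, 'm) prodsys_scheme"
  assumes product_system: "product_system E"
begin

lemma hilbert_fib: "t > 0 \<Longrightarrow> hilbert_space (fib E t)"
  using product_system by (simp add: product_system_def)

lemma unitary_cosplit:
  "s > 0 \<Longrightarrow> t > 0 \<Longrightarrow> unitary_op (fib E (s + t)) (htensor (fib E s) (fib E t)) (cosplit E s t)"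
  using product_system by (simp add: product_system_def)

lemma two_hilbert_fib: "s > 0 \<Longrightarrow> t > 0 \<Longrightarrow> two_hilbert (fib E s) (fib E t)"
  by (simp add: two_hilbert_def hilbert_fib)

lemma two_hilbert_cosplit:
  assumes "s > 0" "t > 0"
  shows "two_hilbert (fib E (s + t)) (htensor (fib E s) (fib E t))"
proof -
  interpret two_hilbert "fib E s" "fib E t" by (rule two_hilbert_fib[OF assms])
  show ?thesis using assms by (simp add: two_hilbert_def hilbert_fib hilbert_space_htensor)
qed

context
  fixes s t :: real
  assumes st: "s > 0" "t > 0"
begin

interpretation F: two_hilbert "fib E s" "fib E t" by (rule two_hilbert_fib[OF st])
interpretation U: two_hilbert "fib E (s + t)" "htensor (fib E s) (fib E t)" by (rule two_hilbert_cosplit[OF st])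

lemma isometric_cosplit: "isometric_op (fib E (s + t)) (htensor (fib E s) (fib E t)) (cosplit E s t)"
  by (rule U.unitary_isometric[OF unitary_cosplit[OF st]])

text \<open>\<open>pmul\<close> is defined by an adjoint. Since \<open>cosplit\<close> is unitary,
  the adjoint is its inverse, and a product is simply the preimage of an elementary tensor.\<close>

lemma pmul_cosplit:
  assumes x: "x \<in> carrier (fib E s)" and y: "y \<in> carrier (fib E t)"
  shows pmul_mem [simp]: "pmul E s t x y \<in> carrier (fib E (s + t))"
    and cosplit_pmul: "cosplit E s t (pmul E s t x y) = elem_tensor (fib E s) (fib E t) x y"
proof -
  have "elem_tensor (fib E s) (fib E t) x y \<in> cosplit E s t ` carrier (fib E (s + t))"
    using unitary_cosplit[OF st] x y by (simp add: unitary_op_def F.elem_tensor_mem)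
  then obtain p where p: "p \<in> carrier (fib E (s + t))" "cosplit E s t p = elem_tensor (fib E s) (fib E t) x y"
    by auto
  have "pmul E s t x y = p"
    unfolding pmul_def p(2)[symmetric]
    by (rule U.adjoint_op_eqI[OF p(1)]) (simp add: U.isometric_cinner[OF isometric_cosplit _ p(1)])
  then show "pmul E s t x y \<in> carrier (fib E (s + t))"
    "cosplit E s t (pmul E s t x y) = elem_tensor (fib E s) (fib E t) x y" using p by auto
qed

lemma cinner_pmul:
  assumes "x \<in> carrier (fib E s)" "y \<in> carrier (fib E t)" "x' \<in> carrier (fib E s)" "y' \<in> carrier (fib E t)"
  shows "cinner (fib E (s + t)) (pmul E s t x y) (pmul E s t x' y') = cinner (fib E s) x x' * cinner (fib E t) y y'"
  using U.isometric_cinner[OF isometric_cosplit pmul_mem[OF assms(1,2)] pmul_mem[OF assms(3,4)]] assms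
  by (simp add: cosplit_pmul F.cinner_elem_tensor)

lemma hnorm_pmul:
  assumes "x \<in> carrier (fib E s)" "y \<in> carrier (fib E t)"
  shows "hnorm (fib E (s + t)) (pmul E s t x y) = hnorm (fib E s) x * hnorm (fib E t) y"
proof -
  have "hnorm (htensor (fib E s) (fib E t)) (cosplit E s t (pmul E s t x y)) = hnorm (fib E (s + t)) (pmul E s t x y)"
    using isometric_cosplit pmul_mem[OF assms] unfolding isometric_op_def by blast
  then show ?thesis using cosplit_pmul[OF assms] F.hnorm_elem_tensor[OF assms] by simp
qed

text \<open>Translates the subsystem condition, stated with \<open>cosplit\<close> and tensor
  products, into closed spans of products inside one fibre.\<close>

lemma cosplit_closed_span_pmul:
  assumes S: "S \<subseteq> carrier (fib E s)" and T: "T \<subseteq> carrier (fib E t)"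
  shows "cosplit E s t ` closed_span (fib E (s + t)) {pmul E s t x y |x y. x \<in> S \<and> y \<in> T} =
    tensor_subspace (fib E s) (fib E t) S T"
proof -
  have "{pmul E s t x y |x y. x \<in> S \<and> y \<in> T} \<subseteq> carrier (fib E (s + t))"
    using S T by (auto intro!: pmul_mem)
  moreover have "cosplit E s t ` {pmul E s t x y |x y. x \<in> S \<and> y \<in> T}
      = {elem_tensor (fib E s) (fib E t) x y |x y. x \<in> S \<and> y \<in> T}"
  proof -
    have "cosplit E s t (pmul E s t x y) = elem_tensor (fib E s) (fib E t) x y" if "x \<in> S" "y \<in> T" for x y
      using S T that by (intro cosplit_pmul) auto
    then show ?thesis by (auto simp: image_iff) metis
  qed
  ultimately show ?thesis
    using U.unitary_image_closed_span[OF unitary_cosplit[OF st]] by (simp add: tensor_subspace_def)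
qed

lemma closed_span_pmul:
  "closed_span (fib E (s + t)) {pmul E s t x y |x y. x \<in> carrier (fib E s) \<and> y \<in> carrier (fib E t)}
    = carrier (fib E (s + t))" (is "closed_span _ ?S = _")
proof -
  have S: "?S \<subseteq> carrier (fib E (s + t))" by auto
  have "z \<in> closed_span (fib E (s + t)) ?S" if z: "z \<in> carrier (fib E (s + t))" for z
  proof -
    have "cosplit E s t z \<in> carrier (htensor (fib E s) (fib E t))"
      using unitary_cosplit[OF st] z by (auto simp: unitary_op_def)
    then have "cosplit E s t z \<in> cosplit E s t ` closed_span (fib E (s + t)) ?S"
      unfolding cosplit_closed_span_pmul[OF order_refl order_refl]
      by (simp add: tensor_subspace_def F.closed_span_elem_tensor_carrier)
    then obtain z' where z': "z' \<in> closed_span (fib E (s + t)) ?S" "cosplit E s t z = cosplit E s t z'" by auto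
    then have "z = z'"
      using U.isometric_inj[OF isometric_cosplit z] U.V.closed_span_carrier[OF S] by auto
    then show ?thesis using z' by simp
  qed
  then show ?thesis using U.V.closed_span_carrier[OF S] by auto
qed

lemma pmul_eqI:
  assumes "A \<in> carrier (fib E (s + t))" "B \<in> carrier (fib E (s + t))"
    "\<And>x y. x \<in> carrier (fib E s) \<Longrightarrow> y \<in> carrier (fib E t) \<Longrightarrow>
      cinner (fib E (s + t)) (pmul E s t x y) A = cinner (fib E (s + t)) (pmul E s t x y) B"
  shows "A = B"
  by (rule U.V.hspace_total_eqI[OF _ closed_span_pmul]) (use assms in auto)

lemma bounded_op_pmul_left:
  assumes y: "y \<in> carrier (fib E t)"
  shows "bounded_op (fib E s) (fib E (s + t)) (\<lambda>x. pmul E s t x y)"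
proof -
  have "linear_op (fib E s) (fib E (s + t)) (\<lambda>x. pmul E s t x y)"
    unfolding linear_op_def
    by (intro conjI ballI allI funcsetI; (rule pmul_eqI)?)
      (use y in \<open>simp_all add: U.V.cinner_simps F.V.cinner_simps cinner_pmul algebra_simps\<close>)
  then show ?thesis using y
    unfolding bounded_op_def opnorm_le_def by (intro conjI exI[of _ "hnorm (fib E t) y"]) (auto simp: hnorm_pmul)
qed

lemma bounded_op_pmul_right:
  assumes x: "x \<in> carrier (fib E s)"
  shows "bounded_op (fib E t) (fib E (s + t)) (pmul E s t x)"
proof -
  have "linear_op (fib E t) (fib E (s + t)) (pmul E s t x)"
    unfolding linear_op_def
    by (intro conjI ballI allI funcsetI; (rule pmul_eqI)?)
      (use x in \<open>simp_all add: U.V.cinner_simps F.W.cinner_simps cinner_pmul algebra_simps\<close>)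
  then show ?thesis using x
    unfolding bounded_op_def opnorm_le_def by (intro conjI exI[of _ "hnorm (fib E s) x"]) (auto simp: hnorm_pmul)
qed

lemma pmul_linear:
  assumes "x \<in> carrier (fib E s)" "y \<in> carrier (fib E t)" "x' \<in> carrier (fib E s)" "y' \<in> carrier (fib E t)"
  shows "pmul E s t (x \<oplus>\<^bsub>fib E s\<^esub> x') y = pmul E s t x y \<oplus>\<^bsub>fib E (s + t)\<^esub> pmul E s t x' y"
    "pmul E s t (c \<odot>\<^bsub>fib E s\<^esub> x) y = c \<odot>\<^bsub>fib E (s + t)\<^esub> pmul E s t x y"
    "pmul E s t x (y \<oplus>\<^bsub>fib E t\<^esub> y') = pmul E s t x y \<oplus>\<^bsub>fib E (s + t)\<^esub> pmul E s t x y'"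
    "pmul E s t x (c \<odot>\<^bsub>fib E t\<^esub> y) = c \<odot>\<^bsub>fib E (s + t)\<^esub> pmul E s t x y"
  using assms bounded_op_pmul_left[OF assms(2)] bounded_op_pmul_right[OF assms(1)]
  by (simp_all add: bounded_op_def linear_op_def)

end

text \<open>Both products have the same image under \<open>cosplit E r (s + t)\<close> followed by
  the tensor of the identity with \<open>cosplit E s t\<close>: the coassociativity axiom evaluates
  the first, \<open>cosplit_pmul\<close> the second. That composite is isometric, hence
  injective.\<close>

lemma pmul_assoc:
  assumes rst: "r > 0" "s > 0" "t > 0"
    and x: "x \<in> carrier (fib E r)" and y: "y \<in> carrier (fib E s)" and z: "z \<in> carrier (fib E t)"
  shows "pmul E (r + s) t (pmul E r s x y) z = pmul E r (s + t) x (pmul E s t y z)"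
proof -
  have pos: "r + s > 0" "s + t > 0" "r + s + t > 0" using rst by auto
  note H = hilbert_fib
  interpret rs: two_hilbert "fib E r" "fib E s" using rst by (intro two_hilbert_fib)
  interpret st: two_hilbert "fib E s" "fib E t" using rst by (intro two_hilbert_fib)
  interpret R: two_hilbert "fib E r" "htensor (fib E s) (fib E t)"
    using st.hilbert_space_htensor H rst by (simp add: two_hilbert_def)
  interpret Q: two_hilbert "fib E r" "fib E (s + t)" using rst pos by (intro two_hilbert_fib)
  interpret RQ: two_hilbert "htensor (fib E r) (fib E (s + t))" "htensor (fib E r) (htensor (fib E s) (fib E t))"
    using R.hilbert_space_htensor Q.hilbert_space_htensor by (simp add: two_hilbert_def)
  have id: "isometric_op (fib E k) (fib E k) id" for k by (simp add: isometric_op_def linear_op_def)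
  let ?p = "pmul E (r + s) t (pmul E r s x y) z"
  let ?q = "pmul E r (s + t) x (pmul E s t y z)"
  have xy: "pmul E r s x y \<in> carrier (fib E (r + s))" and yz: "pmul E s t y z \<in> carrier (fib E (s + t))"
    using rst x y z by (auto intro: pmul_mem)
  have p: "?p \<in> carrier (fib E (r + s + t))" using pmul_mem[OF _ _ xy z] pos rst by simp
  have q: "?q \<in> carrier (fib E (r + (s + t)))" using pmul_mem[OF _ _ x yz] pos rst by simp
  \<comment> \<open>The fibres at \<open>r + s + t\<close> and \<open>r + (s + t)\<close> coincide
    only after rewriting the time index.\<close>
  have p': "?p \<in> carrier (fib E (r + (s + t)))" using p by (simp add: add.assoc)
  let ?T = "tensor_op (fib E r) (fib E (s + t)) (fib E r) (htensor (fib E s) (fib E t)) id (cosplit E s t)"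
  note iso = tensor_op_isometric[OF H[OF rst(1)] H[OF pos(2)] H[OF rst(1)] st.hilbert_space_htensor id isometric_cosplit[OF rst(2,3)]]
  have "?T (cosplit E r (s + t) ?p) =
      tensor_assoc (fib E r) (fib E s) (fib E t)
          (tensor_op (fib E (r + s)) (fib E t) (htensor (fib E r) (fib E s)) (fib E t)
            (cosplit E r s) id (cosplit E (r + s) t ?p))"
    using product_system rst p unfolding product_system_def by blast
  also have "cosplit E (r + s) t ?p = elem_tensor (fib E (r + s)) (fib E t) (pmul E r s x y) z"
    using cosplit_pmul[OF pos(1) rst(3) xy z] .
  also have "tensor_op (fib E (r + s)) (fib E t) (htensor (fib E r) (fib E s)) (fib E t)
            (cosplit E r s) id \<dots> = elem_tensor (htensor (fib E r) (fib E s)) (fib E t) (cosplit E r s (pmul E r s x y)) (id z)"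
    by (rule tensor_op_elem_tensor[OF H[OF pos(1)] H[OF rst(3)] rs.hilbert_space_htensor H[OF rst(3)] isometric_cosplit[OF rst(1,2)] id xy z])
  also have "cosplit E r s (pmul E r s x y) = elem_tensor (fib E r) (fib E s) x y"
    using cosplit_pmul[OF rst(1,2) x y] .
  also have "tensor_assoc (fib E r) (fib E s) (fib E t) (elem_tensor (htensor (fib E r) (fib E s)) (fib E t) (elem_tensor (fib E r) (fib E s) x y) (id z))
      = elem_tensor (fib E r) (htensor (fib E s) (fib E t)) x (elem_tensor (fib E s) (fib E t) y z)"
    using tensor_assoc_elem_tensor[OF H[OF rst(1)] H[OF rst(2)] H[OF rst(3)] x y z] by simp
  also have "\<dots> = ?T (elem_tensor (fib E r) (fib E (s + t)) x (pmul E s t y z))"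
    using iso(2)[OF x yz] cosplit_pmul[OF rst(2,3) y z] by simp
  also have "elem_tensor (fib E r) (fib E (s + t)) x (pmul E s t y z) = cosplit E r (s + t) ?q"
    using cosplit_pmul[OF rst(1) pos(2) x yz] by simp
  finally have eq: "?T (cosplit E r (s + t) ?p) = ?T (cosplit E r (s + t) ?q)" .
  note isoc = isometric_cosplit[OF rst(1) pos(2)]
  have mem: "cosplit E r (s + t) w \<in> carrier (htensor (fib E r) (fib E (s + t)))" if "w \<in> carrier (fib E (r + (s + t)))" for w
    using isoc that by (auto simp: isometric_op_def linear_op_def)
  have "cosplit E r (s + t) ?p = cosplit E r (s + t) ?q"
    by (rule RQ.isometric_inj[OF iso(1) mem[OF p'] mem[OF q] eq])
  then show ?thesis
    using two_hilbert.isometric_inj[OF two_hilbert_cosplit[OF rst(1) pos(2)] isoc p' q] by simp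
qed

end

text \<open>The morphism condition speaks about \<open>cosplit\<close>; applying the injective
  \<open>cosplit F s t\<close> to both sides turns it into multiplicativity.\<close>

lemma isometric_morphism_pmul:
  assumes E: "product_system E" and F: "product_system F"
    and \<phi>: "prodsys_morphism E F \<phi>" "isometric_family E F \<phi>"
    and st: "s > 0" "t > 0" and x: "x \<in> carrier (fib E s)" and y: "y \<in> carrier (fib E t)"
  shows "\<phi> (s + t) (pmul E s t x y) = pmul F s t (\<phi> s x) (\<phi> t y)"
proof -
  interpret E: prodsys E using E by (simp add: prodsys_def)
  interpret F: prodsys F using F by (simp add: prodsys_def)
  have iso: "isometric_op (fib E r) (fib F r) (\<phi> r)" if "r > 0" for r
    using \<phi>(2) that by (simp add: isometric_family_def)
  have mem: "\<phi> r v \<in> carrier (fib F r)" if "r > 0" "v \<in> carrier (fib E r)" for r v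
    using iso[OF that(1)] that(2) by (auto simp: isometric_op_def linear_op_def)
  have "cosplit F s t (\<phi> (s + t) (pmul E s t x y))
      = tensor_op (fib E s) (fib E t) (fib F s) (fib F t) (\<phi> s) (\<phi> t) (cosplit E s t (pmul E s t x y))"
    using \<phi>(1) st E.pmul_mem[OF st x y] by (simp add: prodsys_morphism_def)
  also have "\<dots> = elem_tensor (fib F s) (fib F t) (\<phi> s x) (\<phi> t y)"
    using tensor_op_elem_tensor[OF E.hilbert_fib[OF st(1)] E.hilbert_fib[OF st(2)]
        F.hilbert_fib[OF st(1)] F.hilbert_fib[OF st(2)] iso[OF st(1)] iso[OF st(2)] x y]
      E.cosplit_pmul[OF st x y] by simp
  also have "\<dots> = cosplit F s t (pmul F s t (\<phi> s x) (\<phi> t y))"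
    using F.cosplit_pmul[OF st mem[OF st(1) x] mem[OF st(2) y]] by simp
  finally show ?thesis
    using two_hilbert.isometric_inj[OF F.two_hilbert_cosplit[OF st] F.isometric_cosplit[OF st]]
      mem[OF _ E.pmul_mem[OF st x y]] F.pmul_mem[OF st mem[OF st(1) x] mem[OF st(2) y]] st by simp
qed

section \<open>Measurability of inner products of sections\<close>

locale arveson =
  fixes E :: "'a arveson"
  assumes arveson_system: "arveson_system E"

sublocale arveson \<subseteq> prodsys E
  using arveson_system by unfold_locales (simp add: arveson_system_def)

abbreviation pos_borel :: "real measure" where
  "pos_borel \<equiv> restrict_space borel {0<..}"

lemma pos_borel_cong:
  assumes "\<And>t. t > 0 \<Longrightarrow> f t = g t"
  shows "f \<in> borel_measurable pos_borel \<longleftrightarrow> g \<in> borel_measurable pos_borel"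
  by (rule measurable_cong) (use assms in \<open>simp add: space_restrict_space\<close>)

section \<open>Countable dense families of sections and the norm as a supremum\<close>

definition gauss_rats :: "complex set" where
  "gauss_rats = {z. Re z \<in> \<rat> \<and> Im z \<in> \<rat>}"

lemma countable_gauss_rats: "countable gauss_rats"
proof -
  have "gauss_rats \<subseteq> (\<lambda>(a, b). Complex a b) ` (\<rat> \<times> \<rat>)"
    by (auto simp: gauss_rats_def image_iff complex_eq_iff)
  then show ?thesis by (rule countable_subset) (simp add: countable_rat)
qed

lemma gauss_rats_dense:
  assumes "e > 0"
  shows "\<exists>q\<in>gauss_rats. norm (c - q) < e"
proof -
  obtain a where a: "a \<in> \<rat>" "Re c < a" "a < Re c + e / 2"
    using Rats_dense_in_real[of "Re c" "Re c + e / 2"] assms by auto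
  obtain b where b: "b \<in> \<rat>" "Im c < b" "b < Im c + e / 2"
    using Rats_dense_in_real[of "Im c" "Im c + e / 2"] assms by auto
  have "norm (c - Complex a b) \<le> \<bar>Re (c - Complex a b)\<bar> + \<bar>Im (c - Complex a b)\<bar>" by (rule cmod_le)
  also have "\<dots> < e" using a b by simp
  finally show ?thesis using a b by (intro bexI[of _ "Complex a b"]) (auto simp: gauss_rats_def)
qed

lemma gauss_rats_mult: "p \<in> gauss_rats \<Longrightarrow> q \<in> gauss_rats \<Longrightarrow> p * q \<in> gauss_rats"
  by (auto simp: gauss_rats_def)

context arveson
begin

lemma basic_mem: "t > 0 \<Longrightarrow> basic E n t \<in> carrier (fib E t)"
  using arveson_system by (simp add: arveson_system_def is_section_def)

lemma measurable_section_mem: "measurable_section E x \<Longrightarrow> t > 0 \<Longrightarrow> x t \<in> carrier (fib E t)"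
  by (simp add: measurable_section_def is_section_def)

lemma measurable_section_cinner:
  "measurable_section E x \<Longrightarrow> (\<lambda>t. cinner (fib E t) (basic E n t) (x t)) \<in> borel_measurable pos_borel"
  by (simp add: measurable_section_def)

lemma measurable_section_basic: "measurable_section E (basic E n)"
  using arveson_system by (simp add: arveson_system_def measurable_section_def)

lemma measurable_section_zero: "measurable_section E (\<lambda>t. \<zero>\<^bsub>fib E t\<^esub>)"
  unfolding measurable_section_def
proof (intro conjI allI)
  have Z: "\<zero>\<^bsub>fib E t\<^esub> \<in> carrier (fib E t) \<and> cinner (fib E t) (basic E n t) \<zero>\<^bsub>fib E t\<^esub> = 0" if "t > 0" for t n
  proof -
    interpret hilbert_space "fib E t" by (rule hilbert_fib[OF that])
    show ?thesis using basic_mem[OF that] by simp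
  qed
  show "is_section E (\<lambda>t. \<zero>\<^bsub>fib E t\<^esub>)" using Z by (simp add: is_section_def)
  show "(\<lambda>t. cinner (fib E t) (basic E n t) \<zero>\<^bsub>fib E t\<^esub>) \<in> borel_measurable pos_borel" for n
    by (subst pos_borel_cong[of _ "\<lambda>_. 0"]) (use Z in auto)
qed

lemma measurable_section_add:
  assumes x: "measurable_section E x" and y: "measurable_section E y"
  shows "measurable_section E (\<lambda>t. x t \<oplus>\<^bsub>fib E t\<^esub> y t)"
  unfolding measurable_section_def
proof (intro conjI allI)
  have Z: "x t \<oplus>\<^bsub>fib E t\<^esub> y t \<in> carrier (fib E t) \<and> cinner (fib E t) (basic E n t) (x t \<oplus>\<^bsub>fib E t\<^esub> y t)
     = cinner (fib E t) (basic E n t) (x t) + cinner (fib E t) (basic E n t) (y t)" if "t > 0" for t n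
  proof -
    interpret hilbert_space "fib E t" by (rule hilbert_fib[OF that])
    show ?thesis
      using basic_mem[OF that] measurable_section_mem[OF x that] measurable_section_mem[OF y that]
      by (simp add: cinner_simps)
  qed
  show "is_section E (\<lambda>t. x t \<oplus>\<^bsub>fib E t\<^esub> y t)" using Z by (simp add: is_section_def)
  show "(\<lambda>t. cinner (fib E t) (basic E n t) (x t \<oplus>\<^bsub>fib E t\<^esub> y t)) \<in> borel_measurable pos_borel" for n
    by (subst pos_borel_cong[of _ "\<lambda>t. cinner (fib E t) (basic E n t) (x t) + cinner (fib E t) (basic E n t) (y t)"])
      (use Z in simp, intro borel_measurable_add borel_measurable_times borel_measurable_const measurable_section_cinner x y)
qed

lemma measurable_section_smult:
  assumes x: "measurable_section E x"
  shows "measurable_section E (\<lambda>t. c \<odot>\<^bsub>fib E t\<^esub> x t)"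
  unfolding measurable_section_def
proof (intro conjI allI)
  have Z: "c \<odot>\<^bsub>fib E t\<^esub> x t \<in> carrier (fib E t) \<and> cinner (fib E t) (basic E n t) (c \<odot>\<^bsub>fib E t\<^esub> x t)
     = c * cinner (fib E t) (basic E n t) (x t)" if "t > 0" for t n
  proof -
    interpret hilbert_space "fib E t" by (rule hilbert_fib[OF that])
    show ?thesis
      using basic_mem[OF that] measurable_section_mem[OF x that] by (simp add: cinner_simps)
  qed
  show "is_section E (\<lambda>t. c \<odot>\<^bsub>fib E t\<^esub> x t)" using Z by (simp add: is_section_def)
  show "(\<lambda>t. cinner (fib E t) (basic E n t) (c \<odot>\<^bsub>fib E t\<^esub> x t)) \<in> borel_measurable pos_borel" for n
    by (subst pos_borel_cong[of _ "\<lambda>t. c * cinner (fib E t) (basic E n t) (x t)"])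
      (use Z in simp, intro borel_measurable_add borel_measurable_times borel_measurable_const measurable_section_cinner x)
qed

text \<open>Lists serve as index set because they are countable over countable coefficients, and
  because addition becomes concatenation and scaling a map over the list.\<close>

fun lincomb :: "(complex \<times> nat) list \<Rightarrow> real \<Rightarrow> 'a" where
  "lincomb [] t = \<zero>\<^bsub>fib E t\<^esub>"
| "lincomb (p # l) t = fst p \<odot>\<^bsub>fib E t\<^esub> basic E (snd p) t \<oplus>\<^bsub>fib E t\<^esub> lincomb l t"

abbreviation rat_lists :: "(complex \<times> nat) list set" where
  "rat_lists \<equiv> lists (gauss_rats \<times> UNIV)"

lemma countable_rat_lists: "countable rat_lists"
  by (intro countable_lists countable_SIGMA countable_gauss_rats) auto

lemma measurable_section_lincomb: "measurable_section E (lincomb l)"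
proof (induction l)
  case Nil
  have "lincomb [] = (\<lambda>t. \<zero>\<^bsub>fib E t\<^esub>)" by auto
  then show ?case using measurable_section_zero by simp
next
  case (Cons p l)
  have "lincomb (p # l) = (\<lambda>t. fst p \<odot>\<^bsub>fib E t\<^esub> basic E (snd p) t \<oplus>\<^bsub>fib E t\<^esub> lincomb l t)" by auto
  then show ?case
    using measurable_section_add[OF measurable_section_smult[OF measurable_section_basic] Cons] by simp
qed

lemmas lincomb_mem = measurable_section_mem[OF measurable_section_lincomb]

lemma cinner_lincomb_measurable:
  assumes x: "measurable_section E x"
  shows "(\<lambda>t. cinner (fib E t) (lincomb l t) (x t)) \<in> borel_measurable pos_borel"
proof (induction l)
  case Nil
  have "cinner (fib E t) (lincomb [] t) (x t) = 0" if "t > 0" for t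
  proof -
    interpret hilbert_space "fib E t" by (rule hilbert_fib[OF that])
    show ?thesis using measurable_section_mem[OF x that] by simp
  qed
  then show ?case by (subst pos_borel_cong[of _ "\<lambda>_. 0"]) auto
next
  case (Cons p l)
  have "cinner (fib E t) (lincomb (p # l) t) (x t) =
      cnj (fst p) * cinner (fib E t) (basic E (snd p) t) (x t) + cinner (fib E t) (lincomb l t) (x t)" if "t > 0" for t
  proof -
    interpret hilbert_space "fib E t" by (rule hilbert_fib[OF that])
    show ?thesis using measurable_section_mem[OF x that] lincomb_mem[OF that] basic_mem[OF that]
      by (simp add: cinner_simps)
  qed
  then show ?case
    by (subst pos_borel_cong[of _ "\<lambda>t. cnj (fst p) * cinner (fib E t) (basic E (snd p) t) (x t) + cinner (fib E t) (lincomb l t) (x t)"])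
      (simp, intro borel_measurable_add borel_measurable_times borel_measurable_const measurable_section_cinner x Cons)
qed

text \<open>The vectors that can be approximated form a closed subspace containing the basic vectors
  at \<open>t\<close>, which are total.\<close>

lemma lincomb_dense:
  assumes t: "t > 0" and x: "x \<in> carrier (fib E t)" and e: "e > 0"
  shows "\<exists>l\<in>rat_lists. hnorm (fib E t) (x \<ominus>\<^bsub>fib E t\<^esub> lincomb l t) < e"
proof -
  interpret hilbert_space "fib E t" by (rule hilbert_fib[OF t])
  note lm = lincomb_mem[OF t]
  define N where "N = {x \<in> carrier (fib E t). \<forall>e>0. \<exists>l\<in>rat_lists. hnorm (fib E t) (x \<ominus>\<^bsub>fib E t\<^esub> lincomb l t) < e}"
  have app: "lincomb (l @ l') t = lincomb l t \<oplus>\<^bsub>fib E t\<^esub> lincomb l' t" for l l'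
    by (induction l) (use lm basic_mem[OF t] in \<open>auto simp: M.a_assoc\<close>)
  have scl: "lincomb (map (\<lambda>p. (q * fst p, snd p)) l) t = q \<odot>\<^bsub>fib E t\<^esub> lincomb l t" for q l
    by (induction l) (use lm basic_mem[OF t] in \<open>auto simp: smult_smult smult_r_distr\<close>)
  have "closed_subspace (fib E t) N"
  proof (rule closed_subspaceI)
    show "N \<subseteq> carrier (fib E t)" by (auto simp: N_def)
    show "\<zero>\<^bsub>fib E t\<^esub> \<in> N"
      unfolding N_def by (auto intro!: bexI[of _ "[]"])
    show "x \<oplus>\<^bsub>fib E t\<^esub> y \<in> N" if x: "x \<in> N" and y: "y \<in> N" for x y
      unfolding N_def
    proof (intro CollectI conjI allI impI)
      have xy: "x \<in> carrier (fib E t)" "y \<in> carrier (fib E t)" using x y by (auto simp: N_def)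
      then show "x \<oplus>\<^bsub>fib E t\<^esub> y \<in> carrier (fib E t)" by simp
      fix e :: real assume e: "e > 0"
      obtain l where l: "l \<in> rat_lists" "hnorm (fib E t) (x \<ominus>\<^bsub>fib E t\<^esub> lincomb l t) < e / 2"
        using x half_gt_zero[OF e] unfolding N_def by blast
      obtain l' where l': "l' \<in> rat_lists" "hnorm (fib E t) (y \<ominus>\<^bsub>fib E t\<^esub> lincomb l' t) < e / 2"
        using y half_gt_zero[OF e] unfolding N_def by blast
      have "hnorm (fib E t) ((x \<oplus>\<^bsub>fib E t\<^esub> y) \<ominus>\<^bsub>fib E t\<^esub> lincomb (l @ l') t) < e"
        using hnorm_diff_add[OF xy lm lm, of l l'] l l' unfolding app by simp
      then show "\<exists>l\<in>rat_lists. hnorm (fib E t) ((x \<oplus>\<^bsub>fib E t\<^esub> y) \<ominus>\<^bsub>fib E t\<^esub> lincomb l t) < e"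
        using l l' by (intro bexI[of _ "l @ l'"]) auto
    qed
    show "c \<odot>\<^bsub>fib E t\<^esub> x \<in> N" if x: "x \<in> N" for c x
      unfolding N_def
    proof (intro CollectI conjI allI impI)
      have xc: "x \<in> carrier (fib E t)" using x by (auto simp: N_def)
      then show "c \<odot>\<^bsub>fib E t\<^esub> x \<in> carrier (fib E t)" by simp
      fix e :: real assume e: "e > 0"
      have h: "k * (e / (2 * k)) = e / 2" "e / (2 * k) * k = e / 2" if "k > 0" for k :: real using that by simp_all
      \<comment> \<open>Two errors of size \<open>e / 2\<close>: one from approximating
        \<open>x\<close>, scaled by \<open>c\<close>, and one from replacing \<open>c\<close> by a
        Gaussian rational, scaled by the approximant. The summands 1 keep the denominators
        positive.\<close>
      have d: "e / (2 * (norm c + 1)) > 0" using e by (simp add: add_nonneg_pos)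
      obtain l where l: "l \<in> rat_lists" "hnorm (fib E t) (x \<ominus>\<^bsub>fib E t\<^esub> lincomb l t) < e / (2 * (norm c + 1))"
        using x d unfolding N_def by blast
      let ?r = "lincomb l t"
      have d': "e / (2 * (hnorm (fib E t) ?r + 1)) > 0" using e lm[of l] by (simp add: add_nonneg_pos)
      obtain q where q: "q \<in> gauss_rats" "norm (c - q) < e / (2 * (hnorm (fib E t) ?r + 1))"
        using gauss_rats_dense[OF d'] by blast
      have "hnorm (fib E t) (c \<odot>\<^bsub>fib E t\<^esub> x \<ominus>\<^bsub>fib E t\<^esub> q \<odot>\<^bsub>fib E t\<^esub> ?r) \<le>
          hnorm (fib E t) (c \<odot>\<^bsub>fib E t\<^esub> x \<ominus>\<^bsub>fib E t\<^esub> c \<odot>\<^bsub>fib E t\<^esub> ?r) + hnorm (fib E t) (c \<odot>\<^bsub>fib E t\<^esub> ?r \<ominus>\<^bsub>fib E t\<^esub> q \<odot>\<^bsub>fib E t\<^esub> ?r)"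
        using xc lm by (intro hnorm_diff_triangle) auto
      also have "hnorm (fib E t) (c \<odot>\<^bsub>fib E t\<^esub> x \<ominus>\<^bsub>fib E t\<^esub> c \<odot>\<^bsub>fib E t\<^esub> ?r) = norm c * hnorm (fib E t) (x \<ominus>\<^bsub>fib E t\<^esub> ?r)"
        using xc lm by (rule hnorm_diff_smult)
      also have "hnorm (fib E t) (c \<odot>\<^bsub>fib E t\<^esub> ?r \<ominus>\<^bsub>fib E t\<^esub> q \<odot>\<^bsub>fib E t\<^esub> ?r) = norm (c - q) * hnorm (fib E t) ?r"
      proof -
        have "hnorm (fib E t) (c \<odot>\<^bsub>fib E t\<^esub> ?r \<ominus>\<^bsub>fib E t\<^esub> q \<odot>\<^bsub>fib E t\<^esub> ?r) = hnorm (fib E t) ((c - q) \<odot>\<^bsub>fib E t\<^esub> ?r)"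
          using lm by (intro hnorm_eqI) (auto simp: cinner_simps algebra_simps)
        then show ?thesis using lm by (simp add: hnorm_smult)
      qed
      also have "norm c * hnorm (fib E t) (x \<ominus>\<^bsub>fib E t\<^esub> ?r) + norm (c - q) * hnorm (fib E t) ?r < e"
      proof -
        have "norm c * hnorm (fib E t) (x \<ominus>\<^bsub>fib E t\<^esub> ?r) \<le> (norm c + 1) * hnorm (fib E t) (x \<ominus>\<^bsub>fib E t\<^esub> ?r)"
          using xc lm by (intro mult_right_mono) auto
        also have "\<dots> < (norm c + 1) * (e / (2 * (norm c + 1)))"
          by (intro mult_strict_left_mono l(2)) (simp add: add_nonneg_pos)
        also have "\<dots> = e / 2" by (rule h(1)) (simp add: add_nonneg_pos)
        finally have 1: "norm c * hnorm (fib E t) (x \<ominus>\<^bsub>fib E t\<^esub> ?r) < e / 2" .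
        have "norm (c - q) * hnorm (fib E t) ?r \<le> norm (c - q) * (hnorm (fib E t) ?r + 1)"
          by (intro mult_left_mono) auto
        also have "\<dots> \<le> e / (2 * (hnorm (fib E t) ?r + 1)) * (hnorm (fib E t) ?r + 1)"
          using q(2) lm[of l] by (intro mult_right_mono) auto
        also have "\<dots> = e / 2" using hnorm_nonneg[OF lm, of l] by (intro h(2)) simp
        finally show ?thesis using 1 by simp
      qed
      finally have "hnorm (fib E t) (c \<odot>\<^bsub>fib E t\<^esub> x \<ominus>\<^bsub>fib E t\<^esub> lincomb (map (\<lambda>p. (q * fst p, snd p)) l) t) < e"
        by (simp only: scl)
      moreover have "map (\<lambda>p. (q * fst p, snd p)) l \<in> rat_lists"
        using l(1) q(1) by (fastforce simp: gauss_rats_mult)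
      ultimately show "\<exists>l\<in>rat_lists. hnorm (fib E t) (c \<odot>\<^bsub>fib E t\<^esub> x \<ominus>\<^bsub>fib E t\<^esub> lincomb l t) < e"
        by blast
    qed
    fix X x assume X: "\<And>n. X n \<in> N" "x \<in> carrier (fib E t)" "hconverges (fib E t) X x"
    show "x \<in> N"
      unfolding N_def
    proof (intro CollectI conjI allI impI X(2))
      fix e :: real assume e: "e > 0"
      have "\<forall>\<^sub>F n in sequentially. hnorm (fib E t) (X n \<ominus>\<^bsub>fib E t\<^esub> x) < e / 2"
        using X(3) e unfolding hconverges_def by (intro order_tendstoD(2)) auto
      then obtain n where n: "hnorm (fib E t) (X n \<ominus>\<^bsub>fib E t\<^esub> x) < e / 2" by (auto simp: eventually_sequentially)
      obtain l where l: "l \<in> rat_lists" "hnorm (fib E t) (X n \<ominus>\<^bsub>fib E t\<^esub> lincomb l t) < e / 2"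
        using X(1)[of n] half_gt_zero[OF e] unfolding N_def by blast
      have Xn: "X n \<in> carrier (fib E t)" using X(1) by (auto simp: N_def)
      have "hnorm (fib E t) (x \<ominus>\<^bsub>fib E t\<^esub> lincomb l t) < e"
        using hnorm_diff_triangle[OF X(2) Xn lm, of l] hnorm_minus_commute[OF X(2) Xn] n l by simp
      then show "\<exists>l\<in>rat_lists. hnorm (fib E t) (x \<ominus>\<^bsub>fib E t\<^esub> lincomb l t) < e" using l by blast
    qed
  qed
  moreover have "range (\<lambda>n. basic E n t) \<subseteq> N"
  proof clarify
    fix n
    have "[(1, n)] \<in> rat_lists" by (auto simp: gauss_rats_def)
    moreover have "lincomb [(1, n)] t = basic E n t" using basic_mem[OF t] by simp
    ultimately have "\<exists>l\<in>rat_lists. hnorm (fib E t) (basic E n t \<ominus>\<^bsub>fib E t\<^esub> lincomb l t) < e" if "e > 0" for e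
      using that basic_mem[OF t] by (intro bexI[of _ "[(1, n)]"]) auto
    then show "basic E n t \<in> N" using basic_mem[OF t] by (auto simp: N_def)
  qed
  ultimately have "closed_span (fib E t) (range (\<lambda>n. basic E n t)) \<subseteq> N"
    by (rule closed_span_minimal)
  moreover have "closed_span (fib E t) (range (\<lambda>n. basic E n t)) = carrier (fib E t)"
    using arveson_system t by (simp add: arveson_system_def)
  ultimately show ?thesis using x e by (auto simp: N_def)
qed

text \<open>Completing the square: \<open>F l\<close> is the squared norm of \<open>x\<close> minus
  the squared distance from \<open>x\<close> to the combination \<open>l\<close>, and this distance
  becomes arbitrarily small. Inner products of \<open>x\<close> with basic vectors therefore
  determine the norm through a countable supremum.\<close>

lemma hnorm_sq_eq_SUP:
  assumes t: "t > 0" and x: "x \<in> carrier (fib E t)"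
  defines "F \<equiv> \<lambda>l. 2 * Re (cinner (fib E t) (lincomb l t) x) - Re (cinner (fib E t) (lincomb l t) (lincomb l t))"
  shows "bdd_above (F ` rat_lists)" "(hnorm (fib E t) x)\<^sup>2 = (SUP l\<in>rat_lists. F l)"
proof -
  interpret hilbert_space "fib E t" by (rule hilbert_fib[OF t])
  note lm = lincomb_mem[OF t]
  have F: "F l = (hnorm (fib E t) x)\<^sup>2 - (hnorm (fib E t) (x \<ominus>\<^bsub>fib E t\<^esub> lincomb l t))\<^sup>2" for l
    unfolding F_def using x lm[of l] cinner_commute[OF x lm[of l]]
    by (simp add: cinner_simps flip: Re_cinner_self)
  have le: "F l \<le> (hnorm (fib E t) x)\<^sup>2" for l unfolding F by simp
  show bdd: "bdd_above (F ` rat_lists)" by (intro bdd_aboveI2[of _ _ "(hnorm (fib E t) x)\<^sup>2"] le)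
  show "(hnorm (fib E t) x)\<^sup>2 = (SUP l\<in>rat_lists. F l)"
  proof (rule antisym)
    show "(SUP l\<in>rat_lists. F l) \<le> (hnorm (fib E t) x)\<^sup>2" by (rule cSUP_least) (auto intro: le)
    show "(hnorm (fib E t) x)\<^sup>2 \<le> (SUP l\<in>rat_lists. F l)"
    proof (rule field_le_epsilon)
      fix e :: real assume e: "e > 0"
      then obtain l where l: "l \<in> rat_lists" "hnorm (fib E t) (x \<ominus>\<^bsub>fib E t\<^esub> lincomb l t) < sqrt e"
        using lincomb_dense[OF t x, of "sqrt e"] by auto
      have "(hnorm (fib E t) (x \<ominus>\<^bsub>fib E t\<^esub> lincomb l t))\<^sup>2 \<le> (sqrt e)\<^sup>2"
        using l x lm by (intro power_mono) auto
      then have "(hnorm (fib E t) x)\<^sup>2 \<le> F l + e" using e unfolding F by simp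
      also have "F l \<le> (SUP l\<in>rat_lists. F l)" by (intro cSUP_upper l bdd)
      finally show "(hnorm (fib E t) x)\<^sup>2 \<le> (SUP l\<in>rat_lists. F l) + e" by simp
    qed
  qed
qed

lemma hnorm_sq_measurable:
  assumes x: "measurable_section E x"
  shows "(\<lambda>t. (hnorm (fib E t) (x t))\<^sup>2) \<in> borel_measurable pos_borel"
proof -
  have "(\<lambda>t. SUP l\<in>rat_lists. 2 * Re (cinner (fib E t) (lincomb l t) (x t)) - Re (cinner (fib E t) (lincomb l t) (lincomb l t)))
      \<in> borel_measurable pos_borel"
  proof (rule borel_measurable_cSUP[OF countable_rat_lists])
    fix l
    have "(\<lambda>t. cinner (fib E t) (lincomb l t) (x t)) \<in> borel_measurable pos_borel"
      "(\<lambda>t. cinner (fib E t) (lincomb l t) (lincomb l t)) \<in> borel_measurable pos_borel"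
      by (intro cinner_lincomb_measurable x measurable_section_lincomb)+
    then show "(\<lambda>t. 2 * Re (cinner (fib E t) (lincomb l t) (x t)) - Re (cinner (fib E t) (lincomb l t) (lincomb l t)))
      \<in> borel_measurable pos_borel" by measurable
  qed (use hnorm_sq_eq_SUP(1) measurable_section_mem[OF x] in \<open>auto simp: space_restrict_space\<close>)
  then show ?thesis
    by (subst pos_borel_cong[OF hnorm_sq_eq_SUP(2)]) (auto intro: measurable_section_mem[OF x])
qed

lemma Re_cinner_measurable:
  assumes x: "measurable_section E x" and y: "measurable_section E y"
  shows "(\<lambda>t. Re (cinner (fib E t) (x t) (y t))) \<in> borel_measurable pos_borel"
proof -
  have "Re (cinner (fib E t) (x t) (y t)) = ((hnorm (fib E t) (x t \<oplus>\<^bsub>fib E t\<^esub> y t))\<^sup>2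
      - (hnorm (fib E t) (x t))\<^sup>2 - (hnorm (fib E t) (y t))\<^sup>2) / 2" if t: "t > 0" for t
  proof -
    interpret hilbert_space "fib E t" by (rule hilbert_fib[OF t])
    show ?thesis
      using measurable_section_mem[OF x t] measurable_section_mem[OF y t]
        cinner_commute[OF measurable_section_mem[OF x t] measurable_section_mem[OF y t]]
      by (simp add: cinner_simps flip: Re_cinner_self)
  qed
  note eq = this
  show ?thesis
    by (subst pos_borel_cong[OF eq], assumption, intro borel_measurable_divide borel_measurable_diff
        borel_measurable_const hnorm_sq_measurable measurable_section_add x y)
qed

text \<open>By definition a measurable section is tested against basic sections only. General pairs
  are needed because a morphism need not send basic sections to basic sections. Norms give the real
  part by polarisation, and multiplication by \<i> the imaginary part.\<close>

lemma cinner_measurable: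
  assumes x: "measurable_section E x" and y: "measurable_section E y"
  shows "(\<lambda>t. cinner (fib E t) (x t) (y t)) \<in> borel_measurable pos_borel"
proof -
  have "Im (cinner (fib E t) (x t) (y t)) = - Re (cinner (fib E t) (x t) (\<i> \<odot>\<^bsub>fib E t\<^esub> y t))" if t: "t > 0" for t
  proof -
    interpret hilbert_space "fib E t" by (rule hilbert_fib[OF t])
    show ?thesis
      using measurable_section_mem[OF x t] measurable_section_mem[OF y t] by (simp add: cinner_simps)
  qed
  note eq = this
  have "(\<lambda>t. Im (cinner (fib E t) (x t) (y t))) \<in> borel_measurable pos_borel"
    by (subst pos_borel_cong[OF eq], assumption,
        intro borel_measurable_uminus Re_cinner_measurable measurable_section_smult x y)
  then show ?thesis
    using Re_cinner_measurable[OF x y] by (simp add: borel_measurable_complex_iff)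
qed

end

section \<open>Roots\<close>

text \<open>Nonnegativity makes an additive function monotone; enclosing a multiple of
  \<open>t\<close> between consecutive integers then squeezes \<open>f t\<close>.\<close>

lemma additive_nonneg_linear:
  fixes f :: "real \<Rightarrow> real"
  assumes add: "\<And>s t. s > 0 \<Longrightarrow> t > 0 \<Longrightarrow> f (s + t) = f s + f t"
    and nonneg: "\<And>t. t > 0 \<Longrightarrow> f t \<ge> 0" and t: "t > 0"
  shows "f t = t * f 1"
proof -
  have mult: "f (real (Suc n) * s) = real (Suc n) * f s" if s: "s > 0" for n s
  proof (induction n)
    case (Suc n)
    have "f (real (Suc (Suc n)) * s) = f (real (Suc n) * s + s)" by (simp add: algebra_simps)
    also have "\<dots> = f (real (Suc n) * s) + f s" using s by (intro add) auto
    finally show ?case using Suc by (simp add: algebra_simps)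
  qed simp
  have mono: "f r \<le> f s" if "0 < r" "r \<le> s" for r s
    using add[of r "s - r"] nonneg[of "s - r"] that by (cases "r = s") auto
  have "\<bar>f t - t * f 1\<bar> \<le> e" if e: "e > 0" for e
  proof -
    \<comment> \<open>The enclosure has error at most \<open>f 1\<close>, which division by
      \<open>n\<close> brings below \<open>e\<close>. The bound \<open>1 / t\<close> ensures that
      the lower integer \<open>k\<close> is at least 1, since \<open>f\<close> is controlled only at
      positive arguments.\<close>
    obtain n where n: "real n > max (f 1 / e) (1 / t)" using reals_Archimedean2 by blast
    have n0: "real n > 0" using n t by (meson divide_pos_pos less_trans max_less_iff_conj zero_less_one)
    then obtain m where m: "n = Suc m" by (cases n) auto
    have nt: "1 < real n * t" using n t by (simp add: divide_less_eq)
    define k where "k = nat \<lfloor>real n * t\<rfloor>"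
    have k: "real k \<le> real n * t" "real n * t \<le> real k + 1"
      using nt by (auto simp: k_def)
    have k1: "k \<ge> 1" using nt by (simp add: k_def le_nat_iff)
    then obtain l where l: "k = Suc l" by (cases k) auto
    have fk: "f (real k) = real k * f 1" using mult[of 1 l] by (simp add: l)
    have fk1: "f (real (Suc k)) = real (Suc k) * f 1" using mult[of 1 k] by simp
    have fn: "f (real n * t) = real n * f t" using mult[OF t, of m] by (simp add: m)
    have 1: "real k * f 1 \<le> real n * f t" using mono[of "real k" "real n * t"] k k1 fk fn by simp
    have 2: "real n * f t \<le> (real k + 1) * f 1" using mono[of "real n * t" "real (Suc k)"] k nt fk1 fn by (simp add: add.commute)
    have 3: "real k * f 1 \<le> real n * t * f 1" "real n * t * f 1 \<le> (real k + 1) * f 1"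
      using k nonneg[of 1] by (auto intro!: mult_right_mono)
    have "\<bar>real n * (f t - t * f 1)\<bar> \<le> f 1"
      using 1 2 3 by (simp add: abs_le_iff algebra_simps)
    then have "real n * \<bar>f t - t * f 1\<bar> \<le> f 1" using n0 by (simp add: abs_mult)
    also have "f 1 \<le> real n * e" using n e by (simp add: divide_less_eq)
    finally show ?thesis using n0 by simp
  qed
  then have "\<bar>f t - t * f 1\<bar> \<le> 0" by (rule field_le_epsilon) simp
  then show ?thesis by simp
qed

lemma is_rootD:
  assumes "is_root E u a"
  shows "measurable_section E a"
    "\<And>t. t > 0 \<Longrightarrow> a t \<in> carrier (fib E t)"
    "\<And>s t. s > 0 \<Longrightarrow> t > 0 \<Longrightarrow>
      a (s + t) = pmul E s t (a s) (u t) \<oplus>\<^bsub>fib E (s + t)\<^esub> pmul E s t (u s) (a t)"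
    "\<And>t. t > 0 \<Longrightarrow> cinner (fib E t) (a t) (u t) = 0"
  using assms by (auto simp: is_root_def measurable_section_def is_section_def)

lemma normalised_unitD:
  assumes "normalised_unit E u"
  shows "measurable_section E u" "\<And>t. t > 0 \<Longrightarrow> u t \<in> carrier (fib E t)"
    "\<And>s t. s > 0 \<Longrightarrow> t > 0 \<Longrightarrow> u (s + t) = pmul E s t (u s) (u t)"
    "\<And>t. t > 0 \<Longrightarrow> hnorm (fib E t) (u t) = 1"
  using assms by (auto simp: normalised_unit_def is_unit_def measurable_section_def is_section_def)

section \<open>Linear structure, scaling and limits of roots\<close>

locale arveson_unit = arveson +
  fixes u
  assumes unit: "normalised_unit E u"
begin

lemmas u_mem = normalised_unitD(2)[OF unit]

lemma cinner_u_u: "t > 0 \<Longrightarrow> cinner (fib E t) (u t) (u t) = 1"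
proof -
  assume t: "t > 0"
  interpret hilbert_space "fib E t" by (rule hilbert_fib[OF t])
  show ?thesis using normalised_unitD[OF unit] t by (simp add: cinner_self)
qed

lemma cinner_u_root: "is_root E u a \<Longrightarrow> t > 0 \<Longrightarrow> cinner (fib E t) (u t) (a t) = 0"
proof -
  assume a: "is_root E u a" and t: "t > 0"
  interpret hilbert_space "fib E t" by (rule hilbert_fib[OF t])
  show ?thesis using cinner_commute[of "a t" "u t"] is_rootD[OF a] u_mem t by simp
qed

lemma is_root_zero: "is_root E u (\<lambda>t. \<zero>\<^bsub>fib E t\<^esub>)"
  unfolding is_root_def
proof (intro conjI allI impI measurable_section_zero)
  fix s t :: real assume st: "s > 0" "t > 0"
  interpret S: hilbert_space "fib E s" by (rule hilbert_fib[OF st(1)])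
  interpret T: hilbert_space "fib E t" by (rule hilbert_fib[OF st(2)])
  have st': "s + t > 0" using st by simp
  interpret ST: hilbert_space "fib E (s + t)" by (rule hilbert_fib[OF st'])
  show "\<zero>\<^bsub>fib E (s + t)\<^esub> = pmul E s t \<zero>\<^bsub>fib E s\<^esub> (u t) \<oplus>\<^bsub>fib E (s + t)\<^esub> pmul E s t (u s) \<zero>\<^bsub>fib E t\<^esub>"
    by (rule pmul_eqI[OF st]) (use u_mem st in \<open>simp_all add: ST.cinner_simps cinner_pmul\<close>)
next
  fix t :: real assume t: "t > 0"
  interpret T: hilbert_space "fib E t" by (rule hilbert_fib[OF t])
  show "cinner (fib E t) \<zero>\<^bsub>fib E t\<^esub> (u t) = 0" using u_mem[OF t] by simp
qed

lemma is_root_smult: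
  assumes a: "is_root E u a"
  shows "is_root E u (\<lambda>t. c \<odot>\<^bsub>fib E t\<^esub> a t)"
  unfolding is_root_def
proof (intro conjI allI impI measurable_section_smult is_rootD(1)[OF a])
  fix s t :: real assume st: "s > 0" "t > 0"
  note m = u_mem[OF st(1)] u_mem[OF st(2)] is_rootD(2)[OF a st(1)] is_rootD(2)[OF a st(2)]
  have st': "s + t > 0" using st by simp
  interpret ST: hilbert_space "fib E (s + t)" by (rule hilbert_fib[OF st'])
  show "c \<odot>\<^bsub>fib E (s + t)\<^esub> a (s + t) = pmul E s t (c \<odot>\<^bsub>fib E s\<^esub> a s) (u t) \<oplus>\<^bsub>fib E (s + t)\<^esub> pmul E s t (u s) (c \<odot>\<^bsub>fib E t\<^esub> a t)"
    using m st by (simp add: is_rootD(3)[OF a st] pmul_linear[OF st] ST.smult_r_distr)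
next
  fix t :: real assume t: "t > 0"
  interpret T: hilbert_space "fib E t" by (rule hilbert_fib[OF t])
  show "cinner (fib E t) (c \<odot>\<^bsub>fib E t\<^esub> a t) (u t) = 0"
    using is_rootD[OF a] u_mem t by (simp add: T.cinner_simps)
qed

lemma is_root_add:
  assumes a: "is_root E u a" and b: "is_root E u b"
  shows "is_root E u (\<lambda>t. a t \<oplus>\<^bsub>fib E t\<^esub> b t)"
  unfolding is_root_def
proof (intro conjI allI impI measurable_section_add is_rootD(1)[OF a] is_rootD(1)[OF b])
  fix s t :: real assume st: "s > 0" "t > 0"
  note m = u_mem[OF st(1)] u_mem[OF st(2)] is_rootD(2)[OF a st(1)] is_rootD(2)[OF a st(2)]
    is_rootD(2)[OF b st(1)] is_rootD(2)[OF b st(2)]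
  have st': "s + t > 0" using st by simp
  interpret ST: hilbert_space "fib E (s + t)" by (rule hilbert_fib[OF st'])
  show "a (s + t) \<oplus>\<^bsub>fib E (s + t)\<^esub> b (s + t) = pmul E s t (a s \<oplus>\<^bsub>fib E s\<^esub> b s) (u t) \<oplus>\<^bsub>fib E (s + t)\<^esub> pmul E s t (u s) (a t \<oplus>\<^bsub>fib E t\<^esub> b t)"
    using m st by (simp add: is_rootD(3)[OF a st] is_rootD(3)[OF b st] pmul_linear[OF st] ST.M.a_ac)
next
  fix t :: real assume t: "t > 0"
  interpret T: hilbert_space "fib E t" by (rule hilbert_fib[OF t])
  show "cinner (fib E t) (a t \<oplus>\<^bsub>fib E t\<^esub> b t) (u t) = 0"
    using is_rootD[OF a] is_rootD[OF b] u_mem t by (simp add: T.cinner_simps)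
qed

text \<open>Identities derived from membership in the fibres are available only at positive times,
  while sections are total functions on the reals; this rule bridges the gap.\<close>

lemma is_root_cong:
  assumes a: "is_root E u a" and eq: "\<And>t. t > 0 \<Longrightarrow> b t = a t"
  shows "is_root E u b"
  unfolding is_root_def measurable_section_def is_section_def
proof (intro conjI allI impI)
  fix n
  show "(\<lambda>t. cinner (fib E t) (basic E n t) (b t)) \<in> borel_measurable pos_borel"
    by (subst pos_borel_cong[of _ "\<lambda>t. cinner (fib E t) (basic E n t) (a t)"])
      (use eq measurable_section_cinner[OF is_rootD(1)[OF a]] in auto)
qed (use eq is_rootD[OF a] in auto)

lemma is_root_diff:
  assumes a: "is_root E u a" and b: "is_root E u b"
  shows "is_root E u (\<lambda>t. a t \<ominus>\<^bsub>fib E t\<^esub> b t)"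
proof (rule is_root_cong[OF is_root_add[OF a is_root_smult[OF b, of "-1"]]])
  fix t :: real assume t: "t > 0"
  interpret T: hilbert_space "fib E t" by (rule hilbert_fib[OF t])
  show "a t \<ominus>\<^bsub>fib E t\<^esub> b t = a t \<oplus>\<^bsub>fib E t\<^esub> (-1) \<odot>\<^bsub>fib E t\<^esub> b t"
    using is_rootD(2)[OF a t] is_rootD(2)[OF b t] by (simp add: T.minus_eq_smult)
qed

text \<open>The two summands of the root equation are orthogonal because a root is orthogonal to the
  unit at each time, and the unit has norm one. So the squared norm is additive in time.\<close>

lemma hnorm_root:
  assumes a: "is_root E u a" and t: "t > 0"
  shows "(hnorm (fib E t) (a t))\<^sup>2 = t * (hnorm (fib E 1) (a 1))\<^sup>2"
proof (rule additive_nonneg_linear[where f = "\<lambda>t. (hnorm (fib E t) (a t))\<^sup>2", OF _ _ t])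
  fix s t :: real assume st: "s > 0" "t > 0"
  note m = u_mem[OF st(1)] u_mem[OF st(2)] is_rootD(2)[OF a st(1)] is_rootD(2)[OF a st(2)]
  have st': "s + t > 0" using st by simp
  interpret S: hilbert_space "fib E s" by (rule hilbert_fib[OF st(1)])
  interpret T: hilbert_space "fib E t" by (rule hilbert_fib[OF st(2)])
  interpret ST: hilbert_space "fib E (s + t)" by (rule hilbert_fib[OF st'])
  have "cinner (fib E (s + t)) (a (s + t)) (a (s + t)) = cinner (fib E s) (a s) (a s) + cinner (fib E t) (a t) (a t)"
    using m st unfolding is_rootD(3)[OF a st]
    by (simp add: ST.cinner_simps cinner_pmul cinner_u_u cinner_u_root[OF a] is_rootD(4)[OF a])
  then show "(hnorm (fib E (s + t)) (a (s + t)))\<^sup>2 = (hnorm (fib E s) (a s))\<^sup>2 + (hnorm (fib E t) (a t))\<^sup>2"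
    using m is_rootD(2)[OF a st'] by (simp flip: S.Re_cinner_self T.Re_cinner_self ST.Re_cinner_self)
qed auto

text \<open>Every clause can be tested by inner products with fixed vectors and hence survives
  pointwise limits. For the root equation, products suffice as test vectors, and they factor all
  terms on the right.\<close>

lemma root_limit:
  assumes A: "\<And>n. is_root E u (A n)" and a: "\<And>t. t > 0 \<Longrightarrow> a t \<in> carrier (fib E t)"
    and lim: "\<And>t. t > 0 \<Longrightarrow> hconverges (fib E t) (\<lambda>n. A n t) (a t)"
  shows "is_root E u a"
proof -
  note Am = is_rootD(2)[OF A]
  have lim_cinner: "(\<lambda>n. cinner (fib E t) z (A n t)) \<longlonglongrightarrow> cinner (fib E t) z (a t)"
    if t: "t > 0" and z: "z \<in> carrier (fib E t)" for t z
  proof -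
    interpret hilbert_space "fib E t" by (rule hilbert_fib[OF t])
    show ?thesis by (rule cinner_tendsto) (use z Am[OF t] a[OF t] lim[OF t] in auto)
  qed
  show ?thesis
    unfolding is_root_def
  proof (intro conjI allI impI)
    show "measurable_section E a"
      unfolding measurable_section_def is_section_def
    proof (intro conjI allI impI a)
      fix n
      show "(\<lambda>t. cinner (fib E t) (basic E n t) (a t)) \<in> borel_measurable pos_borel"
        by (rule borel_measurable_LIMSEQ_metric[of "\<lambda>i t. cinner (fib E t) (basic E n t) (A i t)"])
          (use measurable_section_cinner[OF is_rootD(1)[OF A]] lim_cinner basic_mem in
            \<open>auto simp: space_restrict_space\<close>)
    qed
    fix t :: real assume t: "t > 0"
    interpret T: hilbert_space "fib E t" by (rule hilbert_fib[OF t])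
    have "(\<lambda>n. cinner (fib E t) (u t) (A n t)) \<longlonglongrightarrow> cinner (fib E t) (u t) (a t)"
      by (rule lim_cinner[OF t u_mem[OF t]])
    then have "cinner (fib E t) (u t) (a t) = 0" using cinner_u_root[OF A t] by (simp add: LIMSEQ_const_iff)
    then show "cinner (fib E t) (a t) (u t) = 0"
      using T.cinner_commute[OF u_mem[OF t] a[OF t]] by simp
  next
    fix s t :: real assume st: "s > 0" "t > 0"
    have st': "s + t > 0" using st by simp
    interpret S: hilbert_space "fib E s" by (rule hilbert_fib[OF st(1)])
    interpret T: hilbert_space "fib E t" by (rule hilbert_fib[OF st(2)])
    interpret ST: hilbert_space "fib E (s + t)" by (rule hilbert_fib[OF st'])
    note m = u_mem[OF st(1)] u_mem[OF st(2)] a[OF st(1)] a[OF st(2)] a[OF st'] Am[OF st(1)] Am[OF st(2)] Am[OF st']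
    show "a (s + t) = pmul E s t (a s) (u t) \<oplus>\<^bsub>fib E (s + t)\<^esub> pmul E s t (u s) (a t)"
    proof (rule pmul_eqI[OF st])
      fix x y assume x: "x \<in> carrier (fib E s)" and y: "y \<in> carrier (fib E t)"
      have "(\<lambda>n. cinner (fib E (s + t)) (pmul E s t x y) (A n (s + t))) \<longlonglongrightarrow> cinner (fib E (s + t)) (pmul E s t x y) (a (s + t))"
        by (rule lim_cinner[OF st' pmul_mem[OF st x y]])
      moreover have "cinner (fib E (s + t)) (pmul E s t x y) (A n (s + t)) =
          cinner (fib E s) x (A n s) * cinner (fib E t) y (u t) + cinner (fib E s) x (u s) * cinner (fib E t) y (A n t)" for n
        using m x y st by (simp add: is_rootD(3)[OF A st] ST.cinner_simps cinner_pmul)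
      moreover have "(\<lambda>n. cinner (fib E s) x (A n s) * cinner (fib E t) y (u t) + cinner (fib E s) x (u s) * cinner (fib E t) y (A n t))
          \<longlonglongrightarrow> cinner (fib E s) x (a s) * cinner (fib E t) y (u t) + cinner (fib E s) x (u s) * cinner (fib E t) y (a t)"
        by (intro tendsto_intros lim_cinner st x y)
      ultimately have "cinner (fib E (s + t)) (pmul E s t x y) (a (s + t)) =
          cinner (fib E s) x (a s) * cinner (fib E t) y (u t) + cinner (fib E s) x (u s) * cinner (fib E t) y (a t)"
        using LIMSEQ_unique by simp
      then show "cinner (fib E (s + t)) (pmul E s t x y) (a (s + t)) =
          cinner (fib E (s + t)) (pmul E s t x y) (pmul E s t (a s) (u t) \<oplus>\<^bsub>fib E (s + t)\<^esub> pmul E s t (u s) (a t))"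
        using m x y st by (simp add: ST.cinner_simps cinner_pmul)
    qed (use m st in auto)
  qed
qed

lemma closed_subspace_root_space: "closed_subspace (fib E 1) (root_space E u)"
proof -
  interpret H: hilbert_space "fib E 1" by (rule hilbert_fib) simp
  show ?thesis
  proof (rule H.closed_subspaceI)
    show "root_space E u \<subseteq> carrier (fib E 1)" by (auto simp: root_space_def intro: is_rootD(2))
    show "\<zero>\<^bsub>fib E 1\<^esub> \<in> root_space E u" using is_root_zero by (auto simp: root_space_def)
    show "x \<oplus>\<^bsub>fib E 1\<^esub> y \<in> root_space E u" if "x \<in> root_space E u" "y \<in> root_space E u" for x y
      using that is_root_add by (fastforce simp: root_space_def)
    show "c \<odot>\<^bsub>fib E 1\<^esub> x \<in> root_space E u" if "x \<in> root_space E u" for c x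
      using that is_root_smult by (fastforce simp: root_space_def)
    fix X x assume X: "\<And>n. X n \<in> root_space E u" "x \<in> carrier (fib E 1)" "hconverges (fib E 1) X x"
    then have "\<exists>a. is_root E u a \<and> X n = a 1" for n by (auto simp: root_space_def)
    then obtain A where A: "\<And>n. is_root E u (A n)" "\<And>n. X n = A n 1" by metis
    have "\<exists>a\<in>carrier (fib E t). hconverges (fib E t) (\<lambda>n. A n t) a" if t: "t > 0" for t
    proof -
      interpret T: hilbert_space "fib E t" by (rule hilbert_fib[OF t])
      note Am = is_rootD(2)[OF A(1) t]
      \<comment> \<open>Differences of roots are roots, so the scaling of norms carries the Cauchy
        property from time 1 to every time and yields a limit section.\<close>
      have eq: "hnorm (fib E t) (A m t \<ominus>\<^bsub>fib E t\<^esub> A n t) = sqrt t * hnorm (fib E 1) (X m \<ominus>\<^bsub>fib E 1\<^esub> X n)" for m n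
      proof -
        have "(hnorm (fib E t) (A m t \<ominus>\<^bsub>fib E t\<^esub> A n t))\<^sup>2 = (sqrt t * hnorm (fib E 1) (X m \<ominus>\<^bsub>fib E 1\<^esub> X n))\<^sup>2"
          using hnorm_root[OF is_root_diff[OF A(1) A(1)] t, of m n] t by (simp add: A(2) power_mult_distrib)
        moreover have "0 \<le> sqrt t * hnorm (fib E 1) (X m \<ominus>\<^bsub>fib E 1\<^esub> X n)"
          using t is_rootD(2)[OF A(1)] by (simp add: A(2))
        ultimately show ?thesis using Am by (simp add: power2_eq_iff_nonneg)
      qed
      have c: "hcauchy (fib E 1) X"
        by (rule H.hconverges_hcauchy[OF _ X(2,3)]) (use is_rootD(2)[OF A(1)] A(2) in auto)
      have "hcauchy (fib E t) (\<lambda>n. A n t)"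
        unfolding hcauchy_def
      proof (intro conjI allI impI Am)
        fix e :: real assume e: "e > 0"
        then have "e / sqrt t > 0" using t by simp
        then obtain N where N: "\<And>m n. m \<ge> N \<Longrightarrow> n \<ge> N \<Longrightarrow> hnorm (fib E 1) (X m \<ominus>\<^bsub>fib E 1\<^esub> X n) < e / sqrt t"
          using c unfolding hcauchy_def by blast
        then show "\<exists>N. \<forall>m\<ge>N. \<forall>n\<ge>N. hnorm (fib E t) (A m t \<ominus>\<^bsub>fib E t\<^esub> A n t) < e"
          using t by (intro exI[of _ N]) (simp add: eq field_simps)
      qed
      then show ?thesis by (rule T.complete)
    qed
    then obtain a where a: "\<And>t. t > 0 \<Longrightarrow> a t \<in> carrier (fib E t)"
      "\<And>t. t > 0 \<Longrightarrow> hconverges (fib E t) (\<lambda>n. A n t) (a t)" by metis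
    have "X = (\<lambda>n. A n 1)" using A(2) by auto
    then have "hconverges (fib E 1) X (a 1)" using a(2)[of 1] by simp
    moreover have "X n \<in> carrier (fib E 1)" for n using is_rootD(2)[OF A(1)] A(2) by simp
    ultimately have "x = a 1"
      using H.hconverges_unique[of X x "a 1"] X(2,3) a(1)[of 1] by simp
    then show "x \<in> root_space E u" using root_limit[OF A(1) a] by (auto simp: root_space_def)
  qed
qed

end

section \<open>Transport of units and roots along isometric morphisms\<close>

locale arveson_isometry = D: arveson D + E: arveson E for D :: "'d arveson" and E :: "'e arveson" +
  fixes J
  assumes morphism: "arveson_morphism D E J" and isometric: "isometric_family D E J"
begin

lemma isometric_J: "t > 0 \<Longrightarrow> isometric_op (fib D t) (fib E t) (J t)"
  using isometric by (simp add: isometric_family_def)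

lemma J_mem [simp]: "t > 0 \<Longrightarrow> x \<in> carrier (fib D t) \<Longrightarrow> J t x \<in> carrier (fib E t)"
  using isometric_J[of t] by (auto simp: isometric_op_def linear_op_def)

lemma two_hilbert_J: "t > 0 \<Longrightarrow> two_hilbert (fib D t) (fib E t)"
  by (simp add: two_hilbert_def D.hilbert_fib E.hilbert_fib)

lemma cinner_J:
  assumes t: "t > 0" and x: "x \<in> carrier (fib D t)" and y: "y \<in> carrier (fib D t)"
  shows "cinner (fib E t) (J t x) (J t y) = cinner (fib D t) x y"
proof -
  interpret two_hilbert "fib D t" "fib E t" by (rule two_hilbert_J[OF t])
  show ?thesis by (rule isometric_cinner[OF isometric_J[OF t] x y])
qed

lemma pmul_J:
  "\<lbrakk>s > 0; t > 0; x \<in> carrier (fib D s); y \<in> carrier (fib D t)\<rbrakk> \<Longrightarrow>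
    J (s + t) (pmul D s t x y) = pmul E s t (J s x) (J t y)"
  by (rule isometric_morphism_pmul)
    (use D.product_system E.product_system morphism isometric in \<open>auto simp: arveson_morphism_def\<close>)

lemma measurable_section_J: "measurable_section D x \<Longrightarrow> measurable_section E (\<lambda>t. J t (x t))"
  using morphism by (simp add: arveson_morphism_def)

abbreviation adj :: "real \<Rightarrow> 'e \<Rightarrow> 'd" where
  "adj t \<equiv> adjoint_op (fib D t) (fib E t) (J t)"

lemma adj_mem [simp]: "t > 0 \<Longrightarrow> y \<in> carrier (fib E t) \<Longrightarrow> adj t y \<in> carrier (fib D t)"
  using two_hilbert.isometric_adjoint_mem[OF two_hilbert_J isometric_J] by blast

lemma cinner_adj_right:
  "\<lbrakk>t > 0; y \<in> carrier (fib E t); z \<in> carrier (fib D t)\<rbrakk> \<Longrightarrow>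
    cinner (fib D t) z (adj t y) = cinner (fib E t) (J t z) y"
  using two_hilbert.cinner_isometric_adjoint[OF two_hilbert_J isometric_J] by blast

lemma cinner_adj_left:
  assumes t: "t > 0" and y: "y \<in> carrier (fib E t)" and z: "z \<in> carrier (fib D t)"
  shows "cinner (fib D t) (adj t y) z = cinner (fib E t) y (J t z)"
proof -
  interpret two_hilbert "fib D t" "fib E t" by (rule two_hilbert_J[OF t])
  show ?thesis
    using V.cinner_commute[OF z adj_mem[OF t y]] W.cinner_commute[OF J_mem[OF t z] y] cinner_adj_right[OF t y z] by simp
qed

lemma normalised_unit_J:
  assumes v: "normalised_unit D v"
  shows "normalised_unit E (\<lambda>t. J t (v t))"
proof -
  note vD = normalised_unitD[OF v]
  have n: "hnorm (fib E t) (J t (v t)) = 1" if "t > 0" for t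
    using isometric_J[OF that] vD that by (simp add: isometric_op_def)
  interpret H: hilbert_space "fib E 1" by (rule E.hilbert_fib) simp
  have "J 1 (v 1) \<noteq> \<zero>\<^bsub>fib E 1\<^esub>" using n[of 1] by auto
  then show ?thesis
    using vD n measurable_section_J[OF vD(1)]
    by (auto simp: normalised_unit_def is_unit_def pmul_J intro!: exI[of _ 1])
qed

text \<open>\<open>J\<close> preserves norms and is injective and multiplicative, so the unit
  properties descend from \<open>u\<close> to a measurable preimage. This applies to the image of
  \<open>u2\<close> under \<open>C\<close>.\<close>

lemma normalised_unit_reflect:
  assumes u: "normalised_unit E u" and v: "measurable_section D v" and uv: "\<And>t. t > 0 \<Longrightarrow> J t (v t) = u t"
  shows "normalised_unit D v"
proof -
  note uD = normalised_unitD[OF u]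
  have vm: "v t \<in> carrier (fib D t)" if "t > 0" for t
    using D.measurable_section_mem[OF v that] .
  have n: "hnorm (fib D t) (v t) = 1" if "t > 0" for t
  proof -
    have "hnorm (fib E t) (J t (v t)) = hnorm (fib D t) (v t)"
      using isometric_J[OF that] vm[OF that] unfolding isometric_op_def by blast
    then show ?thesis using uD(4)[OF that] uv[OF that] by simp
  qed
  interpret H: hilbert_space "fib D 1" by (rule D.hilbert_fib) simp
  have "v 1 \<noteq> \<zero>\<^bsub>fib D 1\<^esub>" using n[of 1] by auto
  moreover have "v (s + t) = pmul D s t (v s) (v t)" if st: "s > 0" "t > 0" for s t
  proof -
    have st': "s + t > 0" using st by simp
    interpret two_hilbert "fib D (s + t)" "fib E (s + t)" by (rule two_hilbert_J[OF st'])
    show ?thesis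
      by (rule isometric_inj[OF isometric_J[OF st']])
        (use vm st uD(3)[OF st] in \<open>simp_all add: pmul_J uv D.pmul_mem\<close>)
  qed
  ultimately show ?thesis
    using v n by (auto simp: normalised_unit_def is_unit_def intro!: exI[of _ 1])
qed

context
  fixes u v
  assumes v: "\<And>t. t > 0 \<Longrightarrow> v t \<in> carrier (fib D t)" and uv: "\<And>t. t > 0 \<Longrightarrow> J t (v t) = u t"
begin

lemma is_root_J:
  assumes a: "is_root D v a"
  shows "is_root E u (\<lambda>t. J t (a t))"
  unfolding is_root_def
proof (intro conjI allI impI measurable_section_J is_rootD(1)[OF a])
  fix s t :: real assume st: "s > 0" "t > 0"
  have st': "s + t > 0" using st by simp
  note m = is_rootD(2)[OF a st(1)] is_rootD(2)[OF a st(2)] v[OF st(1)] v[OF st(2)]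
  have "J (s + t) (x \<oplus>\<^bsub>fib D (s + t)\<^esub> y) = J (s + t) x \<oplus>\<^bsub>fib E (s + t)\<^esub> J (s + t) y"
    if "x \<in> carrier (fib D (s + t))" "y \<in> carrier (fib D (s + t))" for x y
    using isometric_J[OF st'] that by (simp add: isometric_op_def linear_op_def)
  then show "J (s + t) (a (s + t)) = pmul E s t (J s (a s)) (u t) \<oplus>\<^bsub>fib E (s + t)\<^esub> pmul E s t (u s) (J t (a t))"
    using m st by (simp add: is_rootD(3)[OF a st] pmul_J D.pmul_mem flip: uv)
next
  fix t :: real assume t: "t > 0"
  show "cinner (fib E t) (J t (a t)) (u t) = 0"
    using cinner_J[OF t is_rootD(2)[OF a t] v[OF t]] is_rootD(4)[OF a t] uv[OF t] by simp
qed

text \<open>Testing the adjoint against a product \<open>pmul D s t x y\<close> moves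
  \<open>J\<close> to the other side as \<open>pmul E s t (J s x) (J t y)\<close>, where the root
  equation of \<open>a\<close> factors. Likewise testing against a basic section becomes testing
  \<open>a\<close> against its image, a measurable section.\<close>

lemma is_root_adj:
  assumes a: "is_root E u a"
  shows "is_root D v (\<lambda>t. adj t (a t))"
  unfolding is_root_def measurable_section_def is_section_def
proof (intro conjI allI impI)
  note am = is_rootD(2)[OF a]
  show "adj t (a t) \<in> carrier (fib D t)" if "t > 0" for t using am[OF that] that by simp
  show "(\<lambda>t. cinner (fib D t) (basic D n t) (adj t (a t))) \<in> borel_measurable pos_borel" for n
    by (subst pos_borel_cong[of _ "\<lambda>t. cinner (fib E t) (J t (basic D n t)) (a t)"])
      (use am D.basic_mem E.cinner_measurable[OF measurable_section_J[OF D.measurable_section_basic] is_rootD(1)[OF a]]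
        in \<open>auto simp: cinner_adj_right\<close>)
  show "cinner (fib D t) (adj t (a t)) (v t) = 0" if t: "t > 0" for t
    using cinner_adj_left[OF t am[OF t] v[OF t]] uv[OF t] is_rootD(4)[OF a t] by simp
  fix s t :: real assume st: "s > 0" "t > 0"
  have st': "s + t > 0" using st by simp
  interpret DH: hilbert_space "fib D (s + t)" by (rule D.hilbert_fib[OF st'])
  interpret EH: hilbert_space "fib E (s + t)" by (rule E.hilbert_fib[OF st'])
  note m = am[OF st(1)] am[OF st(2)] am[OF st'] v[OF st(1)] v[OF st(2)]
    J_mem[OF st(1) v[OF st(1)]] J_mem[OF st(2) v[OF st(2)]]
  show "adj (s + t) (a (s + t)) = pmul D s t (adj s (a s)) (v t) \<oplus>\<^bsub>fib D (s + t)\<^esub> pmul D s t (v s) (adj t (a t))"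
  proof (rule D.pmul_eqI[OF st])
    fix x y assume x: "x \<in> carrier (fib D s)" and y: "y \<in> carrier (fib D t)"
    have "cinner (fib D (s + t)) (pmul D s t x y) (adj (s + t) (a (s + t)))
       = cinner (fib E (s + t)) (pmul E s t (J s x) (J t y)) (a (s + t))"
      using m x y st st' by (simp add: cinner_adj_right D.pmul_mem pmul_J)
    also have "\<dots> = cinner (fib E s) (J s x) (a s) * cinner (fib E t) (J t y) (J t (v t))
        + cinner (fib E s) (J s x) (J s (v s)) * cinner (fib E t) (J t y) (a t)"
      using m x y st unfolding is_rootD(3)[OF a st] uv[OF st(1), symmetric] uv[OF st(2), symmetric]
      by (simp add: EH.cinner_simps E.pmul_mem E.cinner_pmul)
    also have "\<dots> = cinner (fib D (s + t)) (pmul D s t x y)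
        (pmul D s t (adj s (a s)) (v t) \<oplus>\<^bsub>fib D (s + t)\<^esub> pmul D s t (v s) (adj t (a t)))"
      using m x y st
      by (simp add: DH.cinner_simps D.pmul_mem D.cinner_pmul cinner_J cinner_adj_right)
    finally show "cinner (fib D (s + t)) (pmul D s t x y) (adj (s + t) (a (s + t))) =
      cinner (fib D (s + t)) (pmul D s t x y)
        (pmul D s t (adj s (a s)) (v t) \<oplus>\<^bsub>fib D (s + t)\<^esub> pmul D s t (v s) (adj t (a t)))" .
  qed (use m st st' in \<open>auto simp: D.pmul_mem\<close>)
qed

end

end

section \<open>Amalgamated sums and generated subsystems\<close>

lemma (in hilbert_space) closed_subspace_hilbert_space:
  assumes W: "closed_subspace V W"
  shows "hilbert_space (V\<lparr>carrier := W\<rparr>)"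
proof -
  note D = closed_subspaceD[OF W]
  have WV: "x \<in> carrier V" if "x \<in> W" for x using D(1) that by auto
  have sub: "submodule W complex_field V" using W by (simp add: closed_subspace_def)
  interpret S: Module.module complex_field "V\<lparr>carrier := W\<rparr>"
    by (rule submodule.submodule_is_module[OF sub module_axioms])
  interpret S: semi_inner_space "V\<lparr>carrier := W\<rparr>"
    by (unfold_locales, simp_all add: WV cinner_add_right cinner_smult_right cinner_nonneg)
      (intro cinner_commute WV)
  \<comment> \<open>The additive inverse is a description relative to the carrier, so differences in
    the subspace have to be matched with differences in \<open>V\<close>.\<close>
  have minus: "x \<ominus>\<^bsub>V\<lparr>carrier := W\<rparr>\<^esub> y = x \<ominus> y" if "x \<in> W" "y \<in> W" for x y
    using S.minus_eq_smult[of x y] minus_eq_smult[of x y] that WV by simp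
  have norm: "hnorm (V\<lparr>carrier := W\<rparr>) x = hnorm V x" for x by (simp add: hnorm_def)
  show ?thesis
  proof unfold_locales
    show "x = \<zero>\<^bsub>V\<lparr>carrier := W\<rparr>\<^esub>" if "x \<in> carrier (V\<lparr>carrier := W\<rparr>)" "cinner (V\<lparr>carrier := W\<rparr>) x x = 0" for x
      using cinner_definite[of x] that WV by simp
    fix X assume X: "hcauchy (V\<lparr>carrier := W\<rparr>) X"
    then have XW: "X n \<in> W" for n using S.hcauchyD[of X n] by simp
    have "hcauchy V X" using X XW WV by (simp add: hcauchy_def norm minus)
    then obtain x where "x \<in> W" "hconverges V X x" using closed_subspace_complete[OF W, of X] XW by auto
    then show "\<exists>x\<in>carrier (V\<lparr>carrier := W\<rparr>). hconverges (V\<lparr>carrier := W\<rparr>) X x"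
      using XW by (auto simp: hconverges_def norm minus)
  qed
qed

text \<open>Since \<open>C\<close> is the adjoint of \<open>A1\<close> composed with
  \<open>A2\<close>, the form on pairs is the pullback of the inner product of \<open>U\<close>
  along the sum map \<open>f\<close>. Positivity is inherited from \<open>U\<close>, and
  \<open>f\<close> extends isometrically to the completion. As \<open>R\<close> is closed and equals
  the range of \<open>f\<close>, the extension is onto \<open>R\<close>.\<close>

lemma identified_amalgamated_sumI:
  assumes U: "hilbert_space U" and V: "hilbert_space V" and W: "hilbert_space W"
    and A1: "isometric_op V U A1" and A2: "isometric_op W U A2"
    and C: "\<And>y. y \<in> carrier W \<Longrightarrow> adjoint_op V U A1 (A2 y) = C y"
    and H1: "closed_subspace V H1" and H2: "closed_subspace W H2" and R: "closed_subspace U R"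
    and R_eq: "R = {A1 x \<oplus>\<^bsub>U\<^esub> A2 y |x y. x \<in> H1 \<and> y \<in> H2}"
  shows "identified_amalgamated_sum U R A1 A2 V W C H1 H2"
proof -
  interpret VU: two_hilbert V U using V U by (simp add: two_hilbert_def)
  interpret WU: two_hilbert W U using W U by (simp add: two_hilbert_def)
  have L1: "linear_op V U A1" and L2: "linear_op W U A2" using A1 A2 by (auto simp: isometric_op_def)
  note l1 = linear_opD[OF L1] and l2 = linear_opD[OF L2]
  note h1 = VU.V.closed_subspaceD[OF H1] and h2 = WU.V.closed_subspaceD[OF H2]
  have m1: "x \<in> carrier V" if "x \<in> H1" for x using h1(1) that by auto
  have m2: "x \<in> carrier W" if "x \<in> H2" for x using h2(1) that by auto
  have Cm: "C y \<in> carrier V" if "y \<in> carrier W" for y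
    using VU.isometric_adjoint_mem[OF A1 l2(1)[OF that]] C[OF that] by simp
  have c12: "cinner U (A1 x) (A2 y) = cinner V x (C y)" if "x \<in> carrier V" "y \<in> carrier W" for x y
    using VU.cinner_isometric_adjoint[OF A1 l2(1)[OF that(2)] that(1)] C[OF that(2)] by simp
  have c21: "cinner U (A2 y) (A1 x) = cinner V (C y) x" if "x \<in> carrier V" "y \<in> carrier W" for x y
    using VU.W.cinner_commute[OF l1(1)[OF that(1)] l2(1)[OF that(2)]]
      VU.V.cinner_commute[OF that(1) Cm[OF that(2)]] c12[OF that] by simp
  let ?P = "pre_amalgamated_sum V W C H1 H2"
  define f where "f p = A1 (fst p) \<oplus>\<^bsub>U\<^esub> A2 (snd p)" for p
  have fU: "f p \<in> carrier U" if "p \<in> H1 \<times> H2" for p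
    using that m1 m2 l1(1) l2(1) by (auto simp: f_def)
  have carP: "carrier ?P = H1 \<times> H2" by (simp add: pre_amalgamated_sum_def)
  have addP: "p \<oplus>\<^bsub>?P\<^esub> q = (fst p \<oplus>\<^bsub>V\<^esub> fst q, snd p \<oplus>\<^bsub>W\<^esub> snd q)" for p q
    by (simp add: pre_amalgamated_sum_def case_prod_unfold)
  have smultP: "c \<odot>\<^bsub>?P\<^esub> p = (c \<odot>\<^bsub>V\<^esub> fst p, c \<odot>\<^bsub>W\<^esub> snd p)" for c p
    by (simp add: pre_amalgamated_sum_def case_prod_unfold)
  have zeroP: "\<zero>\<^bsub>?P\<^esub> = (\<zero>\<^bsub>V\<^esub>, \<zero>\<^bsub>W\<^esub>)" by (simp add: pre_amalgamated_sum_def)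
  have cinP: "cinner ?P p q = cinner U (f p) (f q)" if "p \<in> H1 \<times> H2" "q \<in> H1 \<times> H2" for p q
  proof -
    have m: "fst p \<in> carrier V" "snd p \<in> carrier W" "fst q \<in> carrier V" "snd q \<in> carrier W"
      using that m1 m2 by auto
    show ?thesis
      using m l1(1) l2(1)
      by (simp add: pre_amalgamated_sum_def case_prod_unfold f_def VU.W.cinner_add_left VU.W.cinner_add_right
          c12 c21 VU.isometric_cinner[OF A1] WU.isometric_cinner[OF A2])
  qed
  have f_add: "f (p \<oplus>\<^bsub>?P\<^esub> q) = f p \<oplus>\<^bsub>U\<^esub> f q" if "p \<in> H1 \<times> H2" "q \<in> H1 \<times> H2" for p q
  proof -
    have m: "fst p \<in> carrier V" "snd p \<in> carrier W" "fst q \<in> carrier V" "snd q \<in> carrier W"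
      using that m1 m2 by auto
    then show ?thesis using l1(1) l2(1) by (simp add: f_def addP l1(2) l2(2) VU.W.M.a_ac)
  qed
  have f_smult: "f (c \<odot>\<^bsub>?P\<^esub> p) = c \<odot>\<^bsub>U\<^esub> f p" if "p \<in> H1 \<times> H2" for c p
  proof -
    have m: "fst p \<in> carrier V" "snd p \<in> carrier W" using that m1 m2 by auto
    then show ?thesis using l1(1) l2(1) by (simp add: f_def smultP l1(3) l2(3) VU.W.smult_r_distr)
  qed
  have P_add: "p \<oplus>\<^bsub>?P\<^esub> q \<in> H1 \<times> H2" if "p \<in> H1 \<times> H2" "q \<in> H1 \<times> H2" for p q
    using that h1(3) h2(3) by (auto simp: addP)
  have P_smult: "c \<odot>\<^bsub>?P\<^esub> p \<in> H1 \<times> H2" if "p \<in> H1 \<times> H2" for c p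
    using that h1(4) h2(4) by (auto simp: smultP)
  interpret P: semi_inner_space ?P
  proof (rule semi_inner_spaceI)
    show "abelian_group ?P"
    proof (rule abelian_groupI)
      fix p q r assume "p \<in> carrier ?P" "q \<in> carrier ?P" "r \<in> carrier ?P"
      then show "p \<oplus>\<^bsub>?P\<^esub> q \<oplus>\<^bsub>?P\<^esub> r = p \<oplus>\<^bsub>?P\<^esub> (q \<oplus>\<^bsub>?P\<^esub> r)"
        using m1 m2 by (auto simp: carP addP VU.V.M.a_assoc WU.V.M.a_assoc)
    next
      fix p q assume pq: "p \<in> carrier ?P" "q \<in> carrier ?P"
      then show "p \<oplus>\<^bsub>?P\<^esub> q \<in> carrier ?P" using P_add by (simp add: carP)
      show "p \<oplus>\<^bsub>?P\<^esub> q = q \<oplus>\<^bsub>?P\<^esub> p"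
        using pq m1 m2 VU.V.M.a_comm[of "fst p" "fst q"] WU.V.M.a_comm[of "snd p" "snd q"]
        by (auto simp: carP addP)
    next
      show "\<zero>\<^bsub>?P\<^esub> \<in> carrier ?P" using h1(2) h2(2) by (simp add: carP zeroP)
      fix p assume p: "p \<in> carrier ?P"
      then show "\<zero>\<^bsub>?P\<^esub> \<oplus>\<^bsub>?P\<^esub> p = p" using m1 m2 by (auto simp: carP zeroP addP)
      have "fst p \<in> carrier V" "snd p \<in> carrier W" using p m1 m2 by (auto simp: carP)
      then have "(-1) \<odot>\<^bsub>?P\<^esub> p \<oplus>\<^bsub>?P\<^esub> p = \<zero>\<^bsub>?P\<^esub>"
        using VU.V.smult_l_distr[of "-1" 1 "fst p"] WU.V.smult_l_distr[of "-1" 1 "snd p"]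
        by (simp add: addP smultP zeroP)
      moreover have "(-1) \<odot>\<^bsub>?P\<^esub> p \<in> carrier ?P" using P_smult p by (simp add: carP)
      ultimately show "\<exists>q\<in>carrier ?P. q \<oplus>\<^bsub>?P\<^esub> p = \<zero>\<^bsub>?P\<^esub>" by blast
    qed
  next
    fix p and a b :: complex assume p: "p \<in> carrier ?P"
    then have m: "fst p \<in> carrier V" "snd p \<in> carrier W" using m1 m2 by (auto simp: carP)
    show "a \<odot>\<^bsub>?P\<^esub> p \<in> carrier ?P" using P_smult p by (simp add: carP)
    show "(a + b) \<odot>\<^bsub>?P\<^esub> p = a \<odot>\<^bsub>?P\<^esub> p \<oplus>\<^bsub>?P\<^esub> b \<odot>\<^bsub>?P\<^esub> p"
      using m VU.V.smult_l_distr[of a b "fst p"] WU.V.smult_l_distr[of a b "snd p"] by (simp add: addP smultP)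
    show "(a * b) \<odot>\<^bsub>?P\<^esub> p = a \<odot>\<^bsub>?P\<^esub> (b \<odot>\<^bsub>?P\<^esub> p)"
      using m by (simp add: smultP VU.V.smult_smult WU.V.smult_smult)
    show "1 \<odot>\<^bsub>?P\<^esub> p = p" using m by (simp add: smultP)
    show "0 \<le> Re (cinner ?P p p)" using p fU by (simp add: cinP carP VU.W.cinner_nonneg)
  next
    fix p q r and c :: complex assume pqr: "p \<in> carrier ?P" "q \<in> carrier ?P" "r \<in> carrier ?P"
    then show "cinner ?P p (q \<oplus>\<^bsub>?P\<^esub> r) = cinner ?P p q + cinner ?P p r"
      using P_add fU by (simp add: carP cinP f_add VU.W.cinner_add_right)
  next
    fix p q and c :: complex assume pq: "p \<in> carrier ?P" "q \<in> carrier ?P"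
    then have m: "fst p \<in> carrier V" "snd p \<in> carrier W" "fst q \<in> carrier V" "snd q \<in> carrier W"
      using m1 m2 by (auto simp: carP)
    show "c \<odot>\<^bsub>?P\<^esub> (p \<oplus>\<^bsub>?P\<^esub> q) = c \<odot>\<^bsub>?P\<^esub> p \<oplus>\<^bsub>?P\<^esub> c \<odot>\<^bsub>?P\<^esub> q"
      using m by (simp add: addP smultP VU.V.smult_r_distr WU.V.smult_r_distr)
    show "cinner ?P p (c \<odot>\<^bsub>?P\<^esub> q) = c * cinner ?P p q"
      using pq P_smult fU by (simp add: carP cinP f_smult VU.W.cinner_smult_right)
    show "cinner ?P q p = cnj (cinner ?P p q)"
      using pq VU.W.cinner_commute[OF fU fU, of p q] by (simp add: carP cinP)
  qed
  let ?U = "U\<lparr>carrier := R\<rparr>"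
  interpret T: two_hilbert "hcompletion ?P" ?U
    using P.hilbert_space_hcompletion VU.W.closed_subspace_hilbert_space[OF R] by (simp add: two_hilbert_def)
  have fR: "f ` (H1 \<times> H2) = R" by (force simp: R_eq f_def)
  obtain \<Phi> where \<Phi>: "isometric_op (hcompletion ?P) ?U \<Phi>"
    "\<And>p. p \<in> H1 \<times> H2 \<Longrightarrow> \<Phi> (completion_class ?P p) = f p"
  proof (rule T.isometric_extension[where I = "H1 \<times> H2" and g = "completion_class ?P" and h = f])
    fix p assume p: "p \<in> H1 \<times> H2"
    then show "completion_class ?P p \<in> carrier (hcompletion ?P)" by (intro P.completion_class_mem) (simp add: carP)
    show "f p \<in> carrier ?U" using p fR by auto
    fix q assume q: "q \<in> H1 \<times> H2"
    show "cinner ?U (f p) (f q) = cinner (hcompletion ?P) (completion_class ?P p) (completion_class ?P q)"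
      using p q cinP P.cinner_completion_class[of p q] by (simp add: carP)
  next
    show "closed_span (hcompletion ?P) (completion_class ?P ` (H1 \<times> H2)) = carrier (hcompletion ?P)"
      using P.closed_span_completion_class by (simp add: carP)
  qed (rule that)
  have "R \<subseteq> \<Phi> ` carrier (hcompletion ?P)"
  proof
    fix z assume "z \<in> R"
    then obtain p where p: "p \<in> H1 \<times> H2" "z = f p" using fR by blast
    then have "completion_class ?P p \<in> carrier (hcompletion ?P)" by (intro P.completion_class_mem) (simp add: carP)
    then show "z \<in> \<Phi> ` carrier (hcompletion ?P)" using \<Phi>(2)[OF p(1)] p(2) by force
  qed
  then have "unitary_op (hcompletion ?P) ?U \<Phi>"
    using T.unitary_opI[OF \<Phi>(1), of R] T.W.closed_span_carrier_eq by simp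
  then show ?thesis
    unfolding identified_amalgamated_sum_def amalgamated_sum_def
    using \<Phi>(2) by (intro exI[of _ \<Phi>]) (auto simp: f_def)
qed

section \<open>The product subsystem generated by a family of sets\<close>

context prodsys
begin

text \<open>Time is an index of the induction and not a parameter because \<open>mult\<close> links
  different fibres; closure under limits is built in so that limits may again be multiplied.\<close>

inductive generated :: "(real \<Rightarrow> 'a set) \<Rightarrow> real \<Rightarrow> 'a \<Rightarrow> bool" for S where
  gen: "t > 0 \<Longrightarrow> x \<in> S t \<Longrightarrow> generated S t x"
| zero: "t > 0 \<Longrightarrow> generated S t \<zero>\<^bsub>fib E t\<^esub>"
| add: "generated S t x \<Longrightarrow> generated S t y \<Longrightarrow> generated S t (x \<oplus>\<^bsub>fib E t\<^esub> y)"
| smult: "generated S t x \<Longrightarrow> generated S t (c \<odot>\<^bsub>fib E t\<^esub> x)"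
| lim: "(\<And>n. generated S t (X n)) \<Longrightarrow> x \<in> carrier (fib E t) \<Longrightarrow> hconverges (fib E t) X x \<Longrightarrow> generated S t x"
| mult: "generated S s x \<Longrightarrow> generated S t y \<Longrightarrow> generated S (s + t) (pmul E s t x y)"

context
  fixes S
  assumes S: "\<And>t. t > 0 \<Longrightarrow> S t \<subseteq> carrier (fib E t)"
begin

lemma generated_mem: "generated S t x \<Longrightarrow> t > 0 \<and> x \<in> carrier (fib E t)"
proof (induction rule: generated.induct)
  case (zero t)
  interpret hilbert_space "fib E t" by (rule hilbert_fib[OF zero])
  show ?case using zero by simp
next
  case (add t x y)
  interpret hilbert_space "fib E t" by (rule hilbert_fib) (use add in simp)
  show ?case using add by simp
next
  case (smult t x c)
  interpret hilbert_space "fib E t" by (rule hilbert_fib) (use smult in simp)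
  show ?case using smult by simp
qed (use S in \<open>auto intro: pmul_mem\<close>)

lemma closed_subspace_generated:
  assumes t: "t > 0"
  shows "closed_subspace (fib E t) {x. generated S t x}"
proof -
  interpret hilbert_space "fib E t" by (rule hilbert_fib[OF t])
  show ?thesis
  proof (rule closed_subspaceI)
    show "{x. generated S t x} \<subseteq> carrier (fib E t)" using generated_mem by blast
    fix X x assume "\<And>n. X n \<in> {x. generated S t x}" "x \<in> carrier (fib E t)" "hconverges (fib E t) X x"
    then have "generated S t x" by (intro generated.lim[of S t X x]) auto
    then show "x \<in> {x. generated S t x}" by simp
  qed (simp_all add: t generated.zero generated.add generated.smult)
qed

context
  assumes split: "\<And>s t. s > 0 \<Longrightarrow> t > 0 \<Longrightarrow>
    S (s + t) \<subseteq> closed_span (fib E (s + t)) {pmul E s t x y |x y. x \<in> S s \<and> y \<in> S t}"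
begin

abbreviation prod_span :: "real \<Rightarrow> real \<Rightarrow> 'a set" where
  "prod_span s t \<equiv> closed_span (fib E (s + t)) {pmul E s t x y |x y. generated S s x \<and> generated S t y}"

lemma prod_span_subset: "{pmul E s t x y |x y. generated S s x \<and> generated S t y} \<subseteq> carrier (fib E (s + t))"
  using generated_mem by (auto intro: pmul_mem)

lemma closed_subspace_prod_span:
  assumes "s > 0" "t > 0"
  shows "closed_subspace (fib E (s + t)) (prod_span s t)"
proof -
  have st': "s + t > 0" using assms by simp
  interpret hilbert_space "fib E (s + t)" by (rule hilbert_fib[OF st'])
  show ?thesis by (rule closed_subspace_closed_span[OF prod_span_subset])
qed

lemma pmul_in_prod_span:
  assumes "generated S s x" "generated S t y"
  shows "pmul E s t x y \<in> prod_span s t"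
  using assms unfolding closed_span_def by blast

text \<open>Serves a cut inside the right factor of a product: if that factor is
  \<open>pmul E s t v w\<close>, associativity regroups \<open>x\<close> with \<open>v\<close>. The
  passage to the closed span uses that left multiplication by \<open>x\<close> is bounded.\<close>

lemma pmul_generated_prod_span_right:
  assumes x: "generated S p x" and y: "y \<in> prod_span s t" and st: "s > 0" "t > 0"
  shows "pmul E p (s + t) x y \<in> prod_span (p + s) t"
proof -
  note p = generated_mem[OF x]
  have pos: "p + s > 0" "s + t > 0" "p + (s + t) > 0" using p st by auto
  interpret two_hilbert "fib E (s + t)" "fib E (p + (s + t))"
    using pos by (intro two_hilbert_fib)
  have K: "closed_subspace (fib E (p + (s + t))) (prod_span (p + s) t)"
    using closed_subspace_prod_span[OF pos(1) st(2)] by (simp add: add.assoc)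
  have "prod_span s t \<subseteq> {y \<in> carrier (fib E (s + t)). pmul E p (s + t) x y \<in> prod_span (p + s) t}"
  proof (rule V.closed_span_minimal)
    show "closed_subspace (fib E (s + t)) {y \<in> carrier (fib E (s + t)). pmul E p (s + t) x y \<in> prod_span (p + s) t}"
      by (rule closed_subspace_vimage[OF bounded_op_pmul_right K]) (use p pos in auto)
    show "{pmul E s t x y |x y. generated S s x \<and> generated S t y}
        \<subseteq> {y \<in> carrier (fib E (s + t)). pmul E p (s + t) x y \<in> prod_span (p + s) t}"
    proof clarify
      fix v w assume v: "generated S s v" and w: "generated S t w"
      have "pmul E p (s + t) x (pmul E s t v w) = pmul E (p + s) t (pmul E p s x v) w"
        using pmul_assoc[of p s t x v w] p st generated_mem[OF v] generated_mem[OF w] by simp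
      then show "pmul E s t v w \<in> carrier (fib E (s + t)) \<and> pmul E p (s + t) x (pmul E s t v w) \<in> prod_span (p + s) t"
        using pmul_in_prod_span[OF generated.mult[OF x v] w] generated_mem[OF v] generated_mem[OF w] st
        by (simp add: pmul_mem)
    qed
  qed
  then show ?thesis using y by blast
qed

lemma pmul_generated_prod_span_left:
  assumes y: "generated S q y" and x: "x \<in> prod_span s t" and st: "s > 0" "t > 0"
  shows "pmul E (s + t) q x y \<in> prod_span s (t + q)"
proof -
  note q = generated_mem[OF y]
  have pos: "t + q > 0" "s + t > 0" "s + t + q > 0" using q st by auto
  interpret two_hilbert "fib E (s + t)" "fib E (s + t + q)"
    using pos by (intro two_hilbert_fib)
  have K: "closed_subspace (fib E (s + t + q)) (prod_span s (t + q))"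
    using closed_subspace_prod_span[OF st(1) pos(1)] by (simp add: add.assoc)
  have "prod_span s t \<subseteq> {x \<in> carrier (fib E (s + t)). pmul E (s + t) q x y \<in> prod_span s (t + q)}"
  proof (rule V.closed_span_minimal)
    show "closed_subspace (fib E (s + t)) {x \<in> carrier (fib E (s + t)). pmul E (s + t) q x y \<in> prod_span s (t + q)}"
      by (rule closed_subspace_vimage[OF bounded_op_pmul_left K]) (use q pos in auto)
    show "{pmul E s t x y |x y. generated S s x \<and> generated S t y}
        \<subseteq> {x \<in> carrier (fib E (s + t)). pmul E (s + t) q x y \<in> prod_span s (t + q)}"
    proof clarify
      fix v w assume v: "generated S s v" and w: "generated S t w"
      have "pmul E (s + t) q (pmul E s t v w) y = pmul E s (t + q) v (pmul E t q w y)"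
        using pmul_assoc[of s t q v w y] q st generated_mem[OF v] generated_mem[OF w] by simp
      then show "pmul E s t v w \<in> carrier (fib E (s + t)) \<and> pmul E (s + t) q (pmul E s t v w) y \<in> prod_span s (t + q)"
        using pmul_in_prod_span[OF v generated.mult[OF w y]] generated_mem[OF v] generated_mem[OF w] st
        by (simp add: pmul_mem)
    qed
  qed
  then show ?thesis using x by blast
qed

text \<open>The substantial half of the subsystem condition: an element of time \<open>r\<close>
  must factor at every cut of \<open>r\<close>, not only where it was assembled. Generators factor
  by \<open>split\<close>. A product of times \<open>p\<close> and \<open>q\<close> is cut at
  \<open>p\<close>, inside its right factor, or inside its left one; in the last two cases that
  factor is cut by induction and the result regrouped.\<close>

lemma generated_in_prod_span:
  "generated S r x \<Longrightarrow> s > 0 \<Longrightarrow> t > 0 \<Longrightarrow> r = s + t \<Longrightarrow> x \<in> prod_span s t"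
proof (induction arbitrary: s t rule: generated.induct)
  case (gen r x)
  have st': "s + t > 0" using gen by simp
  interpret hilbert_space "fib E (s + t)" by (rule hilbert_fib[OF st'])
  have "closed_span (fib E (s + t)) {pmul E s t x y |x y. x \<in> S s \<and> y \<in> S t} \<subseteq> prod_span s t"
    by (rule closed_span_minimal[OF closed_subspace_prod_span])
      (use gen in \<open>auto intro!: pmul_in_prod_span generated.gen\<close>)
  then show ?case using split[of s t] gen by blast
next
  case (zero r)
  have st': "s + t > 0" using zero by simp
  interpret hilbert_space "fib E (s + t)" by (rule hilbert_fib[OF st'])
  show ?case using closed_subspaceD(2)[OF closed_subspace_prod_span[of s t]] zero by simp
next
  case (add r x y)
  have st': "s + t > 0" using add by simp
  interpret hilbert_space "fib E (s + t)" by (rule hilbert_fib[OF st'])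
  show ?case using closed_subspaceD(3)[OF closed_subspace_prod_span[of s t], of x y] add by simp
next
  case (smult r x c)
  have st': "s + t > 0" using smult by simp
  interpret hilbert_space "fib E (s + t)" by (rule hilbert_fib[OF st'])
  show ?case using closed_subspaceD(4)[OF closed_subspace_prod_span[of s t], of x c] smult by simp
next
  case (lim r X x)
  have st': "s + t > 0" using lim by simp
  interpret hilbert_space "fib E (s + t)" by (rule hilbert_fib[OF st'])
  show ?case
    by (rule closed_subspaceD(6)[OF closed_subspace_prod_span[of s t], of X x])
      (use lim in auto)
next
  case (mult p x q y)
  consider "p = s" | "p < s" | "p > s" by linarith
  then show ?case
  proof cases
    case 1
    then show ?thesis using mult pmul_in_prod_span by simp
  next
    case 2
    \<comment> \<open>The cut at \<open>s\<close> falls at time \<open>s - p\<close> of the right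
      factor.\<close>
    have q: "q = (s - p) + t" using mult.prems by simp
    have "y \<in> prod_span (s - p) t" using mult.IH(2)[of "s - p" t] 2 mult.prems q by simp
    then show ?thesis
      using pmul_generated_prod_span_right[OF mult.hyps(1), of y "s - p" t] 2 mult.prems q by simp
  next
    case 3
    \<comment> \<open>The cut falls inside the left factor and leaves a remainder of time
      \<open>p - s\<close>, which joins the right factor.\<close>
    have t: "t = (p - s) + q" using mult.prems by simp
    have q: "q > 0" using generated_mem[OF mult.hyps(2)] by simp
    have "x \<in> prod_span s (p - s)" using mult.IH(1)[of s "p - s"] 3 mult.prems by simp
    then show ?thesis
      using pmul_generated_prod_span_left[OF mult.hyps(2), of x s "p - s"] 3 mult.prems(1) t by simp
  qed
qed

lemma product_subsystem_generated: "product_subsystem E (\<lambda>t. {x. generated S t x})"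
  unfolding product_subsystem_def
proof (intro conjI allI impI closed_subspace_generated)
  fix s t :: real assume st: "s > 0" "t > 0"
  have st': "s + t > 0" using st by simp
  interpret hilbert_space "fib E (s + t)" by (rule hilbert_fib[OF st'])
  have "prod_span s t \<subseteq> {x. generated S (s + t) x}"
    by (rule closed_span_minimal[OF closed_subspace_generated[OF st']]) (auto intro: generated.mult)
  moreover have "{x. generated S (s + t) x} \<subseteq> prod_span s t"
    using generated_in_prod_span st by blast
  ultimately have "{x. generated S (s + t) x} = prod_span s t" by blast
  then show "cosplit E s t ` {x. generated S (s + t) x} =
      tensor_subspace (fib E s) (fib E t) {x. generated S s x} {x. generated S t x}"
    using cosplit_closed_span_pmul[OF st, of "{x. generated S s x}" "{x. generated S t x}"] generated_mem by auto
qed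

end

end

end

text \<open>Supplies the splitting hypothesis for generated subsystems: fibres of \<open>D\<close>
  are spanned by products, \<open>J\<close> maps products to products, and preimages of closed
  subspaces are closed.\<close>

lemma (in arveson_isometry) range_J_split:
  assumes st: "s > 0" "t > 0"
  shows "J (s + t) ` carrier (fib D (s + t)) \<subseteq> closed_span (fib E (s + t))
    {pmul E s t x y |x y. x \<in> J s ` carrier (fib D s) \<and> y \<in> J t ` carrier (fib D t)}" (is "_ \<subseteq> closed_span _ ?S")
proof -
  have st': "s + t > 0" using st by simp
  interpret two_hilbert "fib D (s + t)" "fib E (s + t)" by (rule two_hilbert_J[OF st'])
  have S: "?S \<subseteq> carrier (fib E (s + t))" using st by (auto intro!: E.pmul_mem)
  have "closed_span (fib D (s + t)) {pmul D s t x y |x y. x \<in> carrier (fib D s) \<and> y \<in> carrier (fib D t)}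
      \<subseteq> {x \<in> carrier (fib D (s + t)). J (s + t) x \<in> closed_span (fib E (s + t)) ?S}"
  proof (rule V.closed_span_minimal[OF closed_subspace_vimage[OF isometric_bounded[OF isometric_J[OF st']]]])
    show "closed_subspace (fib E (s + t)) (closed_span (fib E (s + t)) ?S)"
      by (rule W.closed_subspace_closed_span[OF S])
    show "{pmul D s t x y |x y. x \<in> carrier (fib D s) \<and> y \<in> carrier (fib D t)}
      \<subseteq> {x \<in> carrier (fib D (s + t)). J (s + t) x \<in> closed_span (fib E (s + t)) ?S}"
    proof clarify
      fix x y assume xy: "x \<in> carrier (fib D s)" "y \<in> carrier (fib D t)"
      have "pmul E s t (J s x) (J t y) \<in> closed_span (fib E (s + t)) ?S"
        by (rule subsetD[OF W.closed_span_subset]) (use xy in blast)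
      then show "pmul D s t x y \<in> carrier (fib D (s + t)) \<and> J (s + t) (pmul D s t x y) \<in> closed_span (fib E (s + t)) ?S"
        using xy st by (simp add: pmul_J D.pmul_mem)
    qed
  qed
  then show ?thesis using D.closed_span_pmul[OF st] by auto
qed

lemma (in arveson_unit) root_orthogonal_generated:
  assumes S: "\<And>t. t > 0 \<Longrightarrow> S t \<subseteq> carrier (fib E t)" and b: "is_root E u b"
    and orth: "\<And>t x. t > 0 \<Longrightarrow> x \<in> S t \<Longrightarrow> cinner (fib E t) x (b t) = 0"
  shows "generated S t x \<Longrightarrow> cinner (fib E t) x (b t) = 0"
proof (induction rule: generated.induct)
  case (gen t x)
  then show ?case using orth by simp
next
  case (zero t)
  interpret hilbert_space "fib E t" by (rule hilbert_fib[OF zero])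
  show ?case using is_rootD(2)[OF b zero] by simp
next
  case (add t x y)
  note m = generated_mem[OF S add.hyps(1)] generated_mem[OF S add.hyps(2)]
  interpret hilbert_space "fib E t" by (rule hilbert_fib) (use m in simp)
  show ?case using is_rootD(2)[OF b] m add by (simp add: cinner_simps)
next
  case (smult t x c)
  note m = generated_mem[OF S smult.hyps(1)]
  interpret hilbert_space "fib E t" by (rule hilbert_fib) (use m in simp)
  show ?case using is_rootD(2)[OF b] m smult by (simp add: cinner_simps)
next
  case (lim t X x)
  have Xm: "t > 0" "X n \<in> carrier (fib E t)" for n using generated_mem[OF S lim.hyps(1)] by auto
  interpret hilbert_space "fib E t" by (rule hilbert_fib[OF Xm(1)])
  have "(\<lambda>n. cinner (fib E t) (X n) (b t)) \<longlonglongrightarrow> cinner (fib E t) x (b t)"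
    by (rule cinner_tendsto) (use Xm lim.hyps is_rootD(2)[OF b Xm(1)] in auto)
  then show ?case using lim.IH by (simp add: LIMSEQ_const_iff)
next
  \<comment> \<open>The inner product with \<open>b (s + t)\<close> is a sum of two terms, one with
    the factor \<open>cinner (fib E s) x (b s)\<close> and one with
    \<open>cinner (fib E t) y (b t)\<close>; both factors vanish by induction.\<close>
  case (mult s x t y)
  note m = generated_mem[OF S mult.hyps(1)] generated_mem[OF S mult.hyps(2)]
  then have st: "s > 0" "t > 0" and st': "s + t > 0" by auto
  interpret hilbert_space "fib E (s + t)" by (rule hilbert_fib[OF st'])
  show ?case
    using m mult.IH u_mem[OF st(1)] u_mem[OF st(2)] is_rootD(2)[OF b st(1)] is_rootD(2)[OF b st(2)] st
    by (simp add: is_rootD(3)[OF b st] cinner_simps pmul_mem cinner_pmul)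
qed

section \<open>Roots of an amalgamated product\<close>

locale amalgam =
  J1: arveson_isometry E1 E J1 + J2: arveson_isometry E2 E J2
  for E1 :: "'a arveson" and E2 :: "'b arveson" and E :: "'c arveson" and J1 J2 +
  fixes C :: "real \<Rightarrow> 'b \<Rightarrow> 'a"
  assumes adj_J1_J2: "t > 0 \<Longrightarrow> y \<in> carrier (fib E2 t) \<Longrightarrow> J1.adj t (J2 t y) = C t y"
    and partial_isometry: "partially_isometric_family E2 E1 C"
    and join: "is_join E (\<lambda>t. J1 t ` carrier (fib E1 t)) (\<lambda>t. J2 t ` carrier (fib E2 t))
       (\<lambda>t. carrier (fib E t))"
begin

lemma C_mem [simp]: "t > 0 \<Longrightarrow> y \<in> carrier (fib E2 t) \<Longrightarrow> C t y \<in> carrier (fib E1 t)"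
  using J1.adj_mem[of t "J2 t y"] adj_J1_J2[of t y] by simp

text \<open>All mixed inner products of \<open>J1 t (C t y)\<close> and \<open>J2 t y\<close> equal
  the squared norm of \<open>C t y\<close>, so their squared distance is that of \<open>y\<close>
  minus that of \<open>C t y\<close>.\<close>

lemma J1_C_eq_J2:
  assumes t: "t > 0" and y: "y \<in> carrier (fib E2 t)" and norm: "hnorm (fib E1 t) (C t y) = hnorm (fib E2 t) y"
  shows "J1 t (C t y) = J2 t y"
proof -
  interpret E: hilbert_space "fib E t" by (rule J1.E.hilbert_fib[OF t])
  interpret E1: hilbert_space "fib E1 t" by (rule J1.D.hilbert_fib[OF t])
  interpret E2: hilbert_space "fib E2 t" by (rule J2.D.hilbert_fib[OF t])
  let ?x = "J1 t (C t y)" and ?z = "J2 t y"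
  have m: "?x \<in> carrier (fib E t)" "?z \<in> carrier (fib E t)" using t y by auto
  have n: "cinner (fib E1 t) (C t y) (C t y) = cinner (fib E2 t) y y"
    using t y norm by (simp add: E1.cinner_self E2.cinner_self)
  have xz: "cinner (fib E t) ?x ?z = cinner (fib E1 t) (C t y) (C t y)"
    using J1.cinner_adj_right[OF t m(2), of "C t y"] adj_J1_J2[OF t y] t y by simp
  have zx: "cinner (fib E t) ?z ?x = cinner (fib E1 t) (C t y) (C t y)"
    using J1.cinner_adj_left[OF t m(2), of "C t y"] adj_J1_J2[OF t y] t y by simp
  have "cinner (fib E t) (?x \<ominus>\<^bsub>fib E t\<^esub> ?z) (?x \<ominus>\<^bsub>fib E t\<^esub> ?z) = 0"
    using m xz zx n J1.cinner_J[OF t, of "C t y" "C t y"] J2.cinner_J[OF t y y] t y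
    by (simp add: E.cinner_simps)
  then show ?thesis using E.cinner_definite[of "?x \<ominus>\<^bsub>fib E t\<^esub> ?z"] m by simp
qed

text \<open>
  Partial isometry of \<open>C\<close> says that the projections onto the ranges of \<open>J1\<close> and \<open>J2\<close> commute;
  this is the half of it that is needed.
\<close>

lemma J1_C_in_range_J2:
  assumes t: "t > 0" and y: "y \<in> carrier (fib E2 t)"
  shows "J1 t (C t y) \<in> J2 t ` carrier (fib E2 t)"
proof -
  interpret two_hilbert "fib E2 t" "fib E1 t"
    by (simp add: two_hilbert_def J1.D.hilbert_fib[OF t] J2.D.hilbert_fib[OF t])
  have C: "bounded_op (fib E2 t) (fib E1 t) (C t)"
    and iso: "\<And>x. \<lbrakk>x \<in> carrier (fib E2 t); \<And>z. z \<in> carrier (fib E2 t) \<Longrightarrow> C t z = \<zero>\<^bsub>fib E1 t\<^esub> \<Longrightarrow> cinner (fib E2 t) z x = 0\<rbrakk>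
      \<Longrightarrow> hnorm (fib E1 t) (C t x) = hnorm (fib E2 t) x"
    using partial_isometry t by (auto simp: partially_isometric_family_def partially_isometric_op_def)
  have L: "linear_op (fib E2 t) (fib E1 t) (C t)" using C by (simp add: bounded_op_def)
  \<comment> \<open>The kernel of \<open>C t\<close> is then closed as a preimage, so
    \<open>y\<close> can be projected onto it.\<close>
  have "closed_subspace (fib E1 t) {\<zero>\<^bsub>fib E1 t\<^esub>}"
  proof (rule W.closed_subspaceI)
    fix X x assume X: "\<And>n. X n \<in> {\<zero>\<^bsub>fib E1 t\<^esub>}" "x \<in> carrier (fib E1 t)" "hconverges (fib E1 t) X x"
    then have "X = (\<lambda>_. \<zero>\<^bsub>fib E1 t\<^esub>)" by auto
    then show "x \<in> {\<zero>\<^bsub>fib E1 t\<^esub>}" using X W.hconverges_unique[of X x "\<zero>\<^bsub>fib E1 t\<^esub>"] by simp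
  qed auto
  from closed_subspace_vimage[OF C this]
  have K: "closed_subspace (fib E2 t) {x \<in> carrier (fib E2 t). C t x \<in> {\<zero>\<^bsub>fib E1 t\<^esub>}}" .
  obtain p where p: "p \<in> {x \<in> carrier (fib E2 t). C t x \<in> {\<zero>\<^bsub>fib E1 t\<^esub>}}"
    "\<And>w. w \<in> {x \<in> carrier (fib E2 t). C t x \<in> {\<zero>\<^bsub>fib E1 t\<^esub>}} \<Longrightarrow> cinner (fib E2 t) w (y \<ominus>\<^bsub>fib E2 t\<^esub> p) = 0"
    by (rule V.orthogonal_projection[OF K y]) (rule that)
  \<comment> \<open>Removing the kernel component does not change the image under
    \<open>C t\<close>, and on the complement of the kernel \<open>C t\<close> preserves norms; so
    \<open>J1 t (C t y)\<close> equals \<open>J2 t ?z\<close>.\<close>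
  let ?z = "y \<ominus>\<^bsub>fib E2 t\<^esub> p"
  have z: "?z \<in> carrier (fib E2 t)" using p y by simp
  have "C t ?z = C t y"
  proof -
    have "C t ?z = C t y \<ominus>\<^bsub>fib E1 t\<^esub> \<zero>\<^bsub>fib E1 t\<^esub>" using linear_op_minus[OF L y, of p] p by simp
    also have "\<dots> = C t y"
      by (rule W.hspace_eqI) (use t y in \<open>simp_all add: W.cinner_minus_right\<close>)
    finally show ?thesis .
  qed
  moreover have "hnorm (fib E1 t) (C t ?z) = hnorm (fib E2 t) ?z"
    by (rule iso[OF z]) (use p in simp)
  ultimately have "J1 t (C t y) = J2 t ?z" using J1_C_eq_J2[OF t z] by simp
  then show ?thesis using z by simp
qed

text \<open>As \<open>C t\<close> is the adjoint of \<open>J1 t\<close> after \<open>J2 t\<close>,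
  its own adjoint acts here as that of \<open>J2 t\<close> after \<open>J1 t\<close>. This
  identifies the description in the hypothesis, which then says that \<open>C t\<close> preserves
  the norm of \<open>y\<close>.\<close>

lemma J1_C_eq_J2_of_initial:
  assumes t: "t > 0" and y: "y \<in> carrier (fib E2 t)"
    and initial: "adjoint_op (fib E2 t) (fib E1 t) (C t) (C t y) = y"
  shows "J1 t (C t y) = J2 t y"
proof (rule J1_C_eq_J2[OF t y])
  interpret two_hilbert "fib E2 t" "fib E1 t"
    by (simp add: two_hilbert_def J1.D.hilbert_fib[OF t] J2.D.hilbert_fib[OF t])
  let ?w = "J2.adj t (J1 t (C t y))"
  have eq: "cinner (fib E2 t) z ?w = cinner (fib E1 t) (C t z) (C t y)" if z: "z \<in> carrier (fib E2 t)" for z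
    using J2.cinner_adj_right[OF t _ z, of "J1 t (C t y)"] J1.cinner_adj_left[OF t _ C_mem[OF t y], of "J2 t z"]
      adj_J1_J2[OF t z] t y z by simp
  have "adjoint_op (fib E2 t) (fib E1 t) (C t) (C t y) = ?w"
    by (rule adjoint_op_eqI) (use t y eq in auto)
  then have "cinner (fib E2 t) y y = cinner (fib E1 t) (C t y) (C t y)" using eq[OF y] initial by simp
  then show "hnorm (fib E1 t) (C t y) = hnorm (fib E2 t) y" by (simp add: hnorm_def)
qed

text \<open>By minimality of the join, the subsystem generated by the union of the two ranges is all
  of \<open>E\<close>, so \<open>b t\<close> is orthogonal to itself. The union satisfies the
  splitting condition since each range is spanned by products of its own elements.\<close>

lemma root_orthogonal_zero:
  assumes u: "normalised_unit E u" and b: "is_root E u b"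
    and orth1: "\<And>t x. t > 0 \<Longrightarrow> x \<in> carrier (fib E1 t) \<Longrightarrow> cinner (fib E t) (J1 t x) (b t) = 0"
    and orth2: "\<And>t x. t > 0 \<Longrightarrow> x \<in> carrier (fib E2 t) \<Longrightarrow> cinner (fib E t) (J2 t x) (b t) = 0"
    and t: "t > 0"
  shows "b t = \<zero>\<^bsub>fib E t\<^esub>"
proof -
  interpret u: arveson_unit E u using u by unfold_locales
  define S where "S r = J1 r ` carrier (fib E1 r) \<union> J2 r ` carrier (fib E2 r)" for r
  have S: "S r \<subseteq> carrier (fib E r)" if "r > 0" for r using that by (auto simp: S_def)
  have split: "S (r + s) \<subseteq> closed_span (fib E (r + s)) {pmul E r s x y |x y. x \<in> S r \<and> y \<in> S s}"
    if rs: "r > 0" "s > 0" for r s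
  proof -
    have mono: "A \<subseteq> B \<Longrightarrow> closed_span (fib E (r + s)) A \<subseteq> closed_span (fib E (r + s)) B" for A B
      by (auto simp: closed_span_def)
    have "closed_span (fib E (r + s)) {pmul E r s x y |x y. x \<in> J1 r ` carrier (fib E1 r) \<and> y \<in> J1 s ` carrier (fib E1 s)}
      \<subseteq> closed_span (fib E (r + s)) {pmul E r s x y |x y. x \<in> S r \<and> y \<in> S s}"
      by (rule mono) (unfold S_def, blast)
    moreover have "closed_span (fib E (r + s)) {pmul E r s x y |x y. x \<in> J2 r ` carrier (fib E2 r) \<and> y \<in> J2 s ` carrier (fib E2 s)}
      \<subseteq> closed_span (fib E (r + s)) {pmul E r s x y |x y. x \<in> S r \<and> y \<in> S s}"
      by (rule mono) (unfold S_def, blast)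
    ultimately show ?thesis
      using J1.range_J_split[OF rs] J2.range_J_split[OF rs] unfolding S_def[of "r + s"] by blast
  qed
  have gen: "\<forall>t>0. J1 t ` carrier (fib E1 t) \<subseteq> {x. J1.E.generated S t x} \<and> J2 t ` carrier (fib E2 t) \<subseteq> {x. J1.E.generated S t x}"
    by (auto simp: S_def intro!: J1.E.generated.gen)
  have sub: "product_subsystem E (\<lambda>t. {x. J1.E.generated S t x})"
    by (rule J1.E.product_subsystem_generated[OF S split])
  \<comment> \<open>The minimality clause of \<open>is_join\<close>, applied to the generated
    subsystem.\<close>
  have "carrier (fib E t) \<subseteq> {x. J1.E.generated S t x}"
    using join[unfolded is_join_def, THEN conjunct2, THEN conjunct2, THEN spec, THEN mp, OF sub, THEN mp, OF gen] t
    by simp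
  then have "J1.E.generated S t (b t)" using is_rootD(2)[OF b t] by blast
  then have "cinner (fib E t) (b t) (b t) = 0"
    by (rule u.root_orthogonal_generated[OF S b, rotated -1]) (use orth1 orth2 in \<open>auto simp: S_def\<close>)
  then show ?thesis
    using hilbert_space.cinner_definite[OF J1.E.hilbert_fib[OF t] is_rootD(2)[OF b t]] by simp
qed

section \<open>Decomposition of roots over a common unit\<close>

context
  fixes u1 u2 u
  assumes u1: "normalised_unit E1 u1" and u2: "normalised_unit E2 u2" and u: "normalised_unit E u"
    and u1_u: "\<And>t. t > 0 \<Longrightarrow> J1 t (u1 t) = u t" and u2_u: "\<And>t. t > 0 \<Longrightarrow> J2 t (u2 t) = u t"
begin

lemma is_root_J1: "is_root E1 u1 a \<Longrightarrow> is_root E u (\<lambda>t. J1 t (a t))"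
  by (rule J1.is_root_J[where v = u1]) (simp_all add: normalised_unitD(2)[OF u1] u1_u)

lemma is_root_adj_J1: "is_root E u a \<Longrightarrow> is_root E1 u1 (\<lambda>t. J1.adj t (a t))"
  by (rule J1.is_root_adj[where u = u]) (simp_all add: normalised_unitD(2)[OF u1] u1_u)

lemma is_root_J2: "is_root E2 u2 a \<Longrightarrow> is_root E u (\<lambda>t. J2 t (a t))"
  by (rule J2.is_root_J[where v = u2]) (simp_all add: normalised_unitD(2)[OF u2] u2_u)

lemma is_root_adj_J2: "is_root E u a \<Longrightarrow> is_root E2 u2 (\<lambda>t. J2.adj t (a t))"
  by (rule J2.is_root_adj[where u = u]) (simp_all add: normalised_unitD(2)[OF u2] u2_u)

lemma root_decomposition:
  assumes a: "is_root E u a"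
  obtains a1 a2 where "is_root E1 u1 a1" "is_root E2 u2 a2"
    "a 1 = J1 1 (a1 1) \<oplus>\<^bsub>fib E 1\<^esub> J2 1 (a2 1)"
proof -
  interpret u: arveson_unit E u using u by unfold_locales
  define a2 where "a2 t = J2.adj t (a t)" for t
  have a2: "is_root E2 u2 a2" unfolding a2_def by (rule is_root_adj_J2[OF a])
  \<comment> \<open>The order of the two subtractions matters: the later one, along the range of
    \<open>J1\<close>, must preserve the orthogonality to the range of \<open>J2\<close> gained
    here, and only that direction of invariance has been established.\<close>
  define w where "w t = a t \<ominus>\<^bsub>fib E t\<^esub> J2 t (a2 t)" for t
  have w: "is_root E u w" unfolding w_def by (rule u.is_root_diff[OF a is_root_J2[OF a2]])
  define a1 where "a1 t = J1.adj t (w t)" for t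
  have a1: "is_root E1 u1 a1" unfolding a1_def by (rule is_root_adj_J1[OF w])
  define b where "b t = w t \<ominus>\<^bsub>fib E t\<^esub> J1 t (a1 t)" for t
  have b: "is_root E u b" unfolding b_def by (rule u.is_root_diff[OF w is_root_J1[OF a1]])
  note m = is_rootD(2)[OF a] is_rootD(2)[OF w] is_rootD(2)[OF a1] is_rootD(2)[OF a2]
  have w_orth: "cinner (fib E t) (J2 t y) (w t) = 0" if t: "t > 0" and y: "y \<in> carrier (fib E2 t)" for t y
  proof -
    interpret hilbert_space "fib E t" by (rule J1.E.hilbert_fib[OF t])
    show ?thesis
      using J2.cinner_J[OF t y m(4)[OF t]] J2.cinner_adj_right[OF t m(1)[OF t] y] m[OF t] t y
      by (simp add: w_def cinner_minus_right) (simp add: a2_def)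
  qed
  have "b 1 = \<zero>\<^bsub>fib E 1\<^esub>"
  proof (rule root_orthogonal_zero[OF u b])
    fix t x assume t: "t > 0" and x: "x \<in> carrier (fib E1 t)"
    interpret hilbert_space "fib E t" by (rule J1.E.hilbert_fib[OF t])
    show "cinner (fib E t) (J1 t x) (b t) = 0"
      using J1.cinner_J[OF t x m(3)[OF t]] J1.cinner_adj_right[OF t m(2)[OF t] x] m[OF t] t x
      by (simp add: b_def cinner_minus_right) (simp add: a1_def)
  next
    fix t y assume t: "t > 0" and y: "y \<in> carrier (fib E2 t)"
    interpret hilbert_space "fib E t" by (rule J1.E.hilbert_fib[OF t])
    obtain y' where y': "y' \<in> carrier (fib E2 t)" "J1 t (C t y) = J2 t y'"
      using J1_C_in_range_J2[OF t y] by auto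
    \<comment> \<open>Moving the projection onto the range of \<open>J1\<close> to the left turns
      \<open>J2 t y\<close> into \<open>J1 t (C t y)\<close>, which is again some
      \<open>J2 t y'\<close> and hence orthogonal to \<open>w t\<close>.\<close>
    have "cinner (fib E t) (J2 t y) (J1 t (a1 t)) = cinner (fib E1 t) (C t y) (a1 t)"
      using J1.cinner_adj_left[OF t J2.J_mem[OF t y] m(3)[OF t]] adj_J1_J2[OF t y] by simp
    also have "\<dots> = cinner (fib E t) (J2 t y') (w t)"
      using J1.cinner_adj_right[OF t m(2)[OF t] C_mem[OF t y]] y' by (simp add: a1_def)
    also have "\<dots> = 0" by (rule w_orth[OF t y'(1)])
    finally show "cinner (fib E t) (J2 t y) (b t) = 0"
      using w_orth[OF t y] m[OF t] t y by (simp add: b_def cinner_minus_right)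
  qed simp
  interpret hilbert_space "fib E 1" by (rule J1.E.hilbert_fib) simp
  have m1: "a 1 \<in> carrier (fib E 1)" "w 1 \<in> carrier (fib E 1)" "J1 1 (a1 1) \<in> carrier (fib E 1)"
    "J2 1 (a2 1) \<in> carrier (fib E 1)"
    using m[of 1] by auto
  have "w 1 = J1 1 (a1 1)" using \<open>b 1 = \<zero>\<^bsub>fib E 1\<^esub>\<close> m1 by (simp add: b_def)
  then have "a 1 = J1 1 (a1 1) \<oplus>\<^bsub>fib E 1\<^esub> J2 1 (a2 1)"
    by (intro hspace_eqI) (use m1 in \<open>auto simp: w_def cinner_simps simp flip: \<open>w 1 = J1 1 (a1 1)\<close>\<close>)
  then show ?thesis using that a1 a2 by blast
qed

lemma root_space_eq:
  "root_space E u = {J1 1 x \<oplus>\<^bsub>fib E 1\<^esub> J2 1 y |x y. x \<in> root_space E1 u1 \<and> y \<in> root_space E2 u2}"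
proof (intro equalityI subsetI)
  interpret u: arveson_unit E u using u by unfold_locales
  fix x assume "x \<in> root_space E u"
  then obtain a where a: "is_root E u a" "x = a 1" by (auto simp: root_space_def)
  obtain a1 a2 where "is_root E1 u1 a1" "is_root E2 u2 a2" "a 1 = J1 1 (a1 1) \<oplus>\<^bsub>fib E 1\<^esub> J2 1 (a2 1)"
    using root_decomposition[OF a(1)] by blast
  then show "x \<in> {J1 1 x \<oplus>\<^bsub>fib E 1\<^esub> J2 1 y |x y. x \<in> root_space E1 u1 \<and> y \<in> root_space E2 u2}"
    unfolding a(2) root_space_def by blast
next
  interpret u: arveson_unit E u using u by unfold_locales
  fix z assume "z \<in> {J1 1 x \<oplus>\<^bsub>fib E 1\<^esub> J2 1 y |x y. x \<in> root_space E1 u1 \<and> y \<in> root_space E2 u2}"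
  then obtain a1 a2 where a: "is_root E1 u1 a1" "is_root E2 u2 a2" "z = J1 1 (a1 1) \<oplus>\<^bsub>fib E 1\<^esub> J2 1 (a2 1)"
    by (auto simp: root_space_def)
  have "is_root E u (\<lambda>t. J1 t (a1 t) \<oplus>\<^bsub>fib E t\<^esub> J2 t (a2 t))"
    by (intro u.is_root_add is_root_J1[OF a(1)] is_root_J2[OF a(2)])
  then show "z \<in> root_space E u" unfolding a(3) root_space_def 
    by (intro CollectI exI[of _ "\<lambda>t. J1 t (a1 t) \<oplus>\<^bsub>fib E t\<^esub> J2 t (a2 t)"] conjI refl)
qed

lemma identified_root_space:
  "identified_amalgamated_sum (fib E 1) (root_space E u) (J1 1) (J2 1)
    (fib E1 1) (fib E2 1) (C 1) (root_space E1 u1) (root_space E2 u2)"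
proof (rule identified_amalgamated_sumI[OF _ _ _ _ _ _ _ _ _ root_space_eq])
  interpret u: arveson_unit E u using u by unfold_locales
  interpret u1: arveson_unit E1 u1 using u1 by unfold_locales
  interpret u2: arveson_unit E2 u2 using u2 by unfold_locales
  show "closed_subspace (fib E1 1) (root_space E1 u1)" by (rule u1.closed_subspace_root_space)
  show "closed_subspace (fib E2 1) (root_space E2 u2)" by (rule u2.closed_subspace_root_space)
  show "closed_subspace (fib E 1) (root_space E u)" by (rule u.closed_subspace_root_space)
qed (simp_all add: J1.E.hilbert_fib J1.D.hilbert_fib J2.D.hilbert_fib J1.isometric_J J2.isometric_J adj_J1_J2)

end

end

theorem theorem5p3:
  fixes E1 :: "'a arveson" and E2 :: "'b arveson" and E :: "'c arveson"
    and C :: "real \<Rightarrow> 'b \<Rightarrow> 'a" and J1 :: "real \<Rightarrow> 'a \<Rightarrow> 'c" and J2 :: "real \<Rightarrow> 'b \<Rightarrow> 'c"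
    and u2 :: "real \<Rightarrow> 'b"
  assumes "arveson_system E1" and "spatial E1"
    and "arveson_system E2" and "spatial E2"
    and "arveson_morphism E2 E1 C" and "partially_isometric_family E2 E1 C"
    and "amalgamated_product E1 E2 C E J1 J2"
    and "arveson_system E" and "arveson_morphism E1 E J1" and "arveson_morphism E2 E J2"
    and "normalised_unit E2 u2"
    and "\<forall>t>0. adjoint_op (fib E2 t) (fib E1 t) (C t) (C t (u2 t)) = u2 t"
  shows "let u1 = (\<lambda>t. C t (u2 t)); u = (\<lambda>t. J2 t (u2 t)) in
    normalised_unit E1 u1 \<and>
    (\<forall>t>0. J1 t (u1 t) = J2 t (u2 t)) \<and>
    normalised_unit E u \<and>
    identified_amalgamated_sum (fib E 1) (root_space E u) (J1 1) (J2 1)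
      (fib E1 1) (fib E2 1) (C 1) (root_space E1 u1) (root_space E2 u2)"
proof -
  interpret amalgam E1 E2 E J1 J2 C
    by unfold_locales (use assms in \<open>auto simp: amalgamated_product_def\<close>)
  let ?u1 = "\<lambda>t. C t (u2 t)" and ?u = "\<lambda>t. J2 t (u2 t)"
  have u12: "J1 t (?u1 t) = ?u t" if "t > 0" for t
    using J1_C_eq_J2_of_initial[OF that normalised_unitD(2)[OF assms(11) that]] assms(12) that by simp
  have u: "normalised_unit E ?u" by (rule J2.normalised_unit_J[OF assms(11)])
  \<comment> \<open>Measurability passes through \<open>C\<close>; norm and multiplicativity are
    pulled back from the unit of \<open>E\<close> along \<open>J1\<close>.\<close>
  have "measurable_section E1 ?u1"
    using assms(5) normalised_unitD(1)[OF assms(11)] by (simp add: arveson_morphism_def)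
  then have u1: "normalised_unit E1 ?u1" by (rule J1.normalised_unit_reflect[OF u _ u12])
  show ?thesis
    unfolding Let_def using u1 u12 u identified_root_space[OF u1 assms(11) u u12 refl] by blast
qed

end
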